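(* In a neighborhood of $(x,y)=(0,0)$, with $|\Lambda_1^2|<1$, $|1-\Lambda_2^2|<1$ and $$x=\frac{4\Lambda_1\Lambda_2}{(\Lambda_1+\Lambda_2)^2},\qquad y=-\frac{(1-\Lambda_1^2)(1-\Lambda_2^2)}{(\Lambda_1+\Lambda_2)^2},$$ let $$\begin{aligned} \Pi_0(x,y)&=\frac{4}{\pi^2}(\Lambda_1+\Lambda_2)K(\Lambda_1^2)K(1-\Lambda_2^2),\\ \Pi_1(x,y)&=\frac{4i}{\pi^2}(\Lambda_1+\Lambda_2)K(1-\Lambda_1^2)K(1-\Lambda_2^2),\\ \Pi_2(x,y)&=\frac{4i}{\pi^2}(\Lambda_1+\Lambda_2)K(\Lambda_1^2)K(\Lambda_2^2), \end{aligned}$$ and introduce the canonical coordinates $$\tau_1=\frac{\Pi_1(x,y)}{\Pi_0(x,y)}=i\frac{K(1-\Lambda_1^2)}{K(\Lambda_1^2)},\qquad \tau_2=\frac{\Pi_2(x,y)}{\Pi_0(x,y)}=i\frac{K(\Lambda_2^2)}{K(1-\Lambda_2^2)},$$ so that $\tau_1$ depends solely on $\Lambda_1$ and $\tau_2$ solely on $\Lambda_2$. Then the mirror map is $$\Lambda_1^2(\tau_1)=\lambda(\tau_1)=\frac{\theta_2(\tau_1)^4}{\theta_3(\tau_1)^4},\qquad \Lambda_2^2(\tau_2)=1-\lambda(\tau_2)=\frac{\theta_4(\tau_2)^4}{\theta_3(\tau_2)^4},$$ and the holomorphic period in modular coordinates is $$\Pi_0(\tau_1,\tau_2)=\theta_2(\tau_1)^2\theta_3(\tau_2)^2+\theta_4(\tau_2)^2\theta_3(\tau_1)^2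 .$$ Moreover, $\Pi_0(\tau_1,\tau_2)$ is a modular form of weight $(1,1)$ and trivial character with respect to the monodromy group $\Gamma(2)\times\Gamma(2)$, and the mirror map is a modular function.
   Context: $\Pi_0,\Pi_1,\Pi_2$ are three of the four elements of a basis of solutions, near $(x,y)=(0,0)$, of the Picard–Fuchs system of the holomorphic two-form $\frac{dt_1\wedge dt_2}{\sqrt{t_1t_2(1-t_1)(1-t_2)(1-z_1t_1-(1-z_2)t_2)}}$ on a two-parameter family of K3 surfaces, where $(x,y)$ corresponds to $(z_1,1-z_2)$. This is the Appell $F_2$ system with $\alpha=\beta_1=\beta_2=\tfrac12$, $\gamma_1=\gamma_2=1$: $x(1-x)F_{xx}-xyF_{xy}+(1-2x)F_x-\tfrac12 yF_y-\tfrac14F=0$ and $y(1-y)F_{yy}-xyF_{xy}+(1-2y)F_y-\tfrac12 xF_x-\tfrac14F=0$. The fourth basis element is $\Pi_3=\frac{4i^2}{\pi^2}(\Lambda_1+\Lambda_2)K(1-\Lambda_1^2)K(\Lambda_2^2)$. $K$ is the complete elliptic integral of the first kind as a function of the parameter: $K(m)=\frac{\pi}{2}\,{}_2F_1(\tfrac12,\tfrac12;1;m)$. The Jacobi theta functions are $\theta_2(\tau)=\sum_{n\in\mathbb{Z}}q^{(n+1/2)^2}$, $\theta_3(\tau)=\sum_{n\in\mathbb{Z}}q^{n^2}$, $\theta_4(\tau)=\sum_{n\in\mathbb{Z}}(-1)^nq^{n^2}$, with $q=e^{\pi i\tau}$, and $\lambda=\theta_2^4/\theta_3^4$ is the Hauptmodul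 of $\Gamma(2)$, the principal congruence subgroup of level 2 of $SL_2(\mathbb{Z})$. A modular form of two variables of weight $(k_1,k_2)$ and character $\chi$ with respect to $\Gamma_1\times\Gamma_2$ is a function $F(\tau_1,\tau_2)$ on the product of two (extended) upper half-planes, meromorphic there, with $F(\gamma_1\tau_1,\gamma_2\tau_2)=\chi(\gamma_1,\gamma_2)(c_1\tau_1+d_1)^{k_1}(c_2\tau_2+d_2)^{k_2}F(\tau_1,\tau_2)$ for all $\gamma_i=\begin{pmatrix}a_i&b_i\\c_i&d_i\end{pmatrix}\in\Gamma_i$; trivial character means $\chi=1$.
   Formalization: Trivial character on Γ(2)×Γ(2) fails for Π_0 (θ_2(τ+2)^2=-θ_2(τ)^2; also (-I,I)); it is proved on the exact subgroup where it holds, and each summand gets a quadratic character. Λ_2(0,0)=1 is fixed; K(1-Λ_1^2), K(Λ_2^2) are continued analytically, x,y≠0. *)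

theory Defs
  imports "HOL-Analysis.Analysis"
begin

section \<open>The complete elliptic integral as a function of the parameter\<close>

text \<open>The principal branch of the Gauss hypergeometric function: the (unique) analytic continuation
  of the series from the unit disc to the plane cut along the real interval from 1 to infinity.\<close>

definition hyp2F1 :: "complex \<Rightarrow> complex \<Rightarrow> complex \<Rightarrow> complex \<Rightarrow> complex" where
  "hyp2F1 a b c = (SOME f. f holomorphic_on - (complex_of_real ` {1..}) \<and>
     (\<forall>z\<in>ball 0 1. f z = eval_fps (fps_hypergeo [a, b] [c] 1) z))"

definition ellK :: "complex \<Rightarrow> complex" where
  "ellK m = of_real pi / 2 * hyp2F1 (1/2) (1/2) 1 m"

text \<open>For \<open>0 < |m| < 1\<close> the function \<open>K(1 - m)\<close> has a logarithmic branch point at \<open>m = 0\<close>. It is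
  single-valued in the coordinate \<open>v = log m\<close>, \<open>Re v < 0\<close>, on the universal cover of the punctured
  disc: \<open>ellK_compl v\<close> is the analytic continuation, to this half-plane, of the principal value
  \<open>K(1 - exp v)\<close>, which is holomorphic in the strip \<open>|Im v| < pi\<close>. Letting \<open>v\<close> range over all logarithms of
  \<open>m\<close> gives all branches of \<open>K(1 - m)\<close>, also for \<open>m\<close> on the cut.\<close>

definition ellK_compl :: "complex \<Rightarrow> complex" where
  "ellK_compl = (SOME f. f holomorphic_on {v. Re v < 0} \<and>
     (\<forall>v. Re v < 0 \<and> \<bar>Im v\<bar> < pi \<longrightarrow> f v = ellK (1 - exp v)))"


section \<open>Theta functions\<close>

definition upper_half :: "complex set" where
  "upper_half = {\<tau>. Im \<tau> > 0}"

definition theta2 :: "complex \<Rightarrow> complex" where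
  "theta2 \<tau> = (\<Sum>\<^sub>\<infinity>n\<in>(UNIV :: int set). exp (of_real pi * \<i> * \<tau> * (of_int n + 1/2)\<^sup>2))"

definition theta3 :: "complex \<Rightarrow> complex" where
  "theta3 \<tau> = (\<Sum>\<^sub>\<infinity>n\<in>(UNIV :: int set). exp (of_real pi * \<i> * \<tau> * (of_int n)\<^sup>2))"

definition theta4 :: "complex \<Rightarrow> complex" where
  "theta4 \<tau> = (\<Sum>\<^sub>\<infinity>n\<in>(UNIV :: int set).
     (-1) powi n * exp (of_real pi * \<i> * \<tau> * (of_int n)\<^sup>2))"

definition modular_lambda :: "complex \<Rightarrow> complex" where
  "modular_lambda \<tau> = theta2 \<tau> ^ 4 / theta3 \<tau> ^ 4"


section \<open>The coordinates and the periods near the origin\<close>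

text \<open>A choice of \<open>\<Lambda>\<^sub>1, \<Lambda>\<^sub>2\<close> as continuous functions of \<open>(x, y)\<close> in a neighbourhood of the origin.
  The equations are invariant under a simultaneous change of sign of \<open>\<Lambda>\<^sub>1, \<Lambda>\<^sub>2\<close>, which negates the
  periods; \<open>\<Lambda>\<^sub>2(0,0) = 1\<close> is the choice with \<open>\<Pi>\<^sub>0(0,0) = 1\<close> (the other possible value is \<open>-1\<close>).
  The denominator never vanishes under these conditions: division by zero in HOL gives zero, so it
  could vanish only at \<open>(0,0)\<close>, where \<open>\<Lambda>\<^sub>2 = 1\<close> and \<open>|\<Lambda>\<^sub>1| < 1\<close>.\<close>

definition Lambda_coordinates ::
  "(complex \<times> complex) set \<Rightarrow> (complex \<times> complex \<Rightarrow> complex) \<Rightarrow> (complex \<times> complex \<Rightarrow> complex) \<Rightarrow> bool"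
  where
  "Lambda_coordinates U L1 L2 \<longleftrightarrow>
     open U \<and> connected U \<and> (0, 0) \<in> U \<and>
     continuous_on U L1 \<and> continuous_on U L2 \<and> L2 (0, 0) = 1 \<and>
     (\<forall>x y. (x, y) \<in> U \<longrightarrow>
        norm ((L1 (x, y))\<^sup>2) < 1 \<and> norm (1 - (L2 (x, y))\<^sup>2) < 1 \<and>
        x = 4 * L1 (x, y) * L2 (x, y) / (L1 (x, y) + L2 (x, y))\<^sup>2 \<and>
        y = - ((1 - (L1 (x, y))\<^sup>2) * (1 - (L2 (x, y))\<^sup>2)) / (L1 (x, y) + L2 (x, y))\<^sup>2)"

definition Period0 :: "complex \<Rightarrow> complex \<Rightarrow> complex" where
  "Period0 l1 l2 = 4 / (of_real pi)\<^sup>2 * (l1 + l2) * ellK (l1\<^sup>2) * ellK (1 - l2\<^sup>2)"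

text \<open>\<open>v1\<close> is a logarithm of \<open>l1\<^sup>2\<close> and selects the branch of \<open>K(1 - l1\<^sup>2)\<close>; \<open>v2\<close> is a logarithm of
  \<open>1 - l2\<^sup>2\<close> and selects the branch of \<open>K(l2\<^sup>2)\<close>.\<close>

definition Period1 :: "complex \<Rightarrow> complex \<Rightarrow> complex \<Rightarrow> complex" where
  "Period1 v1 l1 l2 = 4 * \<i> / (of_real pi)\<^sup>2 * (l1 + l2) * ellK_compl v1 * ellK (1 - l2\<^sup>2)"

definition Period2 :: "complex \<Rightarrow> complex \<Rightarrow> complex \<Rightarrow> complex" where
  "Period2 v2 l1 l2 = 4 * \<i> / (of_real pi)\<^sup>2 * (l1 + l2) * ellK (l1\<^sup>2) * ellK_compl v2"

definition Period0_modular :: "complex \<Rightarrow> complex \<Rightarrow> complex" where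
  "Period0_modular \<tau>1 \<tau>2 =
     (theta2 \<tau>1)\<^sup>2 * (theta3 \<tau>2)\<^sup>2 + (theta4 \<tau>2)\<^sup>2 * (theta3 \<tau>1)\<^sup>2"


section \<open>Modular forms of two variables\<close>

definition SL2Z :: "(int ^ 2 ^ 2) set" where
  "SL2Z = {\<gamma>. det \<gamma> = 1}"

definition Gamma2 :: "(int ^ 2 ^ 2) set" where
  "Gamma2 = {\<gamma> \<in> SL2Z. \<forall>i j. \<gamma> $ i $ j mod 2 = (mat 1 :: int ^ 2 ^ 2) $ i $ j mod 2}"

definition automorphy :: "int ^ 2 ^ 2 \<Rightarrow> complex \<Rightarrow> complex" where
  "automorphy \<gamma> \<tau> = of_int (\<gamma> $ 2 $ 1) * \<tau> + of_int (\<gamma> $ 2 $ 2)"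

definition moeb :: "int ^ 2 ^ 2 \<Rightarrow> complex \<Rightarrow> complex" where
  "moeb \<gamma> \<tau> = (of_int (\<gamma> $ 1 $ 1) * \<tau> + of_int (\<gamma> $ 1 $ 2)) / automorphy \<gamma> \<tau>"

definition holomorphic2_on :: "(complex \<times> complex \<Rightarrow> complex) \<Rightarrow> (complex \<times> complex) set \<Rightarrow> bool" where
  "holomorphic2_on f U \<longleftrightarrow>
     (\<forall>p\<in>U. \<exists>a b. (f has_derivative (\<lambda>(h, k). a * h + b * k)) (at p))"

text \<open>In two variables a meromorphic function is locally a quotient of holomorphic functions, whose
  denominator vanishes identically on no nonempty open set. Values of \<open>f\<close> on the zero set of the
  denominator are irrelevant.\<close>

definition meromorphic2_at :: "(complex \<times> complex \<Rightarrow> complex) \<Rightarrow> complex \<times> complex \<Rightarrow> bool" where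
  "meromorphic2_at f p \<longleftrightarrow>
     (\<exists>U g h. open U \<and> p \<in> U \<and> holomorphic2_on g U \<and> holomorphic2_on h U \<and>
        (\<forall>V. open V \<and> V \<noteq> {} \<and> V \<subseteq> U \<longrightarrow> (\<exists>z\<in>V. h z \<noteq> 0)) \<and>
        (\<forall>z\<in>U. h z \<noteq> 0 \<longrightarrow> f z = g z / h z))"

text \<open>Meromorphy of a form of weight \<open>(k1, k2)\<close> on the product of the extended half-planes: after
  moving any pair of cusps to infinity, the form is a function of the local parameters
  \<open>exp(2 pi i \<tau>\<^sub>j / N)\<close> that is meromorphic on the product of the full unit discs. The point \<open>0\<close> of each disc
  is the cusp, so this covers pairs of interior points, of cusps, and mixed pairs.\<close>

definition meromorphic_extended :: "int \<Rightarrow> int \<Rightarrow> (complex \<Rightarrow> complex \<Rightarrow> complex) \<Rightarrow> bool" where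
  "meromorphic_extended k1 k2 F \<longleftrightarrow>
     (\<forall>\<gamma>1\<in>SL2Z. \<forall>\<gamma>2\<in>SL2Z. \<exists>(N::nat) G. N > 0 \<and>
        (\<forall>\<tau>1\<in>upper_half. \<forall>\<tau>2\<in>upper_half.
           automorphy \<gamma>1 \<tau>1 powi (- k1) * automorphy \<gamma>2 \<tau>2 powi (- k2) *
             F (moeb \<gamma>1 \<tau>1) (moeb \<gamma>2 \<tau>2)
           = G (exp (2 * of_real pi * \<i> * \<tau>1 / of_nat N), exp (2 * of_real pi * \<i> * \<tau>2 / of_nat N))) \<and>
        (\<forall>p \<in> ball 0 1 \<times> ball 0 1. meromorphic2_at G p))"

definition transforms_under ::
  "int ^ 2 ^ 2 \<Rightarrow> int ^ 2 ^ 2 \<Rightarrow> int \<Rightarrow> int \<Rightarrow> complex \<Rightarrow> (complex \<Rightarrow> complex \<Rightarrow> complex) \<Rightarrow> bool" where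
  "transforms_under \<gamma>1 \<gamma>2 k1 k2 c F \<longleftrightarrow>
     (\<forall>\<tau>1\<in>upper_half. \<forall>\<tau>2\<in>upper_half.
        F (moeb \<gamma>1 \<tau>1) (moeb \<gamma>2 \<tau>2) =
          c * automorphy \<gamma>1 \<tau>1 powi k1 * automorphy \<gamma>2 \<tau>2 powi k2 * F \<tau>1 \<tau>2)"

text \<open>\<open>G\<close> is a subgroup of \<open>SL2Z \<times> SL2Z\<close>, not necessarily a product of two subgroups.\<close>

definition modular_form2 ::
  "((int ^ 2 ^ 2) \<times> (int ^ 2 ^ 2)) set \<Rightarrow> int \<Rightarrow> int \<Rightarrow> (int ^ 2 ^ 2 \<Rightarrow> int ^ 2 ^ 2 \<Rightarrow> complex) \<Rightarrow>
     (complex \<Rightarrow> complex \<Rightarrow> complex) \<Rightarrow> bool" where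
  "modular_form2 G k1 k2 ch F \<longleftrightarrow>
     meromorphic_extended k1 k2 F \<and>
     (\<forall>(\<gamma>1, \<gamma>2)\<in>G. transforms_under \<gamma>1 \<gamma>2 k1 k2 (ch \<gamma>1 \<gamma>2) F)"

abbreviation trivial_character :: "int ^ 2 ^ 2 \<Rightarrow> int ^ 2 ^ 2 \<Rightarrow> complex" where
  "trivial_character \<equiv> \<lambda>_ _. 1"

text \<open>No nonzero function of weight \<open>(1,1)\<close> has trivial character on all of \<open>Gamma2 \<times> Gamma2\<close>, since this group
  contains \<open>(-I, I)\<close>; moreover \<open>\<theta>\<^sub>2(\<tau> + 2)\<^sup>2 = - \<theta>\<^sub>2(\<tau>)\<^sup>2\<close>. On \<open>Gamma2 \<times> Gamma2\<close> the two summands of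
  \<open>Period0_modular\<close> have weight \<open>(1,1)\<close> and the quadratic characters \<open>chi_a\<close>, \<open>chi_b\<close> below. Their sum has
  trivial character on \<open>Gamma2_period\<close>, the common kernel, which has index 4
  in \<open>Gamma2 \<times> Gamma2\<close>.\<close>

definition chi_a :: "int ^ 2 ^ 2 \<Rightarrow> int ^ 2 ^ 2 \<Rightarrow> complex" where
  "chi_a \<gamma>1 \<gamma>2 =
     (-1) powi ((\<gamma>1 $ 2 $ 2 - 1) div 2 + (\<gamma>2 $ 2 $ 2 - 1) div 2 + \<gamma>1 $ 1 $ 2 div 2)"

definition chi_b :: "int ^ 2 ^ 2 \<Rightarrow> int ^ 2 ^ 2 \<Rightarrow> complex" where
  "chi_b \<gamma>1 \<gamma>2 =
     (-1) powi ((\<gamma>1 $ 2 $ 2 - 1) div 2 + (\<gamma>2 $ 2 $ 2 - 1) div 2 + \<gamma>2 $ 2 $ 1 div 2)"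

definition Gamma2_period :: "((int ^ 2 ^ 2) \<times> (int ^ 2 ^ 2)) set" where
  "Gamma2_period = {(\<gamma>1, \<gamma>2) \<in> Gamma2 \<times> Gamma2. chi_a \<gamma>1 \<gamma>2 = 1 \<and> chi_b \<gamma>1 \<gamma>2 = 1}"

end

theory Submission
  imports Defs "HOL-Complex_Analysis.Complex_Analysis"
begin

text \<open>Everything rests on Landen's transformation \<open>F(m) = (1 + k) F(k\<^sup>2)\<close>,
  \<open>k = (1 - \<surd>(1 - m)) / (1 + \<surd>(1 - m))\<close>, of \<open>F(m) = 2 K(m) / \<pi>\<close>, and on the fact that \<open>m \<mapsto> k\<^sup>2\<close>
  corresponds to \<open>\<tau> \<mapsto> 2 \<tau>\<close> under \<open>m = \<lambda>(\<tau>)\<close>, by the duplication formulas of the theta functions.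
  The transformation extends \<open>F\<close> to the slit plane, since \<open>|k| < 1\<close> there. In the coordinate \<open>v = log m\<close> it is a
  self-map \<open>L\<close> of the half-plane \<open>Re v < 0\<close> with \<open>Re L(v) \<le> 2 Re v\<close>, and \<open>lim L\<^sup>n(v) / 2\<^sup>n\<close> is a holomorphic
  function \<open>\<pi> \<i> \<tau>(v)\<close> with \<open>Im \<tau>(v) > 0\<close>. On the imaginary axis it inverts \<open>log \<lambda>\<close>, and iteration gives
  \<open>F(\<lambda>(\<tau>)) = \<theta>\<^sub>3(\<tau>)\<^sup>2\<close>; the identity theorem extends these relations to the half-plane.

  The quotient \<open>g(t) = F(1 - \<lambda>(\<i> t)) / F(\<lambda>(\<i> t))\<close> satisfies \<open>g(2 t) = 2 g(t)\<close>, and \<open>g(t) \<sim> t\<close> at infinity by the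
  logarithmic singularity of \<open>F\<close> at 1. Hence \<open>g(t) = t\<close>, which identifies \<open>\<tau>(v)\<close> with \<open>\<i> K(1 - m) / K(m)\<close> and
  also yields the inversion formulas for the theta functions without Poisson summation. Modularity then
  follows from Euclid's algorithm.\<close>

section \<open>The hypergeometric series\<close>

text \<open>The two sides of the theorem come from unrelated series but obey the same doubling law,
  so a quotient that is unchanged by t \<mapsto> 2 t can be evaluated by its limit along t, 2 t, 4
  t, .... The hypergeometric equation enters only in the formal proof of Landen's transformation.
  The inverse of \<lambda> is taken by the explicit \<open>tau_of\<close>, a right inverse:
  \<lambda>(\<open>tau_of v\<close>) = exp v. Its limit exists because \<open>landen_step\<close>
  differs from v \<mapsto> 2 v by a bounded term. The lift to v = log m makes K(1 - m) single-valued
  and at the same time supplies a single-valued root exp(v/2) of m. Roots matter because \<Pi>0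
  contains \<Lambda>1 + \<Lambda>2 and not only squares: the relations between theta functions must
  hold for their squares, not merely for fourth powers, and the signs of \<Lambda>1 and \<Lambda>2
  must be followed. The same signs are the source of \<open>chi_a\<close> and \<open>chi_b\<close>:
  the squares of the theta functions acquire signs under \<Gamma>(2), which disappear in
  \<lambda>.\<close>

abbreviation hyp_fps :: "complex fps" where
  "hyp_fps \<equiv> fps_hypergeo [1/2, 1/2] [1] 1"

definition hypF :: "complex \<Rightarrow> complex" where
  "hypF = eval_fps hyp_fps"

lemma hyp_fps_Suc:
  "(of_nat (Suc n))\<^sup>2 * fps_nth hyp_fps (Suc n) = (of_nat n + 1/2)\<^sup>2 * fps_nth hyp_fps n"
proof -
  define N :: complex where "N = of_nat (Suc n)"
  have N: "N \<noteq> 0" "of_nat n = N - 1"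
    unfolding N_def by (simp_all only: of_nat_eq_0_iff) simp_all
  show ?thesis
    unfolding fps_hypergeo_rec N_def[symmetric] N(2) using N(1)
    by (simp add: field_simps power2_eq_square del: of_nat_Suc fps_hypergeo_nth)
qed

text \<open>This is Legendre's equation m (1 - m) F'' + (1 - 2 m) F' = F / 4 for the periods of
  elliptic curves. Comparing coefficients turns it into the recurrence
  \<open>hyp_fps_Suc\<close>.\<close>

lemma hyp_fps_ode:
  "fps_X * (1 - fps_X) * fps_deriv (fps_deriv hyp_fps) + (1 - 2 * fps_X) * fps_deriv hyp_fps
     = fps_const (1/4) * hyp_fps"
proof (rule fps_ext)
  fix n
  have eq: "fps_X * (1 - fps_X) * fps_deriv (fps_deriv hyp_fps) + (1 - 2 * fps_X) * fps_deriv hyp_fps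
    = fps_X * fps_deriv (fps_deriv hyp_fps) - fps_X * (fps_X * fps_deriv (fps_deriv hyp_fps))
      + fps_deriv hyp_fps - fps_const 2 * (fps_X * fps_deriv hyp_fps)"
    by (simp add: algebra_simps fps_numeral_fps_const)
  show "fps_nth (fps_X * (1 - fps_X) * fps_deriv (fps_deriv hyp_fps) + (1 - 2 * fps_X) * fps_deriv hyp_fps) n
    = fps_nth (fps_const (1/4) * hyp_fps) n"
    unfolding eq using hyp_fps_Suc[of n]
    by (cases n rule: nat.exhaust[case_names 0 Suc]; cases "n - 1")
       (auto simp: fps_X_mult_nth algebra_simps power2_eq_square simp del: fps_hypergeo_nth)
qed

text \<open>\<open>P\<close> is the series of 4 x / (1 + x)^2, the parameter m in terms of the
  Landen modulus k = x. Legendre's equation at m = P becomes x (1 - x^2) Y'' + (1 - 3 x^2) Y' - x Y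
  = 0 for Y = F(P) / (1 + x). The coefficient recurrence of this equation determines a power series
  with Y(0) = 1, and F(x^2) satisfies it.\<close>

lemma hyp_fps_landen:
  assumes P: "P * (1 + fps_X)\<^sup>2 = 4 * fps_X" and P0: "fps_nth P 0 = 0"
  shows "hyp_fps oo P = (1 + fps_X) * (hyp_fps oo fps_X\<^sup>2)"
proof -
  define u :: "complex fps" where "u = 1 + fps_X"
  define x :: "complex fps" where "x = fps_X"
  have ux: "u = 1 + x" and u0: "fps_nth u 0 \<noteq> 0" "u \<noteq> 0"
    by (auto simp: u_def x_def)
  have [simp]: "fps_deriv u = 1" "fps_deriv x = 1"
    by (simp_all add: u_def x_def)
  define f0 where "f0 = hyp_fps oo P"
  define f1 where "f1 = fps_deriv hyp_fps oo P"
  define f2 where "f2 = fps_deriv (fps_deriv hyp_fps) oo P"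
  define P1 where "P1 = fps_deriv P"
  define P2 where "P2 = fps_deriv P1"
  define Y where "Y = f0 * inverse u"
  define Y1 where "Y1 = fps_deriv Y"
  define Y2 where "Y2 = fps_deriv Y1"
  have d: "fps_deriv f0 = f1 * P1" "fps_deriv f1 = f2 * P1"
    unfolding f0_def f1_def f2_def P1_def by (simp_all add: fps_compose_deriv P0)
  have Y: "u * Y = f0"
    using u0 by (simp add: Y_def inverse_mult_eq_1' mult.left_commute)
  have Y1: "u * Y1 = f1 * P1 - Y"
    using arg_cong[OF Y, of fps_deriv] by (simp add: d flip: Y1_def) (simp add: algebra_simps)
  have Y2: "u * Y2 = f2 * P1\<^sup>2 + f1 * P2 - 2 * Y1"
    using arg_cong[OF Y1, of fps_deriv]
    by (simp add: d flip: Y1_def Y2_def P2_def) (simp add: algebra_simps power2_eq_square)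
  have hP: "P * u\<^sup>2 = 4 * x"
    using P by (simp add: u_def x_def)
  have "P1 * u\<^sup>2 + 2 * P * u = 4"
    using arg_cong[OF hP, of fps_deriv]
    by (simp add: power2_eq_square flip: P1_def) (simp add: algebra_simps)
  then have "u * (P1 * u\<^sup>2 + 2 * P * u) = u * 4" by simp
  then have hP1: "P1 * u^3 = 4 - 4 * x"
    using hP ux by algebra
  have "P2 * u^3 + 3 * P1 * u\<^sup>2 = - 4"
    using arg_cong[OF hP1, of fps_deriv]
    by (simp add: eval_nat_numeral flip: P2_def) (simp add: algebra_simps)
  then have "u * (P2 * u^3 + 3 * P1 * u\<^sup>2) = u * (- 4)" by simp
  then have hP2: "P2 * u^4 = 8 * x - 16"
    using hP1 ux by algebra
  have "(fps_X * (1 - fps_X) * fps_deriv (fps_deriv hyp_fps) + (1 - 2 * fps_X) * fps_deriv hyp_fps) oo P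
     = (fps_const (1/4) * hyp_fps) oo P"
    by (simp only: hyp_fps_ode)
  then have "P * (1 - P) * f2 + (1 - 2 * P) * f1 = fps_const (1/4) * f0"
    by (simp add: fps_compose_add_distrib fps_compose_mult_distrib P0 fps_compose_sub_distrib
        fps_X_fps_compose_startby0 fps_const_mult_apply_left fps_numeral_fps_const flip: f0_def f1_def f2_def)
  then have "4 * (P * (1 - P) * f2 + (1 - 2 * P) * f1) = (4 * fps_const (1/4)) * f0"
    by (simp add: mult.assoc)
  also have "4 * fps_const (1/4) = (1 :: complex fps)"
    by (simp add: fps_numeral_fps_const)
  finally have ode: "4 * P * (1 - P) * f2 + 4 * (1 - 2 * P) * f1 = f0"
    by (simp add: algebra_simps)
  \<comment> \<open>The identity x u^2 P'^2 = 4 P (1 - P) makes the coefficients of F'' agree, so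
    that \<open>f2\<close> can be eliminated by the equation. As here, identities are proved after
    multiplication by a power of \<open>u\<close>, which is then cancelled.\<close>
  have s1: "x * u\<^sup>2 * P1\<^sup>2 * u^4 = 4 * P * (1 - P) * u^4"
    using hP hP1 ux by algebra
  then have s1: "x * u\<^sup>2 * P1\<^sup>2 = 4 * P * (1 - P)"
    using u0 by simp
  have s2: "x * u\<^sup>2 * (u * Y2) = f0 - 4 * (1 - 2 * P) * f1 + x * u\<^sup>2 * f1 * P2 - 2 * x * u\<^sup>2 * Y1"
    using s1 Y2 ode by algebra
  have "u^4 * (x * (1 - x\<^sup>2) * Y2 + (1 - 3 * x\<^sup>2) * Y1 - x * Y) = 0"
    using s2 Y Y1 hP hP1 hP2 ux by algebra
  then have E: "x * (1 - x\<^sup>2) * Y2 + (1 - 3 * x\<^sup>2) * Y1 - x * Y = 0"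
    using u0 by simp
  \<comment> \<open>The coefficient of x^n in \<open>E\<close> links the indices n + 1 and n - 1
    only; n = 0 gives Y_1 = 0, hence all odd coefficients vanish.\<close>
  have rec: "(of_nat (Suc n))\<^sup>2 * fps_nth Y (Suc n) = (if n = 0 then 0 else (of_nat n)\<^sup>2 * fps_nth Y (n - 1))" for n
  proof -
    have "fps_X * fps_deriv (fps_deriv Y) - fps_X * (fps_X * (fps_X * fps_deriv (fps_deriv Y)))
      + fps_deriv Y - fps_const 3 * (fps_X * (fps_X * fps_deriv Y)) - fps_X * Y = 0"
      using E unfolding x_def Y2_def Y1_def
      by (simp add: algebra_simps power2_eq_square fps_numeral_fps_const)
    then have "fps_nth (fps_X * fps_deriv (fps_deriv Y) - fps_X * (fps_X * (fps_X * fps_deriv (fps_deriv Y)))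
      + fps_deriv Y - fps_const 3 * (fps_X * (fps_X * fps_deriv Y)) - fps_X * Y) n = 0"
      by simp
    then show ?thesis
      by (cases n; cases "n - 1"; cases "n - 2")
       (auto simp: fps_X_mult_nth algebra_simps power2_eq_square)
  qed
  have Y0: "fps_nth Y 0 = 1"
    using arg_cong[OF Y, of "\<lambda>f. fps_nth f 0"] by (simp add: u_def f0_def del: fps_hypergeo_nth)
  have "fps_nth Y n = fps_nth (hyp_fps oo fps_X\<^sup>2) n" for n
  proof (induction n rule: less_induct)
    case (less n)
    show ?case
    proof (cases n)
      case 0
      then show ?thesis using Y0 by (simp del: fps_hypergeo_nth)
    next
      case (Suc m)
      have nz: "(of_nat (Suc m))\<^sup>2 \<noteq> (0::complex)"
        by (simp only: power_eq_0_iff of_nat_eq_0_iff) simp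
      show ?thesis
      proof (cases m)
        case 0
        then show ?thesis using rec[of 0] Suc by (simp add: fps_nth_compose_X_power del: fps_hypergeo_nth)
      next
        case (Suc l)
        have "fps_nth Y l = fps_nth (hyp_fps oo fps_X\<^sup>2) l"
          using less Suc \<open>n = Suc m\<close> by auto
        then have *: "(of_nat (Suc m))\<^sup>2 * fps_nth Y (Suc m) = (of_nat m)\<^sup>2 * fps_nth (hyp_fps oo fps_X\<^sup>2) l"
          using rec[of m] Suc by simp
        have "(of_nat m)\<^sup>2 * fps_nth (hyp_fps oo fps_X\<^sup>2) l = (of_nat (Suc m))\<^sup>2 * fps_nth (hyp_fps oo fps_X\<^sup>2) (Suc m)"
        proof (cases "even l")
          case True
          then obtain j where j: "l = 2 * j" by blast
          have "Suc m div 2 = Suc j" "l div 2 = j" "even (Suc m)" using j Suc by auto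
          \<comment> \<open>Four times the recurrence of F, read for the exponents 2 j and 2 j + 2
            of F(x^2).\<close>
          have "(2 * of_nat j + 1)\<^sup>2 * fps_nth hyp_fps j = (2 * of_nat j + 2)\<^sup>2 * fps_nth hyp_fps (Suc j)"
            using hyp_fps_Suc[of j] unfolding of_nat_Suc by algebra
          with \<open>Suc m div 2 = Suc j\<close> \<open>l div 2 = j\<close> \<open>even (Suc m)\<close> True j Suc show ?thesis
            by (simp add: fps_nth_compose_X_power add_ac del: fps_hypergeo_nth)
        qed (use Suc in \<open>auto simp: fps_nth_compose_X_power simp del: fps_hypergeo_nth\<close>)
        with * nz \<open>n = Suc m\<close> show ?thesis by simp
      qed
    qed
  qed
  then have "Y = hyp_fps oo fps_X\<^sup>2" by (rule fps_ext)
  with Y show ?thesis by (simp add: f0_def u_def)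
qed


section \<open>Convergence in the unit disc\<close>

lemma hyp_fps_nz: "fps_nth hyp_fps n \<noteq> 0"
proof (induction n)
  case (Suc n)
  have "(of_nat n + 1/2 :: complex) \<noteq> 0"
    by (auto simp: complex_eq_iff)
  then show ?case using hyp_fps_Suc[of n] Suc by (auto simp del: fps_hypergeo_nth)
qed simp

lemma fps_conv_radius_hyp_fps: "fps_conv_radius hyp_fps = 1"
  unfolding fps_conv_radius_def
proof (rule conv_radius_ratio_limit_nonzero)
  have "norm (fps_nth hyp_fps n) / norm (fps_nth hyp_fps (Suc n)) = (real (Suc n) / (real n + 1/2))\<^sup>2" for n
  proof -
    have "norm ((of_nat (Suc n))\<^sup>2 * fps_nth hyp_fps (Suc n)) = norm ((of_nat n + 1/2)\<^sup>2 * fps_nth hyp_fps n)"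
      by (simp only: hyp_fps_Suc)
    also have "(of_nat n + 1/2 :: complex) = of_real (real n + 1/2)" by simp
    also have "(of_nat (Suc n) :: complex) = of_real (real (Suc n))" by simp
    finally have "(real (Suc n))\<^sup>2 * norm (fps_nth hyp_fps (Suc n)) = (real n + 1/2)\<^sup>2 * norm (fps_nth hyp_fps n)"
      unfolding norm_mult norm_power norm_of_real by simp
    moreover have "norm (fps_nth hyp_fps (Suc n)) \<noteq> 0" using hyp_fps_nz[of "Suc n"] by (simp del: fps_hypergeo_nth)
    moreover have "real n + 1/2 \<noteq> 0" by linarith
    ultimately show ?thesis by (simp add: field_simps del: fps_hypergeo_nth of_nat_Suc)
  qed
  moreover have "(\<lambda>n. (real (Suc n) / (real n + 1/2))\<^sup>2) \<longlonglongrightarrow> 1" by real_asymp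
  ultimately show "(\<lambda>n. norm (fps_nth hyp_fps n) / norm (fps_nth hyp_fps (Suc n))) \<longlonglongrightarrow> 1" by presburger
qed auto

lemma holomorphic_on_hypF [holomorphic_intros]:
  assumes "f holomorphic_on A" "\<And>z. z \<in> A \<Longrightarrow> norm (f z) < 1"
  shows "(\<lambda>z. hypF (f z)) holomorphic_on A"
proof -
  have "hypF holomorphic_on ball 0 1"
    unfolding hypF_def by (rule holomorphic_on_eval_fps) (auto simp: fps_conv_radius_hyp_fps in_eball_iff)
  from holomorphic_on_compose_gen[OF assms(1) this] assms(2) show ?thesis
    by (simp add: o_def image_subset_iff)
qed

lemma hypF_0 [simp]: "hypF 0 = 1"
  by (simp add: hypF_def eval_fps_at_0 del: fps_hypergeo_nth)

lemma has_fps_expansion_hypF: "hypF has_fps_expansion hyp_fps"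
  unfolding hypF_def by (rule eval_fps_has_fps_expansion) (simp add: fps_conv_radius_hyp_fps)

lemma hypF_sums: "norm z < 1 \<Longrightarrow> (\<lambda>n. fps_nth hyp_fps n * z ^ n) sums hypF z"
  unfolding hypF_def by (rule sums_eval_fps) (simp add: fps_conv_radius_hyp_fps)

lemma tendsto_hypF_0:
  assumes "(f \<longlongrightarrow> 0) F" shows "((\<lambda>x. hypF (f x)) \<longlongrightarrow> 1) F"
proof -
  have "hypF holomorphic_on ball 0 1"
    by (intro holomorphic_on_hypF holomorphic_intros) auto
  then have "isCont hypF 0"
    by (intro continuous_on_interior[OF holomorphic_on_imp_continuous_on]) auto
  from isCont_tendsto_compose[OF this assms] show ?thesis by simp
qed

section \<open>The Landen transformation\<close>

definition landen_k :: "complex \<Rightarrow> complex" where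
  "landen_k m = (1 - csqrt (1 - m)) / (1 + csqrt (1 - m))"

abbreviation slit_plane :: "complex set" where
  "slit_plane \<equiv> - (complex_of_real ` {1..})"

lemma mem_slit_iff: "m \<in> complex_of_real ` {1..} \<longleftrightarrow> 1 - m \<in> \<real>\<^sub>\<le>\<^sub>0"
proof
  assume "1 - m \<in> \<real>\<^sub>\<le>\<^sub>0"
  then have "m = of_real (Re m)" "Re m \<ge> 1" by (auto simp: complex_nonpos_Reals_iff complex_eq_iff)
  then show "m \<in> complex_of_real ` {1..}" by (metis atLeast_iff imageI)
next
  assume "m \<in> complex_of_real ` {1..}"
  then obtain t where "t \<ge> 1" "m = of_real t" by auto
  then have "Re (1 - m) \<le> 0" "Im (1 - m) = 0" by auto
  then show "1 - m \<in> \<real>\<^sub>\<le>\<^sub>0" by (simp only: complex_nonpos_Reals_iff)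
qed

lemma open_slit_plane: "open slit_plane"
proof -
  have "slit_plane = (\<lambda>m. 1 - m) -` (- \<real>\<^sub>\<le>\<^sub>0)"
    by (rule set_eqI) (simp only: Compl_iff vimage_eq mem_slit_iff)
  then show ?thesis
    by (auto intro!: open_vimage continuous_intros)
qed

lemma slit_planeI: "norm m < 1 \<Longrightarrow> m \<in> slit_plane"
  by auto

lemma Re_csqrt_pos: "z \<notin> \<real>\<^sub>\<le>\<^sub>0 \<Longrightarrow> Re (csqrt z) > 0"
proof (rule ccontr)
  assume z: "z \<notin> \<real>\<^sub>\<le>\<^sub>0" and "\<not> Re (csqrt z) > 0"
  then have "Re (csqrt z) = 0" using Re_csqrt[of z] by linarith
  then have "Re ((csqrt z)\<^sup>2) \<le> 0" "Im ((csqrt z)\<^sup>2) = 0"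
    by (simp_all add: power2_eq_square del: power2_csqrt)
  with z show False by (simp add: complex_nonpos_Reals_iff)
qed

text \<open>Cayley transform: the squared moduli of 1 + s and 1 - s differ by 4 Re s.\<close>

lemma norm_landen_frac:
  assumes "Re s > 0" shows "norm ((1 - s) / (1 + s)) < 1"
proof -
  have "(norm (1 - s))\<^sup>2 < (norm (1 + s))\<^sup>2"
    using assms unfolding cmod_power2 by (simp add: power2_eq_square algebra_simps)
  then have "norm (1 - s) < norm (1 + s)"
    by (rule power_less_imp_less_base) simp
  then show ?thesis
    by (simp add: norm_divide divide_less_eq)
qed

lemma one_plus_nz: "Re s > 0 \<Longrightarrow> 1 + s \<noteq> 0"
  by (auto simp: complex_eq_iff)

lemma norm_landen_k: "m \<in> slit_plane \<Longrightarrow> norm (landen_k m) < 1"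
  unfolding landen_k_def by (intro norm_landen_frac Re_csqrt_pos) (simp add: mem_slit_iff)

lemma holomorphic_on_landen_k: "landen_k holomorphic_on slit_plane"
  unfolding landen_k_def
  by (intro holomorphic_intros) (auto simp: mem_slit_iff dest: Re_csqrt_pos one_plus_nz)

lemma landen_k_0 [simp]: "landen_k 0 = 0"
  by (simp add: landen_k_def)

lemma landen_k_eq:
  assumes "m \<in> slit_plane"
  shows "m * (1 + landen_k m)\<^sup>2 = 4 * landen_k m"
proof -
  define s where "s = csqrt (1 - m)"
  have s: "1 + s \<noteq> 0"
    using assms unfolding s_def by (intro one_plus_nz Re_csqrt_pos) (use assms in \<open>simp add: mem_slit_iff\<close>)
  have m: "m = 1 - s\<^sup>2" by (simp add: s_def)
  have k: "landen_k m = (1 - s) / (1 + s)" by (simp add: landen_k_def s_def)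
  have "1 + landen_k m = 2 / (1 + s)" using s by (simp add: k field_simps)
  then have "m * (1 + landen_k m)\<^sup>2 = (1 - s\<^sup>2) * (2 / (1 + s))\<^sup>2" by (simp only: m)
  also have "\<dots> = 4 * ((1 - s) / (1 + s))"
    using s by (simp add: divide_simps) (simp add: power2_eq_square algebra_simps)
  finally show ?thesis by (simp only: k)
qed

text \<open>1 - 4 k / (1 + k)^2 is the square of (1 - k) / (1 + k), whose real part is positive for
  |k| < 1. It is therefore the principal root.\<close>

lemma landen_k_inverse:
  assumes "norm k < 1"
  shows "landen_k (4 * k / (1 + k)\<^sup>2) = k"
proof -
  have k1: "1 + k \<noteq> 0" using assms by (auto simp: add_eq_0_iff)
  have "1 - 4 * k / (1 + k)\<^sup>2 = ((1 - k) / (1 + k))\<^sup>2"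
  proof -
    have "(1 + k)\<^sup>2 - 4 * k = (1 - k)\<^sup>2" by (simp add: power2_eq_square algebra_simps)
    with k1 show ?thesis by (simp add: power_divide diff_divide_eq_iff)
  qed
  moreover have "Re ((1 - k) / (1 + k)) > 0"
  proof -
    have "(norm k)\<^sup>2 < 1" using assms by (simp add: power_less_one_iff)
    then have "(Re k)\<^sup>2 + (Im k)\<^sup>2 < 1" by (simp add: cmod_power2)
    then have "Re ((1 - k) * cnj (1 + k)) > 0" by (simp add: power2_eq_square algebra_simps)
    moreover have "(1 - k) / (1 + k) = (1 - k) * cnj (1 + k) / of_real ((norm (1 + k))\<^sup>2)"
      by (subst complex_div_cnj) simp
    ultimately show ?thesis using k1 by (simp add: Re_divide_of_real)
  qed
  ultimately have "csqrt (1 - 4 * k / (1 + k)\<^sup>2) = (1 - k) / (1 + k)"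
    by (simp add: csqrt_unique)
  moreover have "1 - (1 - k) / (1 + k) = 2 * k / (1 + k)" "1 + (1 - k) / (1 + k) = 2 / (1 + k)"
    using k1 by (simp_all add: field_simps)
  ultimately show ?thesis using k1 by (simp add: landen_k_def)
qed

text \<open>The formal identity yields an identity of functions of k near 0. Since
  \<open>landen_k m\<close> tends to 0 with m, this becomes an identity in m near 0, which the
  identity theorem extends to the disc.\<close>

theorem hypF_landen:
  assumes "norm m < 1"
  shows "hypF m = (1 + landen_k m) * hypF ((landen_k m)\<^sup>2)"
proof -
  define g where "g k = 4 * k / (1 + k)\<^sup>2" for k :: complex
  have hol: "(\<lambda>m. hypF m - (1 + landen_k m) * hypF ((landen_k m)\<^sup>2)) holomorphic_on ball 0 1"
    by (intro holomorphic_intros holomorphic_on_subset[OF holomorphic_on_landen_k])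
      (auto simp: norm_power power_less_one_iff intro!: norm_landen_k slit_planeI)
  have "\<forall>\<^sub>F k in nhds 0. hypF (g k) = (1 + k) * hypF (k\<^sup>2)"
  proof -
    have "g has_fps_expansion fps_const 4 * fps_X / (1 + fps_X)\<^sup>2" (is "_ has_fps_expansion ?P")
      unfolding g_def by (intro fps_expansion_intros) auto
    moreover have P: "?P * (1 + fps_X)\<^sup>2 = 4 * fps_X"
      by (simp add: fps_numeral_fps_const fps_divide_unit mult.assoc inverse_mult_eq_1 power2_eq_square)
    moreover have P0: "fps_nth ?P 0 = 0"
      using arg_cong[OF P, of "\<lambda>f. fps_nth f 0"] by (simp add: power2_eq_square)
    ultimately have 1: "(hypF \<circ> g) has_fps_expansion (hyp_fps oo ?P)"
      by (intro has_fps_expansion_compose has_fps_expansion_hypF)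
    have "(\<lambda>k. (1 + k) * (hypF \<circ> (\<lambda>k. k\<^sup>2)) k) has_fps_expansion (1 + fps_X) * (hyp_fps oo fps_X\<^sup>2)"
      by (intro fps_expansion_intros has_fps_expansion_hypF) simp
    with 1 have "((\<lambda>k. (hypF \<circ> g) k - (1 + k) * (hypF \<circ> (\<lambda>k. k\<^sup>2)) k)) has_fps_expansion 0"
      using has_fps_expansion_diff[OF 1] hyp_fps_landen[OF P P0] by fastforce
    then show ?thesis
      by (auto simp: has_fps_expansion_0_iff elim!: eventually_mono)
  qed
  moreover have "filterlim landen_k (nhds 0) (nhds 0)"
  proof -
    have "isCont landen_k 0"
      using holomorphic_on_imp_continuous_on[OF holomorphic_on_landen_k] open_slit_plane slit_planeI[of 0]
      by (simp add: continuous_on_eq_continuous_at)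
    then show ?thesis
      using tendsto_at_iff_tendsto_nhds[of landen_k 0] by (simp add: isCont_def)
  qed
  ultimately have "\<forall>\<^sub>F m in nhds 0. hypF (g (landen_k m)) = (1 + landen_k m) * hypF ((landen_k m)\<^sup>2)"
    unfolding filterlim_iff by blast
  moreover have "\<forall>\<^sub>F m in nhds 0. m \<in> ball 0 (1::real)"
    by (intro eventually_nhds_in_open) auto
  ultimately have "\<forall>\<^sub>F m in nhds 0. hypF m = (1 + landen_k m) * hypF ((landen_k m)\<^sup>2)"
  proof eventually_elim
    case (elim m)
    have "m \<in> slit_plane" using elim by (intro slit_planeI) auto
    moreover from this have "1 + landen_k m \<noteq> 0"
      using norm_landen_k[of m] by (auto simp: add_eq_0_iff)
    ultimately have "g (landen_k m) = m"
      using landen_k_eq[of m] by (simp add: g_def field_simps)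
    then show ?case using elim by simp
  qed
  then obtain S where S: "open S" "0 \<in> S" "\<And>m. m \<in> S \<Longrightarrow> hypF m = (1 + landen_k m) * hypF ((landen_k m)\<^sup>2)"
    by (auto simp: eventually_nhds)
  have "hypF m - (1 + landen_k m) * hypF ((landen_k m)\<^sup>2) = 0"
    by (rule analytic_continuation_open[OF _ _ _ _ _ hol holomorphic_on_const, of "S \<inter> ball 0 1"])
       (use S assms in auto)
  then show ?thesis by simp
qed

lemma norm_landen_k_sq: "m \<in> slit_plane \<Longrightarrow> norm ((landen_k m)\<^sup>2) < 1"
  using norm_landen_k[of m] by (simp add: norm_power power_less_one_iff)

text \<open>\<open>hyp2F1\<close> is selected by \<open>SOME\<close>, so a function with both
  defining properties has to be exhibited. The right-hand side of Landen's transformation is one: it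
  is holomorphic wherever |k| < 1, that is, on the whole slit plane.\<close>

lemma hyp2F1_half:
  "hyp2F1 (1/2) (1/2) 1 holomorphic_on slit_plane"
  "norm z < 1 \<Longrightarrow> hyp2F1 (1/2) (1/2) 1 z = hypF z"
proof -
  have "(\<lambda>m. (1 + landen_k m) * hypF ((landen_k m)\<^sup>2)) holomorphic_on slit_plane"
    by (intro holomorphic_intros holomorphic_on_landen_k norm_landen_k_sq)
  then have "\<exists>f. f holomorphic_on slit_plane \<and> (\<forall>z\<in>ball 0 1. f z = eval_fps hyp_fps z)"
    using hypF_landen by (intro exI[of _ "\<lambda>m. (1 + landen_k m) * hypF ((landen_k m)\<^sup>2)"])
      (auto simp: hypF_def)
  from someI_ex[OF this]
  show "hyp2F1 (1/2) (1/2) 1 holomorphic_on slit_plane" "norm z < 1 \<Longrightarrow> hyp2F1 (1/2) (1/2) 1 z = hypF z"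
    unfolding hyp2F1_def by (auto simp: hypF_def)
qed

lemma holomorphic_on_ellK: "ellK holomorphic_on slit_plane"
  unfolding ellK_def by (intro holomorphic_intros hyp2F1_half)

lemma ellK_eq: "norm m < 1 \<Longrightarrow> ellK m = of_real pi / 2 * hypF m"
  by (simp add: ellK_def hyp2F1_half(2))

section \<open>Theta series\<close>

text \<open>The library notation for absolute summability is ambiguous, since two different constants share it.\<close>

abbreviation abs_summ_on :: "('a \<Rightarrow> 'b :: real_normed_vector) \<Rightarrow> 'a set \<Rightarrow> bool" (infixr "abs'_summ'_on" 46) where
  "f abs_summ_on A \<equiv> (\<lambda>x. norm (f x)) summable_on A"

text \<open>Splitting the integers into n and - n - 1 is symmetric about - 1/2. It pairs the equal
  terms of \<open>theta2\<close> and reduces every theta series to series over the naturals.\<close>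

lemma abs_summable_on_int_split:
  fixes f :: "int \<Rightarrow> 'a :: banach"
  assumes "summable (\<lambda>n. norm (f (int n)))" "summable (\<lambda>n. norm (f (- int n - 1)))"
  shows "f abs_summ_on UNIV"
    "infsum f UNIV = (\<Sum>n. f (int n)) + (\<Sum>n. f (- int n - 1))"
proof -
  let ?A = "range int" and ?B = "range (\<lambda>n. - int n - 1)"
  have U: "?A \<union> ?B = UNIV"
  proof (intro equalityI subsetI UnCI)
    fix n :: int assume "n \<notin> ?B"
    have "n \<ge> 0"
    proof (rule ccontr)
      assume "\<not> n \<ge> 0"
      then have "n = - int (nat (- n - 1)) - 1" by simp
      with \<open>n \<notin> ?B\<close> show False by blast
    qed
    then show "n \<in> ?A" by (metis nat_0_le rangeI)
  qed auto
  have I: "?A \<inter> ?B = {}" by auto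
  have inj: "inj int" "inj (\<lambda>n. - int n - 1)" by (auto simp: inj_on_def)
  have "(\<lambda>n. norm (f (int n))) summable_on UNIV" "(\<lambda>n. norm (f (- int n - 1))) summable_on UNIV"
    using assms by (simp_all add: norm_summable_imp_summable_on)
  then have "f abs_summ_on ?A" "f abs_summ_on ?B"
    by (simp_all add: summable_on_reindex inj o_def)
  then show "f abs_summ_on UNIV"
    using summable_on_Un_disjoint[OF _ _ I] U by metis
  have "(f has_sum (\<Sum>n. f (int n))) ?A"
    unfolding has_sum_reindex[OF inj(1)] o_def
    by (intro norm_summable_imp_has_sum assms(1) summable_sums summable_norm_cancel[OF assms(1)])
  moreover have "(f has_sum (\<Sum>n. f (- int n - 1))) ?B"
    unfolding has_sum_reindex[OF inj(2)] o_def
    by (intro norm_summable_imp_has_sum assms(2) summable_sums summable_norm_cancel[OF assms(2)])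
  ultimately show "infsum f UNIV = (\<Sum>n. f (int n)) + (\<Sum>n. f (- int n - 1))"
    using has_sum_Un_disjoint[OF _ _ I, of f] U infsumI by metis
qed

lemma abs_summable_on_product:
  fixes f :: "'a \<Rightarrow> complex" and g :: "'b \<Rightarrow> complex"
  assumes "f abs_summ_on A" "g abs_summ_on B"
  shows "(\<lambda>(x, y). f x * g y) abs_summ_on A \<times> B"
  unfolding Infinite_Sum.abs_summable_on_Sigma_iff
  using assms by (auto simp: norm_mult infsum_cmult_right' abs_mult infsum_nonneg intro!: summable_on_cmult_right summable_on_cmult_left)

lemma infsum_product:
  fixes f :: "'a \<Rightarrow> complex" and g :: "'b \<Rightarrow> complex"
  assumes "f abs_summ_on A" "g abs_summ_on B"
  shows "infsum (\<lambda>(x, y). f x * g y) (A \<times> B) = infsum f A * infsum g B"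
  using infsum_Sigma_banach[OF abs_summable_summable[OF abs_summable_on_product[OF assms]]]
  by (simp add: infsum_cmult_right' infsum_cmult_left')

lemmas infsum_product_UNIV = infsum_product[where A = UNIV and B = UNIV, unfolded UNIV_Times_UNIV]

text \<open>Pairs of integers are split by the parity of their sum and difference.\<close>

lemma infsum_int_product_rotate:
  fixes f g :: "int \<Rightarrow> complex"
  assumes "f abs_summ_on UNIV" "g abs_summ_on UNIV"
  shows "infsum f UNIV * infsum g UNIV =
    infsum (\<lambda>(a, b). f (a + b) * g (a - b)) UNIV + infsum (\<lambda>(a, b). f (a + b + 1) * g (a - b)) UNIV"
proof -
  let ?h = "\<lambda>(x, y). f x * g y"
  let ?E = "{(x :: int, y :: int). even (x + y)}" and ?O = "{(x :: int, y :: int). odd (x + y)}"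
  have s: "?h summable_on UNIV"
    using abs_summable_summable[OF abs_summable_on_product[OF assms]] by simp
  have "infsum f UNIV * infsum g UNIV = infsum ?h UNIV"
    using infsum_product[OF assms] by simp
  also have "UNIV = ?E \<union> ?O" by auto
  also have "infsum ?h (?E \<union> ?O) = infsum ?h ?E + infsum ?h ?O"
    by (intro infsum_Un_disjoint summable_on_subset_banach[OF s]) auto
  also have "infsum ?h ?E = infsum (\<lambda>(a, b). f (a + b) * g (a - b)) UNIV"
  proof -
    have "(x + y) div 2 + (x - y) div 2 = x" "(x + y) div 2 - (x - y) div 2 = y" if "even (x + y)" for x y :: int
      using that by presburger+
    then show ?thesis
      by (intro infsum_reindex_bij_witness[of _ "\<lambda>(a, b). (a + b, a - b)" "\<lambda>(x, y). ((x + y) div 2, (x - y) div 2)"])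
        auto
  qed
  also have "infsum ?h ?O = infsum (\<lambda>(a, b). f (a + b + 1) * g (a - b)) UNIV"
  proof -
    have "(x + y) div 2 + (x - y) div 2 + 1 = x" "(x + y) div 2 - (x - y) div 2 = y" if "odd (x + y)" for x y :: int
      using that by presburger+
    then show ?thesis
      by (intro infsum_reindex_bij_witness[of _ "\<lambda>(a, b). (a + b + 1, a - b)" "\<lambda>(x, y). ((x + y) div 2, (x - y) div 2)"])
        auto
  qed
  finally show ?thesis .
qed

text \<open>A geometric series dominates because n \<le> n^2 \<le> (n + s)^2.\<close>

lemma summable_gauss_nat:
  assumes "c > 0" "0 \<le> s" "s \<le> 1"
  shows "summable (\<lambda>n. exp (- c * (real n + s)\<^sup>2))"
proof (rule summable_comparison_test')
  show "summable (\<lambda>n. exp (- c) ^ n)"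
    using assms by (intro summable_geometric) auto
  fix n :: nat
  have "real n \<le> (real n)\<^sup>2"
    using le_square[of n] by (simp add: power2_eq_square flip: of_nat_mult)
  also have "\<dots> \<le> (real n + s)\<^sup>2"
    using assms by (intro power_mono) auto
  finally have "c * real n \<le> c * (real n + s)\<^sup>2" using assms by (intro mult_left_mono) auto
  then show "norm (exp (- c * (real n + s)\<^sup>2)) \<le> exp (- c) ^ n"
    by (simp add: exp_of_nat_mult [symmetric] mult.commute)
qed

section \<open>Terms of the theta series and their absolute summability\<close>

definition thexp :: "complex \<Rightarrow> complex \<Rightarrow> complex" where
  "thexp \<tau> x = exp (of_real pi * \<i> * \<tau> * x\<^sup>2)"

lemma norm_thexp: "norm (thexp \<tau> (of_real x)) = exp (- (pi * Im \<tau>) * x\<^sup>2)"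
  by (simp add: thexp_def power2_eq_square)

text \<open>One statement for all series: s is 0 or 1/2, and the bounded weights \<open>u\<close>
  carry the signs. On the indices - n - 1 the shift s turns into 1 - s.\<close>

lemma abs_summable_theta:
  assumes "Im \<tau> > 0" "0 \<le> s" "s \<le> 1" "\<And>n. norm (u n) \<le> 1"
  shows "(\<lambda>n::int. u n * thexp \<tau> (of_int n + of_real s)) abs_summ_on UNIV"
proof -
  have 1: "norm (thexp \<tau> (of_int n + of_real s)) = exp (- (pi * Im \<tau>) * (of_int n + s)\<^sup>2)" for n
    using norm_thexp[of \<tau> "of_int n + s"] by simp
  have "(\<lambda>n::int. thexp \<tau> (of_int n + of_real s)) abs_summ_on UNIV"
  proof (rule abs_summable_on_int_split(1); unfold 1)
    show "summable (\<lambda>n. exp (- (pi * Im \<tau>) * (real_of_int (int n) + s)\<^sup>2))"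
      using summable_gauss_nat[of "pi * Im \<tau>" s] assms by simp
    have "(real n + (1 - s))\<^sup>2 = (real_of_int (- int n - 1) + s)\<^sup>2" for n
      by (simp add: power2_eq_square algebra_simps)
    then show "summable (\<lambda>n. exp (- (pi * Im \<tau>) * (real_of_int (- int n - 1) + s)\<^sup>2))"
      using summable_gauss_nat[of "pi * Im \<tau>" "1 - s"] assms by simp
  qed
  then show ?thesis
    by (rule Infinite_Sum.abs_summable_on_comparison_test)
      (simp add: norm_mult mult_left_le_one_le assms(4))
qed

lemma theta2_thexp: "theta2 \<tau> = (\<Sum>\<^sub>\<infinity>n. thexp \<tau> (of_int n + 1/2))"
  and theta3_thexp: "theta3 \<tau> = (\<Sum>\<^sub>\<infinity>n. thexp \<tau> (of_int n))"
  and theta4_thexp: "theta4 \<tau> = (\<Sum>\<^sub>\<infinity>n. (-1) powi n * thexp \<tau> (of_int n))"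
  by (simp_all add: theta2_def theta3_def theta4_def thexp_def)

lemma abs_summable_theta2: "Im \<tau> > 0 \<Longrightarrow> (\<lambda>n::int. thexp \<tau> (of_int n + 1/2)) abs_summ_on UNIV"
  using abs_summable_theta[of \<tau> "1/2" "\<lambda>_. 1"] by simp

lemma abs_summable_theta3: "Im \<tau> > 0 \<Longrightarrow> (\<lambda>n::int. thexp \<tau> (of_int n)) abs_summ_on UNIV"
  using abs_summable_theta[of \<tau> 0 "\<lambda>_. 1"] by simp

lemma abs_summable_theta4: "Im \<tau> > 0 \<Longrightarrow> (\<lambda>n::int. (-1) powi n * thexp \<tau> (of_int n)) abs_summ_on UNIV"
  using abs_summable_theta[of \<tau> 0 "\<lambda>n. (-1) powi n"] by (simp add: norm_power_int)

text \<open>Parallelogram law: x^2 + y^2 = 2 ((x + y) / 2)^2 + 2 ((x - y) / 2)^2. The factor 2 moves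
  into \<tau>, so products at \<tau> become products at 2 \<tau>.\<close>

lemma thexp_rotate: "thexp \<tau> x * thexp \<tau> y = thexp (2 * \<tau>) ((x + y) / 2) * thexp (2 * \<tau>) ((x - y) / 2)"
  unfolding thexp_def exp_add [symmetric]
  by (rule arg_cong[of _ _ exp]) (simp add: power2_eq_square field_simps)

lemma minus_one_powi_add: "(-1 :: complex) powi (m + n) = (-1) powi m * (-1) powi n"
  by (simp add: power_int_add)

section \<open>Duplication formulas and Jacobi's identity\<close>

context
  fixes \<tau> :: complex
  assumes \<tau>: "Im \<tau> > 0"
begin

lemma theta_double_summable:
  "(\<lambda>n::int. thexp (2 * \<tau>) (of_int n)) abs_summ_on UNIV"
  "(\<lambda>n::int. thexp (2 * \<tau>) (of_int n + 1/2)) abs_summ_on UNIV"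
  "(\<lambda>n::int. (-1) powi n * thexp (2 * \<tau>) (of_int n)) abs_summ_on UNIV"
  "(\<lambda>n::int. (-1) powi n * thexp (2 * \<tau>) (of_int n + 1/2)) abs_summ_on UNIV"
proof -
  have "Im (2 * \<tau>) > 0" using \<tau> by simp
  from abs_summable_theta2[OF this] abs_summable_theta3[OF this] abs_summable_theta4[OF this]
    abs_summable_theta[OF this, of "1/2" "\<lambda>n. (-1) powi n"]
  show "(\<lambda>n::int. thexp (2 * \<tau>) (of_int n)) abs_summ_on UNIV"
    "(\<lambda>n::int. thexp (2 * \<tau>) (of_int n + 1/2)) abs_summ_on UNIV"
    "(\<lambda>n::int. (-1) powi n * thexp (2 * \<tau>) (of_int n)) abs_summ_on UNIV"
    "(\<lambda>n::int. (-1) powi n * thexp (2 * \<tau>) (of_int n + 1/2)) abs_summ_on UNIV"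
    by (simp_all add: norm_power_int)
qed

text \<open>For pairs with even sum, half sum and half difference are integers and give the square
  of \<open>theta3\<close>; for odd sum both are half-integers and give the square of
  \<open>theta2\<close>.\<close>

lemma theta3_sq: "(theta3 \<tau>)\<^sup>2 = (theta3 (2 * \<tau>))\<^sup>2 + (theta2 (2 * \<tau>))\<^sup>2"
proof -
  have e: "thexp \<tau> (of_int (a + b)) * thexp \<tau> (of_int (a - b)) = thexp (2 * \<tau>) (of_int a) * thexp (2 * \<tau>) (of_int b)" for a b
    by (simp add: thexp_rotate[of \<tau>])
  have o: "thexp \<tau> (of_int (a + b + 1)) * thexp \<tau> (of_int (a - b)) = thexp (2 * \<tau>) (of_int a + 1/2) * thexp (2 * \<tau>) (of_int b + 1/2)" for a b
    by (simp add: thexp_rotate[of \<tau>] add_divide_distrib)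
  show ?thesis
    unfolding power2_eq_square theta3_thexp theta2_thexp
      infsum_int_product_rotate[OF abs_summable_theta3[OF \<tau>] abs_summable_theta3[OF \<tau>]] e o
    by (simp only: infsum_product_UNIV[OF theta_double_summable(1,1)] infsum_product_UNIV[OF theta_double_summable(2,2)])
qed

text \<open>The same splitting, with the sign (-1)^(x + y): it is 1 on the even class and -1 on the
  odd one.\<close>

lemma theta4_sq: "(theta4 \<tau>)\<^sup>2 = (theta3 (2 * \<tau>))\<^sup>2 - (theta2 (2 * \<tau>))\<^sup>2"
proof -
  have s: "(-1 :: complex) powi (a + b) * (-1) powi (a - b) = 1" "(-1 :: complex) powi (a + b + 1) * (-1) powi (a - b) = - 1" for a b :: int
    by (auto simp flip: minus_one_powi_add simp: power_int_minus_left)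
  have e: "((-1) powi (a + b) * thexp \<tau> (of_int (a + b))) * ((-1) powi (a - b) * thexp \<tau> (of_int (a - b)))
      = thexp (2 * \<tau>) (of_int a) * thexp (2 * \<tau>) (of_int b)" (is "?p * ?x * (?q * ?y) = _") for a b
  proof -
    have "?p * ?x * (?q * ?y) = (?p * ?q) * (?x * ?y)" by (simp only: mult_ac)
    then show ?thesis unfolding s by (simp add: thexp_rotate[of \<tau>])
  qed
  have o: "((-1) powi (a + b + 1) * thexp \<tau> (of_int (a + b + 1))) * ((-1) powi (a - b) * thexp \<tau> (of_int (a - b)))
      = - (thexp (2 * \<tau>) (of_int a + 1/2) * thexp (2 * \<tau>) (of_int b + 1/2))" (is "?p * ?x * (?q * ?y) = _") for a b
  proof -
    have "?p * ?x * (?q * ?y) = (?p * ?q) * (?x * ?y)" by (simp only: mult_ac)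
    then show ?thesis unfolding s by (simp add: thexp_rotate[of \<tau>] add_divide_distrib)
  qed
  have neg: "(\<Sum>\<^sub>\<infinity>(a, b). - (f a * g b)) = - (\<Sum>\<^sub>\<infinity>(a, b). f a * g b :: complex)" for f g :: "int \<Rightarrow> complex"
    by (simp add: case_prod_unfold infsum_uminus)
  show ?thesis
    unfolding power2_eq_square theta3_thexp theta2_thexp theta4_thexp
      infsum_int_product_rotate[OF abs_summable_theta4[OF \<tau>] abs_summable_theta4[OF \<tau>]] e o neg
    by (simp only: infsum_product_UNIV[OF theta_double_summable(1,1)] infsum_product_UNIV[OF theta_double_summable(2,2)] diff_conv_add_uminus)
qed

text \<open>Only the even class survives. The odd class factors into two alternating sums over
  half-integers, and these vanish because n \<mapsto> - n - 1 fixes the square but reverses the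
  sign.\<close>

lemma theta3_theta4: "theta3 \<tau> * theta4 \<tau> = (theta4 (2 * \<tau>))\<^sup>2"
proof -
  have s: "(-1 :: complex) powi (a - b) = (-1) powi a * (-1) powi b" for a b :: int
    by (auto simp flip: minus_one_powi_add simp: power_int_minus_left)
  have e: "thexp \<tau> (of_int (a + b)) * ((-1) powi (a - b) * thexp \<tau> (of_int (a - b)))
      = ((-1) powi a * thexp (2 * \<tau>) (of_int a)) * ((-1) powi b * thexp (2 * \<tau>) (of_int b))" (is "?x * (?q * ?y) = _") for a b
  proof -
    have "?x * (?q * ?y) = ?q * (?x * ?y)" by (simp only: mult_ac)
    then show ?thesis unfolding s by (simp add: thexp_rotate[of \<tau>])
  qed
  have o: "thexp \<tau> (of_int (a + b + 1)) * ((-1) powi (a - b) * thexp \<tau> (of_int (a - b)))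
      = ((-1) powi a * thexp (2 * \<tau>) (of_int a + 1/2)) * ((-1) powi b * thexp (2 * \<tau>) (of_int b + 1/2))" (is "?x * (?q * ?y) = _") for a b
  proof -
    have "?x * (?q * ?y) = ?q * (?x * ?y)" by (simp only: mult_ac)
    then show ?thesis unfolding s by (simp add: thexp_rotate[of \<tau>] add_divide_distrib)
  qed
  let ?S = "\<Sum>\<^sub>\<infinity>n. (-1) powi n * thexp (2 * \<tau>) (of_int n + 1/2)"
  have "?S = (\<Sum>\<^sub>\<infinity>n. - ((-1) powi n * thexp (2 * \<tau>) (of_int n + 1/2)))"
  proof (rule infsum_reindex_bij_witness[of _ "\<lambda>n. - n - 1" "\<lambda>n. - n - 1"])
    fix n :: int
    have "thexp (2 * \<tau>) (of_int (- n - 1) + 1/2) = thexp (2 * \<tau>) (of_int n + 1/2)"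
      by (simp add: thexp_def power2_eq_square algebra_simps)
    moreover have "(-1 :: complex) powi (- n - 1) = - ((-1) powi n)"
      by (auto simp: power_int_minus_left)
    ultimately show "- ((-1) powi (- n - 1) * thexp (2 * \<tau>) (of_int (- n - 1) + 1/2)) = (-1) powi n * thexp (2 * \<tau>) (of_int n + 1/2)"
      by simp
  qed auto
  then have "?S = 0" by (simp add: infsum_uminus)
  then show ?thesis
    unfolding power2_eq_square theta3_thexp theta4_thexp
      infsum_int_product_rotate[OF abs_summable_theta3[OF \<tau>] abs_summable_theta4[OF \<tau>]] e o
    by (simp only: infsum_product_UNIV[OF theta_double_summable(3,3)] infsum_product_UNIV[OF theta_double_summable(4,4)] \<open>?S = 0\<close> mult_zero_left add_0_right)
qed

text \<open>Half sum and half difference of the half-integers are now one integer and one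
  half-integer, in either order according to parity. Both classes contribute \<open>theta2\<close>
  times \<open>theta3\<close>, whence the factor 2.\<close>

lemma theta2_sq: "(theta2 \<tau>)\<^sup>2 = 2 * theta2 (2 * \<tau>) * theta3 (2 * \<tau>)"
proof -
  have e: "thexp \<tau> (of_int (a + b) + 1/2) * thexp \<tau> (of_int (a - b) + 1/2) = thexp (2 * \<tau>) (of_int a + 1/2) * thexp (2 * \<tau>) (of_int b)" for a b
    by (simp add: thexp_rotate[of \<tau>] add_divide_distrib add_ac)
  have o: "thexp \<tau> (of_int (a + b + 1) + 1/2) * thexp \<tau> (of_int (a - b) + 1/2) = thexp (2 * \<tau>) (of_int (a + 1)) * thexp (2 * \<tau>) (of_int b + 1/2)" for a b
    by (simp add: thexp_rotate[of \<tau>] add_divide_distrib add_ac)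
  have s: "(\<lambda>n::int. thexp (2 * \<tau>) (of_int (n + 1))) abs_summ_on UNIV" (is ?s)
    "(\<Sum>\<^sub>\<infinity>n. thexp (2 * \<tau>) (of_int (n + 1))) = (\<Sum>\<^sub>\<infinity>n. thexp (2 * \<tau>) (of_int n))" (is ?i)
  proof -
    have b: "bij_betw (\<lambda>n::int. n + 1) UNIV UNIV"
      by (rule bij_betwI[of _ _ _ "\<lambda>n. n - 1"]) auto
    show ?s using summable_on_reindex_bij_betw[OF b, of "\<lambda>n. norm (thexp (2 * \<tau>) (of_int n))"] theta_double_summable(1)
      by blast
    show ?i using infsum_reindex_bij_betw[OF b] .
  qed
  show ?thesis
    unfolding power2_eq_square[of "theta2 \<tau>"]
    unfolding theta3_thexp theta2_thexp
      infsum_int_product_rotate[OF abs_summable_theta2[OF \<tau>] abs_summable_theta2[OF \<tau>]] e o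
    unfolding infsum_product_UNIV[OF theta_double_summable(2,1)] infsum_product_UNIV[OF s(1) theta_double_summable(2)] s(2) by simp
qed

text \<open>The squares of \<open>theta3_sq\<close> and \<open>theta4_sq\<close> differ by four
  times the product of two squares at 2 \<tau>, which is the square of
  \<open>theta2_sq\<close>.\<close>

lemma theta_jacobi: "theta3 \<tau> ^ 4 = theta2 \<tau> ^ 4 + theta4 \<tau> ^ 4"
  using theta3_sq theta4_sq theta2_sq by algebra

end

subsection \<open>Expansions in the nome\<close>

text \<open>Common form of the half-series in the nome q. Under n \<le> e n the geometric series is
  a majorant on every smaller disc, and at q = 0 only the term n = 0 can survive.\<close>

definition lacunary :: "(nat \<Rightarrow> nat) \<Rightarrow> complex \<Rightarrow> complex" where
  "lacunary e q = (\<Sum>n. q ^ e n)"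

lemma summable_lacunary:
  fixes q :: "'a :: {banach, real_normed_field}"
  assumes "norm q < 1" "\<And>n. n \<le> e n"
  shows "summable (\<lambda>n. norm (q ^ e n))"
proof (rule summable_comparison_test')
  show "summable (\<lambda>n. norm q ^ n)" using assms by (intro summable_geometric) auto
  show "norm (norm (q ^ e n)) \<le> norm q ^ n" for n
    using assms by (auto simp: norm_power intro!: power_decreasing)
qed

lemma holomorphic_on_lacunary:
  assumes "\<And>n. n \<le> e n"
  shows "lacunary e holomorphic_on ball 0 1"
proof (rule holomorphic_uniform_sequence)
  show "open (ball 0 (1::real) :: complex set)" by simp
  show "(\<lambda>q. \<Sum>k<n. q ^ e k) holomorphic_on ball 0 1" for n
    by (intro holomorphic_intros)
  fix z :: complex assume z: "z \<in> ball 0 1"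
  define r where "r = (1 + norm z) / 2"
  have r: "norm z < r" "r < 1" "0 \<le> r" using z by (auto simp: r_def add_nonneg_pos)
  have sub: "cball z (r - norm z) \<subseteq> cball 0 r"
  proof
    fix w assume "w \<in> cball z (r - norm z)"
    then have "norm (w - z) \<le> r - norm z" by (simp add: dist_norm norm_minus_commute)
    then show "w \<in> cball 0 r" using norm_triangle_sub[of w z] by simp
  qed
  have "uniform_limit (cball z (r - norm z)) (\<lambda>n q. \<Sum>k<n. q ^ e k) (lacunary e) sequentially"
    unfolding lacunary_def
  proof (rule Weierstrass_m_test)
    show "summable (\<lambda>n. r ^ n)" using r by (intro summable_geometric) auto
    fix n w assume "w \<in> cball z (r - norm z)"
    then have w: "norm w \<le> r" using sub by auto
    have "norm w ^ e n \<le> norm w ^ n" using w r assms by (intro power_decreasing) auto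
    also have "\<dots> \<le> r ^ n" using w by (intro power_mono) auto
    finally show "norm (w ^ e n) \<le> r ^ n" by (simp add: norm_power)
  qed
  moreover have "cball z (r - norm z) \<subseteq> ball 0 1" using sub r by auto
  ultimately show "\<exists>d. 0 < d \<and> cball z d \<subseteq> ball 0 1 \<and>
      uniform_limit (cball z d) (\<lambda>n q. \<Sum>k<n. q ^ e k) (lacunary e) sequentially"
    using r by (intro exI[of _ "r - norm z"]) auto
qed

lemma lacunary_of_real:
  assumes "\<bar>x\<bar> < 1" "\<And>n. n \<le> e n"
  shows "lacunary e (of_real x) = of_real (\<Sum>n. x ^ e n)"
proof -
  have "summable (\<lambda>n. x ^ e n)"
    using assms by (intro summable_norm_cancel[OF summable_lacunary]) auto
  from suminf_of_real[OF this, where 'a = complex] show ?thesis by (simp add: lacunary_def)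
qed

lemma lacunary_real_pos:
  fixes x :: real
  assumes "0 < x" "x < 1" "\<And>n. n \<le> e n"
  shows "(\<Sum>n. x ^ e n) > 0"
  using assms by (intro suminf_pos summable_norm_cancel[OF summable_lacunary]) auto

lemma lacunary_0:
  assumes "\<And>n. n \<le> e n"
  shows "lacunary e 0 = (if e 0 = 0 then 1 else 0)"
proof -
  have "(\<lambda>n. (0::complex) ^ e n) = (\<lambda>n. if n = 0 then (if e 0 = 0 then 1 else 0) else 0)"
  proof
    fix n show "(0::complex) ^ e n = (if n = 0 then (if e 0 = 0 then 1 else 0) else 0)"
      using assms[of n] by (auto simp: zero_power)
  qed
  then show ?thesis
    using sums_unique[OF sums_single[of 0 "\<lambda>_. if e 0 = 0 then 1 else 0 :: complex"]]
    by (simp add: lacunary_def)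
qed

lemma sq_ge: "n \<le> (n::nat)\<^sup>2" "n \<le> (Suc n)\<^sup>2" "n \<le> n\<^sup>2 + n"
  by (auto simp: power2_eq_square)

definition theta3_q :: "complex \<Rightarrow> complex" where
  "theta3_q q = lacunary (\<lambda>n. n\<^sup>2) q + lacunary (\<lambda>n. (Suc n)\<^sup>2) q"

text \<open>Ramanujan's \<psi> at q^2. It is what remains of \<open>theta2\<close> after splitting
  off 2 q^(1/4), the factor that is not holomorphic in q at the cusp q = 0.\<close>

definition psi_q :: "complex \<Rightarrow> complex" where
  "psi_q = lacunary (\<lambda>n. n\<^sup>2 + n)"

lemma theta3_q_0 [simp]: "theta3_q 0 = 1" and psi_q_0 [simp]: "psi_q 0 = 1"
  by (simp_all add: theta3_q_def psi_q_def lacunary_0 sq_ge)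

lemma holomorphic_on_theta3_q: "theta3_q holomorphic_on ball 0 1"
  and holomorphic_on_psi_q: "psi_q holomorphic_on ball 0 1"
  unfolding theta3_q_def psi_q_def
  by (intro holomorphic_intros holomorphic_on_lacunary sq_ge)+

abbreviation nome :: "complex \<Rightarrow> complex" where
  "nome \<tau> \<equiv> exp (of_real pi * \<i> * \<tau>)"

lemma theta3_eq_q:
  assumes "Im \<tau> > 0"
  shows "theta3 \<tau> = theta3_q (nome \<tau>)"
proof -
  have q: "norm (nome \<tau>) < 1" using assms by simp
  have 1: "thexp \<tau> (of_int (int n)) = nome \<tau> ^ (n\<^sup>2)" for n
    by (simp add: thexp_def mult_ac flip: exp_of_nat_mult)
  have 2: "thexp \<tau> (of_int (- int n - 1)) = nome \<tau> ^ ((Suc n)\<^sup>2)" for n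
    unfolding thexp_def exp_of_nat_mult [symmetric]
    by (rule arg_cong[of _ _ exp]) (simp add: power2_eq_square algebra_simps)
  show ?thesis
    unfolding theta3_thexp theta3_q_def lacunary_def
    by (subst abs_summable_on_int_split(2); unfold 1 2)
      (use summable_lacunary[OF q] sq_ge in auto)
qed

lemma theta2_eq_q:
  assumes "Im \<tau> > 0"
  shows "theta2 \<tau> = 2 * exp (of_real pi * \<i> * \<tau> / 4) * psi_q (nome \<tau>)"
proof -
  have q: "norm (nome \<tau>) < 1" using assms by simp
  have 1: "thexp \<tau> (of_int (int n) + 1/2) = exp (of_real pi * \<i> * \<tau> / 4) * nome \<tau> ^ (n\<^sup>2 + n)" for n
    unfolding thexp_def exp_of_nat_mult [symmetric] exp_add [symmetric]
    by (rule arg_cong[of _ _ exp]) (simp add: power2_eq_square field_simps)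
  have 2: "thexp \<tau> (of_int (- int n - 1) + 1/2) = exp (of_real pi * \<i> * \<tau> / 4) * nome \<tau> ^ (n\<^sup>2 + n)" for n
    unfolding thexp_def exp_of_nat_mult [symmetric] exp_add [symmetric]
    by (rule arg_cong[of _ _ exp]) (simp add: power2_eq_square field_simps)
  have s: "summable (\<lambda>n. norm (nome \<tau> ^ (n\<^sup>2 + n)))" by (intro summable_lacunary q sq_ge)
  show ?thesis
    unfolding theta2_thexp psi_q_def lacunary_def
    by (subst abs_summable_on_int_split(2); unfold 1 2)
      (use s in \<open>auto simp: norm_mult suminf_mult summable_norm_cancel intro!: summable_mult\<close>)
qed

section \<open>Integer translations of \<tau>\<close>

lemma exp_pi_i_int: "exp (of_real pi * \<i> * of_int m) = (-1) powi m"
proof -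
  have "exp (of_real pi * \<i> * of_int m) = exp (of_real pi * \<i>) powi m"
    unfolding exp_power_int by (simp only: mult_ac)
  then show ?thesis by simp
qed

lemma thexp_shift: "thexp (\<tau> + of_int k) x = thexp \<tau> x * exp (of_real pi * \<i> * (of_int k * x\<^sup>2))"
  by (simp add: thexp_def exp_add [symmetric] algebra_simps)

lemma thexp_shift_int: "thexp (\<tau> + of_int k) (of_int n) = (if even k then 1 else (-1) powi n) * thexp \<tau> (of_int n)"
proof -
  have "exp (of_real pi * \<i> * (of_int k * (of_int n)\<^sup>2)) = (-1) powi (k * n\<^sup>2)"
    unfolding exp_pi_i_int [symmetric] by simp
  also have "\<dots> = (if even k then 1 else (-1) powi n)"
    by (auto simp: power_int_minus_left)
  finally show ?thesis by (simp add: thexp_shift)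
qed

lemma theta3_shift: "theta3 (\<tau> + of_int k) = (if even k then theta3 \<tau> else theta4 \<tau>)"
  by (auto simp: theta3_thexp theta4_thexp thexp_shift_int)

lemma theta4_shift: "theta4 (\<tau> + of_int k) = (if even k then theta4 \<tau> else theta3 \<tau>)"
  unfolding theta3_thexp theta4_thexp thexp_shift_int
  by (auto simp: power_int_minus_left intro!: infsum_cong)

text \<open>(n + 1/2)^2 = n (n + 1) + 1/4, and n (n + 1) is even, so every term acquires the same
  factor.\<close>

lemma theta2_shift: "theta2 (\<tau> + of_int k) = exp (of_real pi * \<i> * of_int k / 4) * theta2 \<tau>"
proof -
  have "thexp (\<tau> + of_int k) (of_int n + 1/2) = exp (of_real pi * \<i> * of_int k / 4) * thexp \<tau> (of_int n + 1/2)" for n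
  proof -
    have "exp (of_real pi * \<i> * (of_int k * (of_int n + 1/2)\<^sup>2))
        = exp (of_real pi * \<i> * of_int (k * (n * (n + 1)))) * exp (of_real pi * \<i> * of_int k / 4)"
      by (simp add: exp_add [symmetric] power2_eq_square algebra_simps add_divide_distrib)
    also have "exp (of_real pi * \<i> * of_int (k * (n * (n + 1)))) = 1"
      unfolding exp_pi_i_int by (simp add: power_int_minus_left)
    finally show ?thesis by (simp add: thexp_shift)
  qed
  then show ?thesis by (simp add: theta2_thexp infsum_cmult_right')
qed

lemma theta2_sq_shift: "(theta2 (\<tau> + of_int (2 * k)))\<^sup>2 = (-1) powi k * (theta2 \<tau>)\<^sup>2"
proof -
  have "(exp (of_real pi * \<i> * of_int (2 * k) / 4))\<^sup>2 = exp (of_real pi * \<i> * of_int k)"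
    unfolding exp_of_nat_mult [symmetric] by (rule arg_cong[of _ _ exp]) simp
  then show ?thesis unfolding theta2_shift power_mult_distrib exp_pi_i_int by simp
qed

lemma theta4_eq_q:
  assumes "Im \<tau> > 0"
  shows "theta4 \<tau> = theta3_q (- nome \<tau>)"
proof -
  have "theta4 \<tau> = theta3 (\<tau> + of_int 1)" by (subst theta3_shift) simp
  also have "\<dots> = theta3_q (nome (\<tau> + of_int 1))" using assms by (intro theta3_eq_q) simp
  also have "nome (\<tau> + of_int 1) = - nome \<tau>" by (simp add: algebra_simps exp_add)
  finally show ?thesis .
qed

lemma holomorphic_on_theta [holomorphic_intros]:
  assumes "f holomorphic_on A" "\<And>z. z \<in> A \<Longrightarrow> Im (f z) > 0"
  shows "(\<lambda>z. theta2 (f z)) holomorphic_on A" "(\<lambda>z. theta3 (f z)) holomorphic_on A"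
    "(\<lambda>z. theta4 (f z)) holomorphic_on A"
proof -
  have n: "(\<lambda>z. nome (f z)) holomorphic_on A" "(\<lambda>z. - nome (f z)) holomorphic_on A"
    using assms by (auto intro!: holomorphic_intros)
  have b: "(\<lambda>z. nome (f z)) ` A \<subseteq> ball 0 1" "(\<lambda>z. - nome (f z)) ` A \<subseteq> ball 0 1"
    using assms(2) by (auto simp: image_subset_iff)
  note c = holomorphic_on_compose_gen[OF n(1) holomorphic_on_psi_q b(1), unfolded o_def]
    holomorphic_on_compose_gen[OF n(1) holomorphic_on_theta3_q b(1), unfolded o_def]
    holomorphic_on_compose_gen[OF n(2) holomorphic_on_theta3_q b(2), unfolded o_def]
  have "(\<lambda>z. 2 * exp (of_real pi * \<i> * f z / 4) * psi_q (nome (f z))) holomorphic_on A"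
    by (intro holomorphic_intros assms c) auto
  then show "(\<lambda>z. theta2 (f z)) holomorphic_on A"
    by (rule holomorphic_transform) (simp add: theta2_eq_q assms)
  show "(\<lambda>z. theta3 (f z)) holomorphic_on A"
    by (rule holomorphic_transform[OF c(2)]) (simp add: theta3_eq_q assms)
  show "(\<lambda>z. theta4 (f z)) holomorphic_on A"
    by (rule holomorphic_transform[OF c(3)]) (simp add: theta4_eq_q assms)
qed

lemma tendsto_theta_q:
  assumes "(f \<longlongrightarrow> 0) F"
  shows "((\<lambda>x. theta3_q (f x)) \<longlongrightarrow> 1) F" "((\<lambda>x. psi_q (f x)) \<longlongrightarrow> 1) F"
proof -
  have "isCont theta3_q 0" "isCont psi_q 0"
    by (rule continuous_on_interior[OF holomorphic_on_imp_continuous_on[OF holomorphic_on_theta3_q]], simp)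
      (rule continuous_on_interior[OF holomorphic_on_imp_continuous_on[OF holomorphic_on_psi_q]], simp)
  from this[THEN isCont_tendsto_compose, OF assms]
  show "((\<lambda>x. theta3_q (f x)) \<longlongrightarrow> 1) F" "((\<lambda>x. psi_q (f x)) \<longlongrightarrow> 1) F" by simp_all
qed

subsection \<open>The imaginary axis\<close>

definition th2 :: "real \<Rightarrow> real" where "th2 t = Re (theta2 (\<i> * of_real t))"
definition th3 :: "real \<Rightarrow> real" where "th3 t = Re (theta3 (\<i> * of_real t))"
definition th4 :: "real \<Rightarrow> real" where "th4 t = Re (theta4 (\<i> * of_real t))"

lemma nome_imag: "nome (\<i> * of_real t) = of_real (exp (- (pi * t)))"
  by (simp add: exp_of_real [symmetric] mult_ac del: exp_of_real)

context
  fixes t :: real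
  assumes t: "t > 0"
begin

lemma theta3_imag: "theta3 (\<i> * of_real t) = of_real (th3 t)" and th3_pos: "th3 t > 0"
proof -
  have t3: "theta3 (\<i> * of_real t) = theta3_q (of_real (exp (- (pi * t))))"
    using t by (subst theta3_eq_q) (simp_all only: nome_imag, simp)
  have x: "0 < exp (- (pi * t))" "exp (- (pi * t)) < 1" "\<bar>exp (- (pi * t))\<bar> < 1" using t by auto
  show "theta3 (\<i> * of_real t) = of_real (th3 t)" "th3 t > 0"
    unfolding th3_def t3 theta3_q_def using x sq_ge lacunary_real_pos[OF x(1,2), of "\<lambda>n. n\<^sup>2"]
      lacunary_real_pos[OF x(1,2), of "\<lambda>n. (Suc n)\<^sup>2"]
    by (simp_all add: lacunary_of_real add_pos_pos del: exp_of_real)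
qed

lemma theta2_imag: "theta2 (\<i> * of_real t) = of_real (th2 t)" and th2_pos: "th2 t > 0"
proof -
  have e: "exp (of_real pi * \<i> * (\<i> * of_real t) / 4) = of_real (exp (- (pi * t) / 4))"
    by (simp add: exp_of_real [symmetric] mult_ac del: exp_of_real)
  have t2: "theta2 (\<i> * of_real t) = 2 * of_real (exp (- (pi * t) / 4)) * psi_q (of_real (exp (- (pi * t))))"
    using t by (subst theta2_eq_q) (simp_all only: nome_imag e, simp)
  have x: "0 < exp (- (pi * t))" "exp (- (pi * t)) < 1" "\<bar>exp (- (pi * t))\<bar> < 1" using t by auto
  show "theta2 (\<i> * of_real t) = of_real (th2 t)" "th2 t > 0"
    unfolding th2_def t2 psi_q_def using x sq_ge lacunary_real_pos[OF x(1,2), of "\<lambda>n. n\<^sup>2 + n"]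
    by (simp_all add: lacunary_of_real del: exp_of_real)
qed

lemma theta4_imag_real: "theta4 (\<i> * of_real t) = of_real (th4 t)"
proof -
  have t4: "theta4 (\<i> * of_real t) = theta3_q (of_real (- exp (- (pi * t))))"
    using t by (subst theta4_eq_q) (simp_all only: nome_imag of_real_minus, simp)
  have x: "\<bar>- exp (- (pi * t))\<bar> < 1" using t by auto
  show ?thesis
    unfolding th4_def t4 theta3_q_def using x sq_ge
    by (simp add: lacunary_of_real del: exp_of_real of_real_minus)
qed

end

lemma double_imag: "2 * (\<i> * of_real t) = \<i> * of_real (2 * t)"
  by simp

lemma th_double:
  assumes "t > 0"
  shows "(th3 t)\<^sup>2 = (th3 (2 * t))\<^sup>2 + (th2 (2 * t))\<^sup>2" "(th4 t)\<^sup>2 = (th3 (2 * t))\<^sup>2 - (th2 (2 * t))\<^sup>2"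
    "th3 t * th4 t = (th4 (2 * t))\<^sup>2" "(th2 t)\<^sup>2 = 2 * th2 (2 * t) * th3 (2 * t)"
    "th3 t ^ 4 = th2 t ^ 4 + th4 t ^ 4"
proof -
  have t: "Im (\<i> * of_real t) > 0" "2 * t > 0" using assms by auto
  note r = theta3_imag[OF assms] theta2_imag[OF assms] theta4_imag_real[OF assms]
    theta3_imag[OF t(2)] theta2_imag[OF t(2)] theta4_imag_real[OF t(2)]
  note d = theta3_sq[OF t(1)] theta4_sq[OF t(1)] theta3_theta4[OF t(1)] theta2_sq[OF t(1)] theta_jacobi[OF t(1)]
  have "complex_of_real ((th3 t)\<^sup>2) = of_real ((th3 (2 * t))\<^sup>2 + (th2 (2 * t))\<^sup>2)"
    "complex_of_real ((th4 t)\<^sup>2) = of_real ((th3 (2 * t))\<^sup>2 - (th2 (2 * t))\<^sup>2)"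
    "complex_of_real (th3 t * th4 t) = of_real ((th4 (2 * t))\<^sup>2)"
    "complex_of_real ((th2 t)\<^sup>2) = of_real (2 * th2 (2 * t) * th3 (2 * t))"
    "complex_of_real (th3 t ^ 4) = of_real (th2 t ^ 4 + th4 t ^ 4)"
    using d unfolding double_imag r by simp_all
  then show "(th3 t)\<^sup>2 = (th3 (2 * t))\<^sup>2 + (th2 (2 * t))\<^sup>2" "(th4 t)\<^sup>2 = (th3 (2 * t))\<^sup>2 - (th2 (2 * t))\<^sup>2"
    "th3 t * th4 t = (th4 (2 * t))\<^sup>2" "(th2 t)\<^sup>2 = 2 * th2 (2 * t) * th3 (2 * t)"
    "th3 t ^ 4 = th2 t ^ 4 + th4 t ^ 4"
    by (simp_all only: of_real_eq_iff)
qed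

lemma tendsto_nome_pow:
  assumes "t > 0" shows "(\<lambda>n. nome (\<i> * of_real (2 ^ n * t))) \<longlonglongrightarrow> 0"
proof -
  have "(\<lambda>n. exp (- (pi * (2 ^ n * t)))) \<longlonglongrightarrow> 0" using assms by real_asymp
  from tendsto_of_real[OF this, where 'a = complex] show ?thesis unfolding nome_imag by simp
qed

lemma th_limits:
  assumes "t > 0"
  shows "(\<lambda>n. th3 (2 ^ n * t)) \<longlonglongrightarrow> 1" "(\<lambda>n. th4 (2 ^ n * t)) \<longlonglongrightarrow> 1"
    "(\<lambda>n. Re (psi_q (nome (\<i> * of_real (2 ^ n * t))))) \<longlonglongrightarrow> 1"
proof -
  have p: "2 ^ n * t > 0" for n using assms by simp
  have eq: "th3 (2 ^ n * t) = Re (theta3_q (nome (\<i> * of_real (2 ^ n * t))))"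
    "th4 (2 ^ n * t) = Re (theta3_q (- nome (\<i> * of_real (2 ^ n * t))))" for n
    using p[of n] by (simp_all add: th3_def th4_def theta3_eq_q theta4_eq_q)
  have l0: "(\<lambda>n. - nome (\<i> * of_real (2 ^ n * t))) \<longlonglongrightarrow> 0"
    using tendsto_minus[OF tendsto_nome_pow[OF assms]] by simp
  show "(\<lambda>n. th3 (2 ^ n * t)) \<longlonglongrightarrow> 1" "(\<lambda>n. th4 (2 ^ n * t)) \<longlonglongrightarrow> 1"
    "(\<lambda>n. Re (psi_q (nome (\<i> * of_real (2 ^ n * t))))) \<longlonglongrightarrow> 1"
    unfolding eq using tendsto_Re[OF tendsto_theta_q(1)[OF tendsto_nome_pow[OF assms]]]
      tendsto_Re[OF tendsto_theta_q(1)[OF l0]] tendsto_Re[OF tendsto_theta_q(2)[OF tendsto_nome_pow[OF assms]]]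
    by simp_all
qed

lemma th4_pos:
  assumes "t > 0"
  shows "th4 t > 0"
proof -
  have nz: "th4 s \<noteq> 0" if s: "s > 0" for s
  proof
    assume 0: "th4 s = 0"
    have "th4 (2 ^ n * s) = 0" for n
    proof (induction n)
      case (Suc n)
      have "2 ^ n * s > 0" using s by simp
      from th_double(3)[OF this] Suc show ?case by (simp add: mult.assoc)
    qed (use 0 in simp)
    then show False using th_limits(2)[OF s] by (simp add: LIMSEQ_const_iff)
  qed
  have "th3 t * th4 t > 0"
    using th_double(3)[OF assms] nz[of "2 * t"] assms by simp
  then show ?thesis using th3_pos[OF assms] by (simp add: zero_less_mult_iff)
qed

section \<open>Inverting the modular function by Landen's iteration\<close>

abbreviation left_half :: "complex set" where
  "left_half \<equiv> {v. Re v < 0}"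

lemma open_left_half: "open left_half"
  by (rule open_halfspace_Re_lt)

lemma connected_left_half: "connected left_half"
  by (rule convex_connected) (rule convex_halfspace_Re_lt)

text \<open>The complementary modulus k' belonging to the parameter m = exp v.\<close>

definition kp :: "complex \<Rightarrow> complex" where
  "kp v = csqrt (1 - exp v)"

lemma norm_exp_left: "v \<in> left_half \<Longrightarrow> norm (exp v) < 1"
  by simp

lemma one_minus_exp_left: "v \<in> left_half \<Longrightarrow> 1 - exp v \<notin> \<real>\<^sub>\<le>\<^sub>0"
  using slit_planeI[OF norm_exp_left, of v] by (simp only: Compl_iff mem_slit_iff simp_thms)

lemma Re_kp: "v \<in> left_half \<Longrightarrow> Re (kp v) > 0"
  unfolding kp_def by (intro Re_csqrt_pos one_minus_exp_left)

lemma kp_sq: "(kp v)\<^sup>2 = 1 - exp v"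
  by (simp add: kp_def)

lemma one_plus_kp: "v \<in> left_half \<Longrightarrow> 1 + kp v \<notin> \<real>\<^sub>\<le>\<^sub>0"
  using Re_kp[of v] by (auto simp: complex_nonpos_Reals_iff)

lemma holomorphic_on_kp: "kp holomorphic_on left_half"
  unfolding kp_def by (intro holomorphic_intros one_minus_exp_left)

text \<open>A logarithm of k^2: since 1 - k'^2 = m, the Landen modulus is k = m / (1 + k')^2, so k^2
  = m^2 / (1 + k')^4. The principal logarithm of 1 + k' is holomorphic here because Re k' >
  0.\<close>

definition landen_step :: "complex \<Rightarrow> complex" where
  "landen_step v = 2 * v - 4 * Ln (1 + kp v)"

lemma holomorphic_on_landen_step: "landen_step holomorphic_on left_half"
  unfolding landen_step_def by (intro holomorphic_intros holomorphic_on_kp one_plus_kp)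

lemma norm_one_plus_gt_1: "Re s > 0 \<Longrightarrow> norm (1 + s) > 1"
  using complex_Re_le_cmod[of "1 + s"] by simp

lemma Re_landen_step: "v \<in> left_half \<Longrightarrow> Re (landen_step v) \<le> 2 * Re v"
  using norm_one_plus_gt_1[OF Re_kp[of v]] one_plus_nz[OF Re_kp[of v]] by (simp add: landen_step_def)

lemma landen_step_left: "v \<in> left_half \<Longrightarrow> landen_step v \<in> left_half"
  using Re_landen_step[of v] by simp

text \<open>A bound uniform in v, for the convergence of L^n(v) / 2^n. From |1 + k'| \<le> 3 the
  real part is at most 2, and the imaginary part is at most \<pi> < 4.\<close>

lemma norm_Ln_kp:
  assumes "v \<in> left_half"
  shows "norm (Ln (1 + kp v)) \<le> 6"
proof -
  let ?z = "1 + kp v"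
  have z: "norm ?z > 1" "?z \<noteq> 0"
    using norm_one_plus_gt_1[OF Re_kp[OF assms]] by auto
  have "(norm (kp v))\<^sup>2 = norm (1 - exp v)" by (simp add: kp_sq flip: norm_power)
  also have "\<dots> \<le> 1 + norm (exp v)" using norm_triangle_ineq4[of 1 "exp v"] by simp
  also have "\<dots> \<le> 2\<^sup>2" using norm_exp_left[OF assms] unfolding power2_eq_square by linarith
  finally have "norm (kp v) \<le> 2" by (rule power2_le_imp_le) simp
  then have "norm ?z \<le> 3" using norm_triangle_ineq[of 1 "kp v"] by simp
  moreover have "ln (norm ?z) \<le> norm ?z - 1" using z by (intro ln_le_minus_one) auto
  ultimately have "\<bar>Re (Ln ?z)\<bar> \<le> 2" using z by simp
  moreover have "\<bar>Im (Ln ?z)\<bar> \<le> 4" using Im_Ln_le_pi[OF z(2)] mpi_less_Im_Ln[OF z(2)] pi_less_4 by linarith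
  ultimately show ?thesis using cmod_le[of "Ln ?z"] by linarith
qed

definition landen_iter :: "nat \<Rightarrow> complex \<Rightarrow> complex" where
  "landen_iter n = landen_step ^^ n"

lemma landen_iter_simps [simp]: "landen_iter 0 v = v" "landen_iter (Suc n) v = landen_step (landen_iter n v)"
  by (simp_all add: landen_iter_def)

lemma landen_iter_left: "v \<in> left_half \<Longrightarrow> landen_iter n v \<in> left_half"
  by (induction n) (auto intro: landen_step_left[simplified])

lemma Re_landen_iter: "v \<in> left_half \<Longrightarrow> Re (landen_iter n v) \<le> 2 ^ n * Re v"
proof (induction n)
  case (Suc n)
  then show ?case using Re_landen_step[OF landen_iter_left[OF Suc(2), of n]] by simp
qed simp

lemma holomorphic_on_landen_iter: "landen_iter n holomorphic_on left_half"
proof (induction n)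
  case 0
  have "landen_iter 0 = (\<lambda>v. v)" by auto
  then show ?case by simp
next
  case (Suc n)
  have "landen_iter (Suc n) = landen_step \<circ> landen_iter n" by auto
  moreover have "\<dots> holomorphic_on left_half"
    by (rule holomorphic_on_compose_gen[OF Suc holomorphic_on_landen_step])
      (use landen_iter_left in auto)
  ultimately show ?case by (simp only:)
qed

text \<open>The limit of L^n(v) / 2^n as a telescoping series: step k of the iteration contributes
  -4 Ln(1 + k') / 2^(k + 1). The value is \<pi> \<i> \<tau>, the logarithm of the nome.\<close>

definition log_nome :: "complex \<Rightarrow> complex" where
  "log_nome v = v + (\<Sum>k. - 2 * Ln (1 + kp (landen_iter k v)) / 2 ^ k)"

lemma landen_iter_sum: "landen_iter n v / 2 ^ n = v + (\<Sum>k<n. - 2 * Ln (1 + kp (landen_iter k v)) / 2 ^ k)"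
proof (induction n)
  case (Suc n)
  have "landen_iter (Suc n) v / 2 ^ Suc n = landen_iter n v / 2 ^ n - 2 * Ln (1 + kp (landen_iter n v)) / 2 ^ n"
    by (simp add: landen_step_def diff_divide_distrib)
  then show ?case using Suc by simp
qed simp

lemma uniform_limit_log_nome:
  "uniform_limit left_half (\<lambda>n v. landen_iter n v / 2 ^ n) log_nome sequentially"
proof -
  have "uniform_limit left_half (\<lambda>n v. \<Sum>k<n. - 2 * Ln (1 + kp (landen_iter k v)) / 2 ^ k)
      (\<lambda>v. \<Sum>k. - 2 * Ln (1 + kp (landen_iter k v)) / 2 ^ k) sequentially"
  proof (rule Weierstrass_m_test)
    show "summable (\<lambda>k. 12 * (1 / 2 :: real) ^ k)" by (intro summable_mult summable_geometric) auto
    fix k v assume "v \<in> left_half"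
    from norm_Ln_kp[OF landen_iter_left[OF this, of k]]
    show "norm (- 2 * Ln (1 + kp (landen_iter k v)) / 2 ^ k) \<le> 12 * (1 / 2) ^ k"
      by (simp add: norm_divide norm_mult norm_power power_divide divide_right_mono)
  qed
  from uniform_limit_add[OF uniform_limit_const this, of "\<lambda>v. v"] show ?thesis
    unfolding landen_iter_sum log_nome_def[abs_def] .
qed

lemma holomorphic_on_log_nome: "log_nome holomorphic_on left_half"
proof (rule holomorphic_uniform_sequence[OF open_left_half])
  show "(\<lambda>v. landen_iter n v / 2 ^ n) holomorphic_on left_half" for n
    by (intro holomorphic_intros holomorphic_on_landen_iter) auto
  fix v assume "v \<in> left_half"
  then obtain d where "d > 0" "cball v d \<subseteq> left_half"
    using open_left_half open_contains_cball by blast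
  then show "\<exists>d>0. cball v d \<subseteq> left_half \<and> uniform_limit (cball v d) (\<lambda>n v. landen_iter n v / 2 ^ n) log_nome sequentially"
    using uniform_limit_on_subset[OF uniform_limit_log_nome] by blast
qed

lemma tendsto_log_nome: "v \<in> left_half \<Longrightarrow> (\<lambda>n. landen_iter n v / 2 ^ n) \<longlonglongrightarrow> log_nome v"
  using tendsto_uniform_limitI[OF uniform_limit_log_nome] .

lemma Re_log_nome:
  assumes "v \<in> left_half" shows "Re (log_nome v) \<le> Re v"
proof (rule LIMSEQ_le_const2[OF tendsto_Re[OF tendsto_log_nome[OF assms]]])
  have "Re (landen_iter n v / 2 ^ n) \<le> Re v" for n
  proof -
    have "Re (landen_iter n v / 2 ^ n) = Re (landen_iter n v) / 2 ^ n"
      using Re_divide_of_real[of "landen_iter n v" "2 ^ n"] by simp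
    then show ?thesis using Re_landen_iter[OF assms, of n] by (simp add: field_simps)
  qed
  then show "\<exists>N. \<forall>n\<ge>N. Re (landen_iter n v / 2 ^ n) \<le> Re v" by blast
qed

definition tau_of :: "complex \<Rightarrow> complex" where
  "tau_of v = log_nome v / (of_real pi * \<i>)"

lemma tau_of_Im: "Im (tau_of v) = - Re (log_nome v) / pi"
proof -
  have "tau_of v = - \<i> * log_nome v / of_real pi" by (simp add: tau_of_def field_simps)
  then show ?thesis by (simp add: Im_divide_of_real)
qed

lemma tau_of_upper: "v \<in> left_half \<Longrightarrow> Im (tau_of v) > 0"
  using Re_log_nome[of v] by (simp add: tau_of_Im divide_neg_pos)

lemma holomorphic_on_tau_of: "tau_of holomorphic_on left_half"
  unfolding tau_of_def by (intro holomorphic_intros holomorphic_on_log_nome) auto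

lemma landen_step_real:
  assumes "x < 0"
  shows "landen_step (of_real x) = of_real (2 * x - 4 * ln (1 + sqrt (1 - exp x)))"
proof -
  have k: "kp (of_real x) = of_real (sqrt (1 - exp x))"
  proof -
    have "1 - exp (of_real x) = complex_of_real (1 - exp x)" by (simp add: exp_of_real)
    then show ?thesis using assms of_real_sqrt[of "1 - exp x"] by (simp add: kp_def)
  qed
  have "Ln (of_real (1 + sqrt (1 - exp x))) = of_real (ln (1 + sqrt (1 - exp x)))"
    by (rule Ln_of_real) (use assms in \<open>auto intro!: add_pos_nonneg\<close>)
  then show ?thesis by (simp add: landen_step_def k)
qed

text \<open>L preserves the negative reals, so \<open>tau_of\<close> sends them to the imaginary
  axis. This is how \<open>lam_inverse\<close> finds a point of that axis with a prescribed value of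
  \<lambda>.\<close>

lemma log_nome_real:
  assumes "x < 0"
  shows "Im (log_nome (of_real x)) = 0"
proof -
  have "Im (landen_iter n (of_real x)) = 0" for n
  proof (induction n)
    case (Suc n)
    have "landen_iter n (of_real x) = of_real (Re (landen_iter n (of_real x)))"
      using Suc by (simp add: complex_eq_iff)
    moreover have "Re (landen_iter n (of_real x)) < 0"
      using landen_iter_left[of "of_real x" n] assms by simp
    ultimately show ?case using landen_step_real by (metis Im_complex_of_real landen_iter_simps(2))
  qed simp
  then have "Im (landen_iter n (of_real x) / 2 ^ n) = 0" for n
    using Im_divide_of_real[of "landen_iter n (of_real x)" "2 ^ n"] by simp
  then have "(\<lambda>n. Im (landen_iter n (of_real x) / 2 ^ n)) \<longlonglongrightarrow> 0" by simp
  with tendsto_Im[OF tendsto_log_nome[of "of_real x"]] assms show ?thesis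
    using LIMSEQ_unique by auto
qed

subsection \<open>The iteration on the imaginary axis\<close>

definition lam :: "real \<Rightarrow> real" where
  "lam t = (th2 t / th3 t) ^ 4"

context
  fixes t :: real
  assumes t: "t > 0"
begin

lemma lam_pos: "lam t > 0"
  using th2_pos[OF t] th3_pos[OF t] by (simp add: lam_def)

lemma one_minus_lam: "1 - lam t = ((th4 t)\<^sup>2 / (th3 t)\<^sup>2)\<^sup>2"
proof -
  have "1 - lam t = (th3 t ^ 4 - th2 t ^ 4) / th3 t ^ 4"
    using th3_pos[OF t] by (simp add: lam_def power_divide diff_divide_distrib)
  also have "\<dots> = th4 t ^ 4 / th3 t ^ 4" using th_double(5)[OF t] by simp
  finally show ?thesis by (simp add: power_divide flip: power_mult)
qed

lemma lam_less_1: "lam t < 1"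
proof -
  have "1 - lam t > 0" unfolding one_minus_lam using th3_pos[OF t] th4_pos[OF t] by simp
  then show ?thesis by simp
qed

lemma sqrt_one_minus_lam: "sqrt (1 - lam t) = (th4 t)\<^sup>2 / (th3 t)\<^sup>2"
  unfolding one_minus_lam by simp

lemma one_plus_sqrt: "1 + sqrt (1 - lam t) = 2 * (th3 (2 * t))\<^sup>2 / (th3 t)\<^sup>2"
proof -
  have "1 + sqrt (1 - lam t) = ((th3 t)\<^sup>2 + (th4 t)\<^sup>2) / (th3 t)\<^sup>2"
    using th3_pos[OF t] by (simp add: sqrt_one_minus_lam add_divide_distrib)
  also have "(th3 t)\<^sup>2 + (th4 t)\<^sup>2 = 2 * (th3 (2 * t))\<^sup>2" using th_double(1,2)[OF t] by simp
  finally show ?thesis .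
qed

lemma csqrt_lam: "csqrt (1 - of_real (lam t)) = of_real (sqrt (1 - lam t))"
proof -
  have "1 - of_real (lam t) = complex_of_real (1 - lam t)" by simp
  then show ?thesis using lam_less_1 of_real_sqrt[of "1 - lam t"] by simp
qed

text \<open>The left side is Landen's k^2. With the square root expressed by \<open>th4\<close> and
  \<open>th3\<close>, both factors \<open>th3 t\<close> cancel and the duplication formula for
  \<open>th2\<close> leaves \<lambda> at 2 t.\<close>

lemma lam_double: "(lam t)\<^sup>2 / (1 + sqrt (1 - lam t)) ^ 4 = lam (2 * t)"
proof -
  have p: "th3 t > 0" "th3 (2 * t) > 0" using t by (auto intro: th3_pos)
  have "(lam t)\<^sup>2 / (1 + sqrt (1 - lam t)) ^ 4 = ((th2 t)\<^sup>2) ^ 4 / (2 * (th3 (2 * t))\<^sup>2) ^ 4"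
  proof -
    have "(lam t)\<^sup>2 = th2 t ^ 8 / th3 t ^ 8" by (simp add: lam_def power_divide flip: power_mult)
    then show ?thesis unfolding one_plus_sqrt using p
      by (simp add: power_divide power_mult_distrib flip: power_mult)
  qed
  also have "\<dots> = lam (2 * t)"
    unfolding th_double(4)[OF t] lam_def using p
    by (simp add: power_divide power_mult_distrib field_simps flip: power_mult power_add)
  finally show ?thesis .
qed

lemma landen_step_lam: "landen_step (of_real (ln (lam t))) = of_real (ln (lam (2 * t)))"
proof -
  have p: "1 + sqrt (1 - lam t) > 0" using lam_less_1 by (intro add_pos_nonneg) auto
  have "ln (lam t) < 0" using lam_pos lam_less_1 by simp
  then have "landen_step (of_real (ln (lam t))) = of_real (2 * ln (lam t) - 4 * ln (1 + sqrt (1 - lam t)))"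
    using lam_pos by (subst landen_step_real) auto
  also have "2 * ln (lam t) - 4 * ln (1 + sqrt (1 - lam t)) = ln ((lam t)\<^sup>2 / (1 + sqrt (1 - lam t)) ^ 4)"
    using p lam_pos by (subst ln_div) (auto simp: ln_realpow)
  finally show ?thesis by (simp only: lam_double)
qed

lemma landen_k_lam:
  "1 + landen_k (of_real (lam t)) = of_real ((th3 t)\<^sup>2 / (th3 (2 * t))\<^sup>2)"
  "(landen_k (of_real (lam t)))\<^sup>2 = of_real (lam (2 * t))"
proof -
  define s where "s = sqrt (1 - lam t)"
  have p: "1 + s > 0" using lam_less_1 unfolding s_def by (intro add_pos_nonneg) auto
  have l: "lam t = (1 - s) * (1 + s)" using lam_less_1 by (simp add: s_def algebra_simps)
  have k: "landen_k (of_real (lam t)) = of_real ((1 - s) / (1 + s))"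
    unfolding landen_k_def csqrt_lam s_def[symmetric] by simp
  have "(1 - s) / (1 + s) + 1 = 2 / (1 + s)" using p by (simp add: field_simps)
  also have "\<dots> = (th3 t)\<^sup>2 / (th3 (2 * t))\<^sup>2" unfolding s_def one_plus_sqrt by simp
  finally have "complex_of_real ((1 - s) / (1 + s) + 1) = of_real ((th3 t)\<^sup>2 / (th3 (2 * t))\<^sup>2)"
    by (simp only:)
  then have "1 + of_real ((1 - s) / (1 + s)) = complex_of_real ((th3 t)\<^sup>2 / (th3 (2 * t))\<^sup>2)"
    by (simp only: of_real_add of_real_1 add.commute)
  then show "1 + landen_k (of_real (lam t)) = of_real ((th3 t)\<^sup>2 / (th3 (2 * t))\<^sup>2)"
    by (simp only: k)
  have "((1 - s) / (1 + s))\<^sup>2 = (lam t)\<^sup>2 / (1 + s) ^ 4"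
  proof -
    have "(lam t)\<^sup>2 / (1 + s) ^ 4 = ((1 - s) * (1 + s))\<^sup>2 / (1 + s) ^ 4" by (simp only: l[symmetric])
    also have "\<dots> = ((1 - s) / (1 + s))\<^sup>2"
      using p by (simp add: power_divide power_mult_distrib divide_simps flip: power_add)
    finally show ?thesis by simp
  qed
  also have "\<dots> = lam (2 * t)" using lam_double by (simp add: s_def)
  finally show "(landen_k (of_real (lam t)))\<^sup>2 = of_real (lam (2 * t))"
    by (simp only: k flip: of_real_power)
qed

end

section \<open>Limits along the orbit t, 2 t, 4 t, ...\<close>

lemma pow2_pos: "t > 0 \<Longrightarrow> 2 ^ n * t > (0::real)"
  by simp

lemma landen_iter_lam: "t > 0 \<Longrightarrow> landen_iter n (of_real (ln (lam t))) = of_real (ln (lam (2 ^ n * t)))"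
  by (induction n) (simp_all add: landen_step_lam mult.assoc)

text \<open>The form \<lambda> = 16 q (\<psi> / \<theta>3)^4 with q = exp(- \<pi> t). The second
  term converges along the orbit, so after division by 2^n only - \<pi> t remains.\<close>

lemma ln_lam:
  assumes "t > 0"
  shows "ln (lam t) = - pi * t + 4 * ln (2 * Re (psi_q (nome (\<i> * of_real t))) / th3 t)"
    and "Re (psi_q (nome (\<i> * of_real t))) > 0"
proof -
  have "theta2 (\<i> * of_real t) = 2 * exp (of_real pi * \<i> * (\<i> * of_real t) / 4) * psi_q (nome (\<i> * of_real t))"
    using assms by (intro theta2_eq_q) simp
  also have "exp (of_real pi * \<i> * (\<i> * of_real t) / 4) = of_real (exp (- (pi * t) / 4))"
    by (simp add: exp_of_real [symmetric] mult_ac del: exp_of_real)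
  finally have e: "th2 t = 2 * exp (- (pi * t) / 4) * Re (psi_q (nome (\<i> * of_real t)))"
    by (simp add: th2_def del: exp_of_real)
  then show p: "Re (psi_q (nome (\<i> * of_real t))) > 0"
    using th2_pos[OF assms] by (simp add: zero_less_mult_iff)
  have "ln (lam t) = 4 * ln (exp (- (pi * t) / 4) * (2 * Re (psi_q (nome (\<i> * of_real t))) / th3 t))"
    using th2_pos[OF assms] th3_pos[OF assms] by (simp add: lam_def ln_realpow e mult_ac)
  also have "\<dots> = - pi * t + 4 * ln (2 * Re (psi_q (nome (\<i> * of_real t))) / th3 t)"
    using p th3_pos[OF assms] by (subst ln_mult) auto
  finally show "ln (lam t) = - pi * t + 4 * ln (2 * Re (psi_q (nome (\<i> * of_real t))) / th3 t)" .
qed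

lemma tendsto_ln_lam:
  assumes "t > 0"
  shows "(\<lambda>n. ln (lam (2 ^ n * t)) / 2 ^ n) \<longlonglongrightarrow> - pi * t"
proof -
  have A: "(\<lambda>n. 4 * ln (2 * Re (psi_q (nome (\<i> * of_real (2 ^ n * t)))) / th3 (2 ^ n * t))) \<longlonglongrightarrow> 4 * ln (2 * 1 / 1)"
    by (intro tendsto_intros th_limits assms) auto
  have B: "(\<lambda>n. (1/2 :: real) ^ n) \<longlonglongrightarrow> 0" by (intro LIMSEQ_realpow_zero) auto
  have "(\<lambda>n. - pi * t + 4 * ln (2 * Re (psi_q (nome (\<i> * of_real (2 ^ n * t)))) / th3 (2 ^ n * t)) * (1/2) ^ n)
      \<longlonglongrightarrow> - pi * t + 4 * ln (2 * 1 / 1) * 0"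
    by (intro tendsto_add tendsto_const tendsto_mult[OF A B])
  moreover have "- pi * t + 4 * ln (2 * Re (psi_q (nome (\<i> * of_real (2 ^ n * t)))) / th3 (2 ^ n * t)) * (1/2) ^ n
      = ln (lam (2 ^ n * t)) / 2 ^ n" for n
    unfolding ln_lam[OF pow2_pos[OF assms]] by (simp add: field_simps power_divide)
  ultimately show ?thesis by simp
qed

lemma tau_of_lam:
  assumes "t > 0"
  shows "tau_of (of_real (ln (lam t))) = \<i> * of_real t"
proof -
  have "of_real (ln (lam t)) \<in> left_half" using lam_pos[OF assms] lam_less_1[OF assms] by simp
  from tendsto_log_nome[OF this]
  have "(\<lambda>n. of_real (ln (lam (2 ^ n * t)) / 2 ^ n)) \<longlonglongrightarrow> log_nome (of_real (ln (lam t)))"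
    by (simp add: landen_iter_lam assms)
  from LIMSEQ_unique[OF this tendsto_of_real[OF tendsto_ln_lam[OF assms]]]
  show ?thesis by (simp add: tau_of_def field_simps)
qed

lemma tendsto_lam:
  assumes "t > 0" shows "(\<lambda>n. lam (2 ^ n * t)) \<longlonglongrightarrow> 0"
proof -
  have "(\<lambda>n. 1 - ((th4 (2 ^ n * t))\<^sup>2 / (th3 (2 ^ n * t))\<^sup>2)\<^sup>2) \<longlonglongrightarrow> 1 - (1\<^sup>2 / 1\<^sup>2)\<^sup>2"
    by (intro tendsto_intros th_limits assms) auto
  moreover have "1 - ((th4 (2 ^ n * t))\<^sup>2 / (th3 (2 ^ n * t))\<^sup>2)\<^sup>2 = lam (2 ^ n * t)" for n
    using one_minus_lam[OF pow2_pos[OF assms, of n]] by simp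
  ultimately show ?thesis by simp
qed

text \<open>Passing from t to 2 t divides both F(\<lambda>) and the square of \<open>th3\<close> by
  1 + k. Their quotient is therefore constant along the orbit, and its limit is 1.\<close>

lemma hypF_lam:
  assumes "t > 0"
  shows "hypF (of_real (lam t)) = of_real ((th3 t)\<^sup>2)"
proof -
  have iter: "hypF (of_real (lam t)) / of_real ((th3 t)\<^sup>2)
      = hypF (of_real (lam (2 ^ n * t))) / of_real ((th3 (2 ^ n * t))\<^sup>2)" for n
  proof (induction n)
    case (Suc n)
    let ?s = "2 ^ n * t"
    have s: "?s > 0" "th3 ?s > 0" "th3 (2 * ?s) > 0" using assms by (auto intro: th3_pos)
    have "norm (complex_of_real (lam ?s)) < 1" using lam_pos[OF s(1)] lam_less_1[OF s(1)] by simp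
    from hypF_landen[OF this]
    have "hypF (of_real (lam ?s)) = of_real ((th3 ?s)\<^sup>2 / (th3 (2 * ?s))\<^sup>2) * hypF (of_real (lam (2 * ?s)))"
      unfolding landen_k_lam[OF s(1)] .
    then have "hypF (of_real (lam ?s)) / of_real ((th3 ?s)\<^sup>2) = hypF (of_real (lam (2 * ?s))) / of_real ((th3 (2 * ?s))\<^sup>2)"
      using s by simp
    then show ?case using Suc by (simp add: mult.assoc)
  qed simp
  have "(\<lambda>n. hypF (of_real (lam (2 ^ n * t))) / of_real ((th3 (2 ^ n * t))\<^sup>2)) \<longlonglongrightarrow> 1 / of_real (1\<^sup>2)"
    by (intro tendsto_intros th_limits assms tendsto_hypF_0
        tendsto_of_real[OF tendsto_lam[OF assms], where 'a = complex, unfolded of_real_0])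
      auto
  then have "(\<lambda>n. hypF (of_real (lam t)) / of_real ((th3 t)\<^sup>2)) \<longlonglongrightarrow> 1"
    by (simp only: iter[symmetric]) simp
  then have "hypF (of_real (lam t)) / of_real ((th3 t)\<^sup>2) = 1" by (simp add: LIMSEQ_const_iff)
  then show ?thesis using th3_pos[OF assms] by simp
qed

section \<open>From the imaginary axis to the half-plane\<close>

lemma isCont_th:
  assumes "t > 0" shows "isCont th2 t" "isCont th3 t"
proof -
  have "theta2 holomorphic_on {z. Im z > 0}" "theta3 holomorphic_on {z. Im z > 0}"
    by (auto intro!: holomorphic_on_theta holomorphic_intros)
  then have c: "isCont theta2 (\<i> * of_real t)" "isCont theta3 (\<i> * of_real t)"
    using assms by (auto dest!: holomorphic_on_imp_continuous_on simp: continuous_on_eq_continuous_at open_halfspace_Im_gt)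
  have "isCont (\<lambda>t. \<i> * of_real t) t" by (intro continuous_intros)
  from isCont_o2[OF this c(1)] isCont_o2[OF this c(2)] show "isCont th2 t" "isCont th3 t"
    unfolding th2_def[abs_def] th3_def[abs_def] by (auto intro!: continuous_intros)
qed

text \<open>A convergent sequence of values is not enough: they must differ from the limit.
  Injectivity is free, because \<open>tau_of\<close> recovers \<i> t from ln(\<lambda>(\<i>
  t)).\<close>

lemma ln_lam_islimpt: "complex_of_real (ln (lam 1)) islimpt (\<lambda>t. of_real (ln (lam t))) ` {0<..}"
proof -
  define f where "f n = complex_of_real (ln (lam (1 + 1 / real (Suc n))))" for n
  have "isCont (\<lambda>t. ln (lam t)) 1"
    unfolding lam_def using th2_pos[of 1] th3_pos[of 1] by (intro continuous_intros isCont_th isCont_ln') auto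
  moreover have "(\<lambda>n. 1 + 1 / real (Suc n)) \<longlonglongrightarrow> 1" by real_asymp
  ultimately have "(\<lambda>n. ln (lam (1 + 1 / real (Suc n)))) \<longlonglongrightarrow> ln (lam 1)"
    by (rule isCont_tendsto_compose)
  then have "f \<longlonglongrightarrow> complex_of_real (ln (lam 1))" unfolding f_def by (rule tendsto_of_real)
  moreover have "f n \<in> (\<lambda>t. of_real (ln (lam t))) ` {0<..} - {complex_of_real (ln (lam 1))}" for n
  proof -
    let ?t = "1 + 1 / real (Suc n)"
    have t: "?t > 0" by (simp add: add_pos_pos)
    have "tau_of (f n) \<noteq> tau_of (of_real (ln (lam 1)))"
      using tau_of_lam[OF t] tau_of_lam[of 1] unfolding f_def by (auto simp: complex_eq_iff)
    then show ?thesis using t unfolding f_def by auto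
  qed
  ultimately show ?thesis unfolding islimpt_sequential by blast
qed

lemma lam_identity:
  assumes "f holomorphic_on A" "g holomorphic_on A" "open A" "connected A" "of_real ` {..<0} \<subseteq> A"
    "\<And>t. t > 0 \<Longrightarrow> f (of_real (ln (lam t))) = g (of_real (ln (lam t)))" "v \<in> A"
  shows "f v = g v"
proof -
  have sub: "(\<lambda>t. complex_of_real (ln (lam t))) ` {0<..} \<subseteq> A"
    using assms(5) lam_pos lam_less_1 by auto
  have "f v - g v = 0"
    by (rule analytic_continuation[OF holomorphic_on_diff[OF assms(1,2)] assms(3,4) sub _ ln_lam_islimpt _ assms(7)])
      (use sub assms(6) in auto)
  then show ?thesis by simp
qed

text \<open>On the imaginary axis all the quantities are positive, which selects the roots exp(v/2)
  and k' of m and 1 - m. Both are holomorphic on the half-plane, so the relations between squares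
  continue.\<close>

theorem theta_tau_of:
  assumes "v \<in> left_half"
  shows "(theta2 (tau_of v))\<^sup>2 = exp (v / 2) * (theta3 (tau_of v))\<^sup>2"
    "(theta4 (tau_of v))\<^sup>2 = kp v * (theta3 (tau_of v))\<^sup>2"
    "hypF (exp v) = (theta3 (tau_of v))\<^sup>2"
proof -
  have sub: "complex_of_real ` {..<0} \<subseteq> left_half" by auto
  note hol = holomorphic_on_theta[OF holomorphic_on_tau_of tau_of_upper]
  note id = lam_identity[OF _ _ open_left_half connected_left_half sub _ assms]
  show "(theta2 (tau_of v))\<^sup>2 = exp (v / 2) * (theta3 (tau_of v))\<^sup>2"
  proof (rule id)
    fix t :: real assume t: "t > 0"
    have "exp (ln (lam t) / 2) = (th2 t)\<^sup>2 / (th3 t)\<^sup>2"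
    proof -
      have "ln (lam t) / 2 = ln ((th2 t / th3 t)\<^sup>2)"
        using th2_pos[OF t] th3_pos[OF t] by (simp add: lam_def ln_realpow)
      then show ?thesis using th2_pos[OF t] th3_pos[OF t] by (simp add: power_divide)
    qed
    then have "exp (complex_of_real (ln (lam t)) / 2) = of_real ((th2 t)\<^sup>2 / (th3 t)\<^sup>2)"
      by (metis exp_of_real of_real_divide of_real_numeral)
    then show "(theta2 (tau_of (of_real (ln (lam t)))))\<^sup>2 =
         exp (of_real (ln (lam t)) / 2) * (theta3 (tau_of (of_real (ln (lam t)))))\<^sup>2"
      using th3_pos[OF t] unfolding tau_of_lam[OF t] theta2_imag[OF t] theta3_imag[OF t] by simp
  qed (intro holomorphic_intros hol; simp)+
  show "(theta4 (tau_of v))\<^sup>2 = kp v * (theta3 (tau_of v))\<^sup>2"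
  proof (rule id)
    fix t :: real assume t: "t > 0"
    have "kp (of_real (ln (lam t))) = of_real ((th4 t)\<^sup>2 / (th3 t)\<^sup>2)"
      using csqrt_lam[OF t] lam_pos[OF t] unfolding kp_def sqrt_one_minus_lam[OF t] by (simp add: exp_of_real)
    then show "(theta4 (tau_of (of_real (ln (lam t)))))\<^sup>2 =
         kp (of_real (ln (lam t))) * (theta3 (tau_of (of_real (ln (lam t)))))\<^sup>2"
      using th3_pos[OF t] unfolding tau_of_lam[OF t] theta4_imag_real[OF t] theta3_imag[OF t] by simp
  qed (intro holomorphic_intros hol holomorphic_on_kp; simp)+
  show "hypF (exp v) = (theta3 (tau_of v))\<^sup>2"
  proof (rule id)
    fix t :: real assume t: "t > 0"
    show "hypF (exp (of_real (ln (lam t)))) = (theta3 (tau_of (of_real (ln (lam t)))))\<^sup>2"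
      using hypF_lam[OF t] lam_pos[OF t] unfolding tau_of_lam[OF t] theta3_imag[OF t] by (simp add: exp_of_real)
  qed (intro holomorphic_intros hol; simp)+
qed

text \<open>A zero would pass to all Landen iterates of m, since 1 + k never vanishes. The iterates
  tend to 0, where F is 1.\<close>

lemma hypF_nonzero:
  assumes "norm m < 1"
  shows "hypF m \<noteq> 0"
proof
  assume 0: "hypF m = 0"
  define M where "M n = ((\<lambda>m. (landen_k m)\<^sup>2) ^^ n) m" for n
  have M: "norm (M n) \<le> norm m ^ Suc n \<and> norm (M n) < 1 \<and> hypF (M n) = 0" for n
  proof (induction n)
    case (Suc n)
    let ?m = "M n" and ?k = "landen_k (M n)"
    have m: "norm ?m < 1" "?m \<in> slit_plane" using Suc by (auto intro: slit_planeI)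
    have s: "Re (csqrt (1 - ?m)) > 0" using m(2) by (intro Re_csqrt_pos) (simp only: Compl_iff mem_slit_iff not_False_eq_True)
    \<comment> \<open>From k (1 + k')^2 = m and |1 + k'| > 1 follows |k| \<le> |m|, so one step at
      least squares the modulus.\<close>
    have "norm (?k * (1 + csqrt (1 - ?m))\<^sup>2) = norm ?m"
    proof -
      have "?k * (1 + csqrt (1 - ?m))\<^sup>2 = (1 - csqrt (1 - ?m)) * (1 + csqrt (1 - ?m))"
        using one_plus_nz[OF s] by (simp add: landen_k_def power2_eq_square)
      also have "\<dots> = 1 - (csqrt (1 - ?m))\<^sup>2" by (simp add: power2_eq_square algebra_simps)
      also have "\<dots> = ?m" by simp
      finally show ?thesis by simp
    qed
    moreover have "norm ((1 + csqrt (1 - ?m))\<^sup>2) \<ge> 1"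
      using norm_one_plus_gt_1[OF s] by (simp add: norm_power)
    ultimately have k: "norm ?k \<le> norm ?m"
      by (metis mult_left_mono mult.right_neutral norm_ge_zero norm_mult)
    have "norm (M (Suc n)) = norm ?k * norm ?k" by (simp add: M_def norm_mult power2_eq_square)
    also have "\<dots> \<le> norm ?m * norm ?m" using k by (intro mult_mono) auto
    also have mm: "\<dots> \<le> norm ?m * norm m"
      using Suc assms power_decreasing[of 1 "Suc n" "norm m"] by (intro mult_left_mono) auto
    also have "\<dots> \<le> norm m ^ Suc n * norm m" using Suc by (intro mult_right_mono) auto
    finally have "norm (M (Suc n)) \<le> norm m ^ Suc (Suc n)" by (simp add: mult_ac)
    moreover have "norm m ^ Suc (Suc n) < 1" using assms by (subst power_less_one_iff) auto
    moreover have "hypF (M (Suc n)) = 0"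
    proof -
      have "1 + ?k \<noteq> 0" using norm_landen_k[OF m(2)] by (auto simp: add_eq_0_iff)
      then show ?thesis using hypF_landen[OF m(1)] Suc by (simp add: M_def)
    qed
    ultimately show ?case by linarith
  qed (use 0 assms in \<open>simp add: M_def\<close>)
  have "(\<lambda>n. norm m ^ Suc n) \<longlonglongrightarrow> 0" using assms by (intro LIMSEQ_Suc LIMSEQ_realpow_zero) auto
  then have "M \<longlonglongrightarrow> 0" by (rule Lim_null_comparison[rotated]) (use M in auto)
  from tendsto_hypF_0[OF this] M show False by (simp add: LIMSEQ_const_iff)
qed

section \<open>The logarithmic singularity and the inversion formula\<close>

definition hyp_coeff :: "nat \<Rightarrow> real" where
  "hyp_coeff n = (pochhammer (1/2) n / fact n)\<^sup>2"

lemma hyp_fps_nth: "fps_nth hyp_fps n = of_real (hyp_coeff n)"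
proof -
  have "pochhammer (1/2) n = complex_of_real (pochhammer (1/2) n)"
    by (simp flip: pochhammer_of_real)
  then show ?thesis
    by (simp add: hyp_coeff_def power2_eq_square flip: pochhammer_fact)
qed

lemma hypF_real_sums:
  assumes "0 \<le> y" "y < 1"
  shows "(\<lambda>n. hyp_coeff n * y ^ n) sums Re (hypF (of_real y))" "hypF (of_real y) = of_real (Re (hypF (of_real y)))"
proof -
  have "(\<lambda>n. complex_of_real (hyp_coeff n * y ^ n)) sums hypF (of_real y)"
    using hypF_sums[of "of_real y"] assms by (simp add: hyp_fps_nth del: fps_hypergeo_nth)
  from sums_Re[OF this] sums_Im[OF this]
  show "(\<lambda>n. hyp_coeff n * y ^ n) sums Re (hypF (of_real y))" "hypF (of_real y) = of_real (Re (hypF (of_real y)))"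
    by (simp_all add: complex_eq_iff sums_iff)
qed

text \<open>Wallis' product in the form of the limit formula for \<open>Gamma (1/2)\<close>.\<close>

lemma tendsto_hyp_coeff: "(\<lambda>n. real n * hyp_coeff n) \<longlonglongrightarrow> 1 / pi"
proof -
  let ?g = "\<lambda>n. Gamma_series (1/2 :: real) n"
  have "?g \<longlonglongrightarrow> sqrt pi" using Gamma_series_LIMSEQ[of "1/2 :: real"] by (simp add: Gamma_one_half_real)
  \<comment> \<open>The product in \<open>Gamma_series\<close> has n + 1 factors; n / (n + 1/2)
    removes the last one and supplies the power of n.\<close>
  then have "(\<lambda>n. (real n / (real n + 1/2))\<^sup>2 / (?g n)\<^sup>2) \<longlonglongrightarrow> 1 / (sqrt pi)\<^sup>2"
    by (intro tendsto_divide tendsto_power) (auto, real_asymp)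
  moreover have "\<forall>\<^sub>F n in sequentially. (real n / (real n + 1/2))\<^sup>2 / (?g n)\<^sup>2 = real n * hyp_coeff n"
  proof (rule eventually_mono[OF eventually_gt_at_top[of 0]])
    fix n :: nat assume n: "0 < n"
    have p: "pochhammer (1/2 :: real) n > 0" by (intro pochhammer_pos) auto
    have e: "(exp (ln (real n) / 2))\<^sup>2 = real n" using n by (simp flip: exp_of_nat_mult)
    have g: "?g n = fact n * exp (ln (real n) / 2) / (pochhammer (1/2) n * (real n + 1/2))"
      by (simp add: Gamma_series_def pochhammer_Suc add.commute)
    have g2: "(?g n)\<^sup>2 = (fact n)\<^sup>2 * real n / ((pochhammer (1/2) n)\<^sup>2 * (real n + 1/2)\<^sup>2)"
      unfolding g power_divide power_mult_distrib e ..
    have "real n + 1/2 > 0" by simp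
    then show "(real n / (real n + 1/2))\<^sup>2 / (?g n)\<^sup>2 = real n * hyp_coeff n"
      unfolding g2 hyp_coeff_def using n p by (simp add: power_divide divide_simps) (simp add: power2_eq_square)
  qed
  ultimately show ?thesis by (auto dest: Lim_transform_eventually)
qed

text \<open>The sum may start at n = 0: its term there is 1 / 0 = 0.\<close>

lemma sums_minus_ln:
  assumes "0 \<le> y" "y < (1::real)"
  shows "(\<lambda>n. y ^ n / real n) sums (- ln (1 - y))"
proof -
  have "(\<lambda>n. - ((- (- y)) ^ n) / real n) sums ln (1 + - y)"
    by (rule ln_series') (use assms in auto)
  from sums_minus[OF this] show ?thesis by simp
qed

text \<open>Abelian argument by comparison with L / n, whose series is - L ln(1 - y). From index N
  on the difference is at most e / n, which costs e times the logarithm; the finitely many earlier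
  terms cost a constant \<open>C\<close>, negligible as the logarithm grows.\<close>

lemma abelian_log:
  fixes c :: "nat \<Rightarrow> real" and f :: "real \<Rightarrow> real" and y :: "nat \<Rightarrow> real"
  assumes c: "(\<lambda>n. real n * c n) \<longlonglongrightarrow> L"
    and f: "\<And>y. 0 \<le> y \<Longrightarrow> y < 1 \<Longrightarrow> (\<lambda>n. c n * y ^ n) sums f y"
    and y: "\<And>k. 0 \<le> y k" "\<And>k. y k < 1" "y \<longlonglongrightarrow> 1"
  shows "(\<lambda>k. f (y k) / - ln (1 - y k)) \<longlonglongrightarrow> L"
proof (rule LIMSEQ_I)
  fix r :: real assume r: "r > 0"
  define e where "e = r / 2"
  have e: "e > 0" using r by (simp add: e_def)
  obtain N where N: "\<And>n. n \<ge> N \<Longrightarrow> \<bar>real n * c n - L\<bar> < e"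
    using LIMSEQ_D[OF c e] by auto
  define C where "C = (\<Sum>n\<le>N. \<bar>c n - L / real n\<bar>)"
  have bound: "\<bar>f z - L * (- ln (1 - z))\<bar> \<le> C + e * (- ln (1 - z))" if z: "0 \<le> z" "z < 1" for z
  proof -
    have d: "(\<lambda>n. (c n - L / real n) * z ^ n) sums (f z - L * (- ln (1 - z)))"
      using sums_diff[OF f[OF z] sums_mult[OF sums_minus_ln[OF z], of L]] by (simp add: algebra_simps)
    have fin: "(\<lambda>n. if n \<in> {..N} then \<bar>c n - L / real n\<bar> else 0) sums C"
      unfolding C_def by (rule sums_If_finite_set) simp
    have b: "(\<lambda>n. (if n \<in> {..N} then \<bar>c n - L / real n\<bar> else 0) + e * (z ^ n / real n)) sums (C + e * (- ln (1 - z)))"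
      by (intro sums_add fin sums_mult sums_minus_ln z)
    have le: "\<bar>(c n - L / real n) * z ^ n\<bar> \<le> (if n \<in> {..N} then \<bar>c n - L / real n\<bar> else 0) + e * (z ^ n / real n)" for n
    proof (cases "n \<le> N")
      case True
      have "\<bar>(c n - L / real n) * z ^ n\<bar> \<le> \<bar>c n - L / real n\<bar>"
        using z by (simp add: abs_mult mult_left_le power_le_one)
      moreover have "0 \<le> e * (z ^ n / real n)" using z e by simp
      ultimately show ?thesis using True by simp
    next
      case False
      then have n: "n \<ge> N" "n > 0" by auto
      have "\<bar>c n - L / real n\<bar> * real n = \<bar>real n * c n - L\<bar>"
      proof -
        have "real n * c n - L = (c n - L / real n) * real n" using n by (simp add: field_simps)
        then show ?thesis by (simp add: abs_mult)
      qed
      then have "\<bar>c n - L / real n\<bar> \<le> e / real n"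
        using N[OF n(1)] n by (simp add: field_simps)
      then have "\<bar>c n - L / real n\<bar> * z ^ n \<le> e / real n * z ^ n"
        using z by (intro mult_right_mono) auto
      then show ?thesis using False z by (simp add: abs_mult)
    qed
    have "summable (\<lambda>n. \<bar>(c n - L / real n) * z ^ n\<bar>)"
      by (rule summable_comparison_test'[OF sums_summable[OF b]]) (use le in auto)
    from summable_rabs[OF this] have "\<bar>f z - L * (- ln (1 - z))\<bar> \<le> (\<Sum>n. \<bar>(c n - L / real n) * z ^ n\<bar>)"
      using sums_unique[OF d] by simp
    also have "\<dots> \<le> C + e * (- ln (1 - z))"
      using suminf_le[OF le \<open>summable _\<close> sums_summable[OF b]] sums_unique[OF b] by simp
    finally show ?thesis .
  qed
  have "filterlim (\<lambda>k. - ln (1 - y k)) at_top sequentially"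
  proof -
    have "filterlim (\<lambda>k. 1 - y k) (at_right 0) sequentially"
      unfolding filterlim_at using tendsto_diff[OF tendsto_const[of 1] y(3)] y(2) by (auto simp: less_imp_neq)
    then have "filterlim (\<lambda>k. ln (1 - y k)) at_bot sequentially"
      by (rule filterlim_compose[OF ln_at_0])
    then show ?thesis by (simp add: filterlim_uminus_at_top)
  qed
  then have "\<forall>\<^sub>F k in sequentially. - ln (1 - y k) > max 0 (C / e)"
    unfolding filterlim_at_top_dense by (rule spec)
  then obtain K where K: "\<And>k. k \<ge> K \<Longrightarrow> - ln (1 - y k) > max 0 (C / e)"
    unfolding eventually_sequentially by blast
  have "norm (f (y k) / - ln (1 - y k) - L) < r" if "k \<ge> K" for k
  proof -
    define l where "l = - ln (1 - y k)"
    \<comment> \<open>The threshold C / e for the logarithm makes the total error C + e l smaller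
      than 2 e l = r l.\<close>
    have l: "l > 0" "C < e * l" using K[OF that] e by (auto simp: l_def field_simps)
    have "\<bar>f (y k) - L * l\<bar> < r * l" using bound[OF y(1,2), of k] l by (simp add: l_def e_def)
    moreover have "f (y k) / l - L = (f (y k) - L * l) / l" using l by (simp add: field_simps)
    ultimately show ?thesis using l by (simp add: l_def[symmetric] abs_divide divide_less_eq)
  qed
  then show "\<exists>K. \<forall>k\<ge>K. norm (f (y k) / - ln (1 - y k) - L) < r" by blast
qed

section \<open>The complementary parameter on the imaginary axis\<close>

definition hypR :: "real \<Rightarrow> real" where
  "hypR y = Re (hypF (of_real y))"

lemma hypF_real: "0 \<le> y \<Longrightarrow> y < 1 \<Longrightarrow> hypF (of_real y) = of_real (hypR y)"
  using hypF_real_sums(2) by (simp add: hypR_def)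

lemma hypR_lam: "t > 0 \<Longrightarrow> hypR (lam t) = (th3 t)\<^sup>2"
  by (simp add: hypR_def hypF_lam)

lemma hypR_landen:
  assumes "0 < k" "k < 1"
  shows "hypR (4 * k / (1 + k)\<^sup>2) = (1 + k) * hypR (k\<^sup>2)" "4 * k / (1 + k)\<^sup>2 < 1"
proof -
  have "(1 - k)\<^sup>2 > 0" using assms by simp
  then have "4 * k < (1 + k)\<^sup>2" by (simp add: power2_eq_square algebra_simps)
  then show l: "4 * k / (1 + k)\<^sup>2 < 1" using assms by simp
  have k2: "k\<^sup>2 < 1" using assms by (simp add: power_less_one_iff)
  have "landen_k (of_real (4 * k / (1 + k)\<^sup>2)) = of_real k"
    using landen_k_inverse[of "of_real k"] assms by simp
  then have "hypF (of_real (4 * k / (1 + k)\<^sup>2)) = (1 + of_real k) * hypF (of_real (k\<^sup>2))"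
    using hypF_landen[of "of_real (4 * k / (1 + k)\<^sup>2)"] l assms by (simp del: of_real_divide)
  then have "of_real (hypR (4 * k / (1 + k)\<^sup>2)) = complex_of_real ((1 + k) * hypR (k\<^sup>2))"
    using assms l k2 by (simp add: hypF_real del: of_real_divide of_real_power)
  then show "hypR (4 * k / (1 + k)\<^sup>2) = (1 + k) * hypR (k\<^sup>2)" by (simp only: of_real_eq_iff)
qed

text \<open>For the complementary parameter the transformation runs upwards: with k the root of 1 -
  \<lambda>(\<i> t) one has 1 - \<lambda>(2 \<i> t) = 4 k / (1 + k)^2. The numerator is thus
  multiplied by 1 + k, the denominator by (1 + k) / 2.\<close>

lemma hypR_compl_double:
  assumes "t > 0"
  shows "hypR (1 - lam (2 * t)) / hypR (lam (2 * t)) = 2 * (hypR (1 - lam t) / hypR (lam t))"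
proof -
  define k where "k = sqrt (1 - lam t)"
  have k: "0 < k" "k < 1" using lam_pos[OF assms] lam_less_1[OF assms] by (auto simp: k_def)
  have k2: "k\<^sup>2 = 1 - lam t" using lam_less_1[OF assms] by (simp add: k_def)
  have p: "th3 t > 0" "th3 (2 * t) > 0" using assms by (auto intro: th3_pos)
  have "lam (2 * t) = (1 - k\<^sup>2)\<^sup>2 / (1 + k) ^ 4" using lam_double[OF assms] by (simp add: k_def[symmetric] k2)
  also have "\<dots> = ((1 - k) / (1 + k))\<^sup>2"
  proof -
    have "1 - k\<^sup>2 = (1 - k) * (1 + k)" by (simp add: power2_eq_square algebra_simps)
    then show ?thesis using k by (simp add: power_divide power_mult_distrib divide_simps flip: power_add)
  qed
  also have "\<dots> = 1 - 4 * k / (1 + k)\<^sup>2"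
    using k by (simp add: power_divide field_simps) (simp add: power2_eq_square algebra_simps)
  finally have "1 - lam (2 * t) = 4 * k / (1 + k)\<^sup>2" by simp
  then have "hypR (1 - lam (2 * t)) = (1 + k) * hypR (1 - lam t)"
    using hypR_landen[OF k] k2 by simp
  also have "1 + k = 2 * (th3 (2 * t))\<^sup>2 / (th3 t)\<^sup>2"
    using one_plus_sqrt[OF assms] by (simp add: k_def)
  finally show ?thesis using assms p by (simp add: hypR_lam field_simps)
qed

lemma hypR_compl_lam:
  assumes "t > 0"
  shows "hypR (1 - lam t) = t * hypR (lam t)"
proof -
  define g where "g t = hypR (1 - lam t) / hypR (lam t)" for t
  have iter: "g (2 ^ n * t) = 2 ^ n * g t" for n
  proof (induction n)
    case (Suc n)
    then show ?case using hypR_compl_double[of "2 ^ n * t"] assms by (simp add: g_def mult_ac)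
  qed simp
  let ?l = "\<lambda>n. lam (2 ^ n * t)"
  have l: "0 < ?l n" "?l n < 1" for n using lam_pos lam_less_1 pow2_pos[OF assms] by blast+
  have 1: "(\<lambda>n. hypR (1 - ?l n) / - ln (1 - (1 - ?l n))) \<longlonglongrightarrow> 1 / pi"
  proof (rule abelian_log[OF tendsto_hyp_coeff])
    show "(\<lambda>n. hyp_coeff n * y ^ n) sums hypR y" if "0 \<le> y" "y < 1" for y
      using hypF_real_sums(1)[OF that] by (simp add: hypR_def)
    show "(\<lambda>n. 1 - ?l n) \<longlonglongrightarrow> 1" using tendsto_diff[OF tendsto_const[of 1] tendsto_lam[OF assms]] by simp
  qed (use l in \<open>auto simp: less_imp_le\<close>)
  have "(\<lambda>n. (th3 (2 ^ n * t))\<^sup>2) \<longlonglongrightarrow> 1\<^sup>2" by (intro tendsto_intros th_limits assms)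
  then have 2: "(\<lambda>n. hypR (?l n)) \<longlonglongrightarrow> 1" by (simp add: hypR_lam assms)
  \<comment> \<open>The three limits are 1 / \<pi> from the logarithmic singularity, \<pi> t from
    the decay of ln \<lambda>, and 1 for the denominator. Their combination is t, while each term
    equals g(t).\<close>
  have "(\<lambda>n. hypR (1 - ?l n) / - ln (1 - (1 - ?l n)) * - (ln (?l n) / 2 ^ n) / hypR (?l n)) \<longlonglongrightarrow> 1 / pi * - (- pi * t) / 1"
    by (intro tendsto_intros 1 2 tendsto_ln_lam assms) auto
  moreover have "hypR (1 - ?l n) / - ln (1 - (1 - ?l n)) * - (ln (?l n) / 2 ^ n) / hypR (?l n) = g t" for n
  proof -
    have "ln (?l n) < 0" using l by simp
    then have "hypR (1 - ?l n) / - ln (1 - (1 - ?l n)) * - (ln (?l n) / 2 ^ n) / hypR (?l n) = g (2 ^ n * t) / 2 ^ n"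
      by (simp add: g_def)
    then show ?thesis by (simp add: iter)
  qed
  ultimately have "g t = t" by (simp add: LIMSEQ_const_iff)
  then show ?thesis using hypR_lam[OF assms] th3_pos[OF assms] by (simp add: g_def field_simps)
qed

text \<open>A point \<i> s with \<lambda>(\<i> s) = 1 - \<lambda>(\<i> t) is supplied by
  \<open>tau_of\<close>. Applying \<open>hypR_compl_lam\<close> at t and at s exchanges the same two
  values of F, so t s = 1.\<close>

lemma lam_inverse:
  assumes "t > 0"
  shows "lam (1 / t) = 1 - lam t"
proof -
  define x where "x = ln (1 - lam t)"
  have x: "x < 0" "exp x = 1 - lam t" using lam_pos[OF assms] lam_less_1[OF assms] by (auto simp: x_def)
  have xl: "complex_of_real x \<in> left_half" using x by simp
  define s where "s = Im (tau_of (of_real x))"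
  have s: "s > 0" using tau_of_upper[OF xl] by (simp add: s_def)
  have ts: "tau_of (of_real x) = \<i> * of_real s"
  proof -
    have "Re (tau_of (of_real x)) = Im (log_nome (of_real x)) / pi"
    proof -
      have "tau_of (of_real x) = - \<i> * log_nome (of_real x) / of_real pi" by (simp add: tau_of_def field_simps)
      then show ?thesis by (simp add: Re_divide_of_real)
    qed
    then show ?thesis using log_nome_real[OF x(1)] by (simp add: s_def complex_eq_iff)
  qed
  have "(complex_of_real (th2 s))\<^sup>2 = exp (of_real x / 2) * (of_real (th3 s))\<^sup>2"
    using theta_tau_of(1)[OF xl] unfolding ts theta2_imag[OF s] theta3_imag[OF s] .
  also have "exp (complex_of_real x / 2) = of_real (exp (x / 2))" by (metis exp_of_real of_real_divide of_real_numeral)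
  finally have "complex_of_real ((th2 s)\<^sup>2) = of_real (exp (x / 2) * (th3 s)\<^sup>2)" by simp
  then have "(th2 s)\<^sup>2 = exp (x / 2) * (th3 s)\<^sup>2" by (simp only: of_real_eq_iff)
  then have "(th2 s / th3 s)\<^sup>2 = exp (x / 2)" using th3_pos[OF s] by (simp add: power_divide)
  then have "((th2 s / th3 s)\<^sup>2)\<^sup>2 = exp x" by (simp flip: exp_double)
  then have ls: "lam s = 1 - lam t" using x by (simp add: lam_def flip: power_mult)
  have "hypR (lam t) > 0" "hypR (lam s) > 0"
    using hypR_lam assms s th3_pos[OF assms] th3_pos[OF s] by simp_all
  then have "t * s = 1"
    using hypR_compl_lam[OF assms] hypR_compl_lam[OF s] ls by (simp add: field_simps)
  then have "s = 1 / t" using assms by (simp add: field_simps)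
  then show ?thesis using ls by simp
qed

lemma th_inverse:
  assumes t: "t > 0"
  shows "(th3 (1 / t))\<^sup>2 = t * (th3 t)\<^sup>2" "(th2 (1 / t))\<^sup>2 = t * (th4 t)\<^sup>2"
proof -
  have t': "1 / t > 0" using t by simp
  show 3: "(th3 (1 / t))\<^sup>2 = t * (th3 t)\<^sup>2"
    using hypR_lam[OF t'] hypR_lam[OF t] hypR_compl_lam[OF t] by (simp add: lam_inverse t)
  have "((th2 (1 / t))\<^sup>2)\<^sup>2 = lam (1 / t) * ((th3 (1 / t))\<^sup>2)\<^sup>2"
    using th3_pos[OF t'] by (simp add: lam_def power_divide flip: power_mult)
  also have "\<dots> = (t * (th4 t)\<^sup>2)\<^sup>2"
    unfolding 3 lam_inverse[OF t] one_minus_lam[OF t] using th3_pos[OF t]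
    by (simp add: power_divide power_mult_distrib)
  finally show "(th2 (1 / t))\<^sup>2 = t * (th4 t)\<^sup>2"
    using t by (subst (asm) power2_eq_iff_nonneg) auto
qed

lemma imag_identity:
  assumes "f holomorphic_on {z. Im z > 0}" "g holomorphic_on {z. Im z > 0}"
    "\<And>t. t > 0 \<Longrightarrow> f (\<i> * of_real t) = g (\<i> * of_real t)" "Im \<tau> > 0"
  shows "f \<tau> = g \<tau>"
proof -
  let ?S = "(\<lambda>t. \<i> * complex_of_real t) ` {0<..}"
  have "(\<lambda>n. \<i> * complex_of_real (1 + 1 / real (Suc n))) \<longlonglongrightarrow> \<i> * of_real 1"
    by (intro tendsto_intros) real_asymp
  moreover have "\<i> * complex_of_real (1 + 1 / real (Suc n)) \<in> ?S - {\<i>}" for n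
    by (auto simp: complex_eq_iff add_pos_pos simp del: of_nat_Suc intro!: imageI)
  ultimately have "\<i> islimpt ?S" unfolding islimpt_sequential
    by (intro exI[of _ "\<lambda>n. \<i> * complex_of_real (1 + 1 / real (Suc n))"]) simp
  moreover have "?S \<subseteq> {z. Im z > 0}" by auto
  moreover have "connected {z. Im z > 0}" by (rule convex_connected[OF convex_halfspace_Im_gt])
  ultimately have "f \<tau> - g \<tau> = 0"
    using analytic_continuation[OF holomorphic_on_diff[OF assms(1,2)] open_halfspace_Im_gt, of ?S \<i> \<tau>] assms(3,4)
    by auto
  then show ?thesis by simp
qed

text \<open>The factor - \<i> \<tau> is t at \<tau> = \<i> t. The first two laws continue
  \<open>th_inverse\<close>; the third is the second at - 1 / \<tau>.\<close>

theorem theta_inversion: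
  assumes "Im \<tau> > 0"
  shows "(theta3 (- 1 / \<tau>))\<^sup>2 = - \<i> * \<tau> * (theta3 \<tau>)\<^sup>2"
    "(theta2 (- 1 / \<tau>))\<^sup>2 = - \<i> * \<tau> * (theta4 \<tau>)\<^sup>2"
    "(theta4 (- 1 / \<tau>))\<^sup>2 = - \<i> * \<tau> * (theta2 \<tau>)\<^sup>2"
proof -
  have up: "Im (- 1 / z) > 0" if "Im z > 0" for z :: complex
  proof -
    have "Im (- 1 / z) = Im z / ((Re z)\<^sup>2 + (Im z)\<^sup>2)" by (simp add: Im_divide)
    moreover have "(Re z)\<^sup>2 + (Im z)\<^sup>2 > 0" using that by (intro add_nonneg_pos) auto
    ultimately show ?thesis using that by simp
  qed
  have nz: "z \<noteq> 0" if "Im z > 0" for z :: complex using that by auto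
  have hS: "(\<lambda>z. - 1 / z) holomorphic_on {z. Im z > 0}"
    by (intro holomorphic_intros) auto
  note hol = holomorphic_on_theta[OF hS] holomorphic_on_theta[OF holomorphic_on_ident]
  have inv: "- 1 / (\<i> * complex_of_real t) = \<i> * of_real (1 / t)" if "t > 0" for t
    using that by (simp add: field_simps)
  have h: "(\<lambda>z. - \<i> * z) holomorphic_on {z. Im z > 0}" by (intro holomorphic_intros)
  have th3: "(theta3 (- 1 / z))\<^sup>2 = - \<i> * z * (theta3 z)\<^sup>2" if "Im z > 0" for z
  proof (rule imag_identity[OF _ _ _ that])
    fix t :: real assume t: "t > 0"
    then have t': "1 / t > 0" by simp
    show "(theta3 (- 1 / (\<i> * of_real t)))\<^sup>2 = - \<i> * (\<i> * of_real t) * (theta3 (\<i> * of_real t))\<^sup>2"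
      unfolding inv[OF t] theta3_imag[OF t] theta3_imag[OF t'] of_real_power[symmetric] th_inverse[OF t] by simp
  qed (intro holomorphic_intros hol h up; simp)+
  then show "(theta3 (- 1 / \<tau>))\<^sup>2 = - \<i> * \<tau> * (theta3 \<tau>)\<^sup>2" using assms by blast
  have th2: "(theta2 (- 1 / z))\<^sup>2 = - \<i> * z * (theta4 z)\<^sup>2" if "Im z > 0" for z
  proof (rule imag_identity[OF _ _ _ that])
    fix t :: real assume t: "t > 0"
    then have t': "1 / t > 0" by simp
    show "(theta2 (- 1 / (\<i> * of_real t)))\<^sup>2 = - \<i> * (\<i> * of_real t) * (theta4 (\<i> * of_real t))\<^sup>2"
      unfolding inv[OF t] theta4_imag_real[OF t] theta2_imag[OF t'] of_real_power[symmetric] th_inverse[OF t] by simp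
  qed (intro holomorphic_intros hol h up; simp)+
  then show "(theta2 (- 1 / \<tau>))\<^sup>2 = - \<i> * \<tau> * (theta4 \<tau>)\<^sup>2" using assms by blast
  have "(theta2 (- 1 / (- 1 / \<tau>)))\<^sup>2 = - \<i> * (- 1 / \<tau>) * (theta4 (- 1 / \<tau>))\<^sup>2"
    by (rule th2[OF up[OF assms]])
  then show "(theta4 (- 1 / \<tau>))\<^sup>2 = - \<i> * \<tau> * (theta2 \<tau>)\<^sup>2"
    using nz[OF assms] by (simp add: field_simps)
qed

section \<open>The mirror map\<close>

text \<open>The identity theorem is used twice: in the strip, to see that \<open>E\<close> meets the
  specification of \<open>ellK_compl\<close>, and in the half-plane, to see that the function
  selected by \<open>SOME\<close> is \<open>E\<close>. Both times the agreement at ln(\<lambda>(\<i>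
  t)) is \<open>hypR_compl_lam\<close>.\<close>

theorem ellK_compl_eq:
  assumes "v \<in> left_half"
  shows "ellK_compl v = - \<i> * tau_of v * ellK (exp v)"
proof -
  define E where "E v = - \<i> * tau_of v * (of_real pi / 2 * hypF (exp v))" for v
  let ?S = "{v. Re v < 0 \<and> \<bar>Im v\<bar> < pi}"
  have S: "?S = left_half \<inter> {v. Im v < pi} \<inter> {v. Im v > - pi}" by auto
  have opS: "open ?S" unfolding S by (intro open_Int open_halfspace_Re_lt open_halfspace_Im_lt open_halfspace_Im_gt)
  have conS: "connected ?S" unfolding S
    by (intro convex_connected convex_Int convex_halfspace_Re_lt convex_halfspace_Im_lt convex_halfspace_Im_gt)
  have holE: "E holomorphic_on left_half"
    unfolding E_def by (intro holomorphic_intros holomorphic_on_tau_of) auto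
  have slit: "1 - exp v \<in> slit_plane" if "v \<in> ?S" for v
  proof -
    \<comment> \<open>A nonpositive real value would have argument \<pi>, but in the open strip the
      argument is Im v itself.\<close>
    have "exp v \<notin> \<real>\<^sub>\<le>\<^sub>0"
    proof
      assume *: "exp v \<in> \<real>\<^sub>\<le>\<^sub>0"
      have "Ln (exp v) = v" using that by (intro Ln_exp) auto
      moreover have "Im (Ln (exp v)) = pi"
        using * Im_Ln_eq_pi[of "exp v"] exp_not_eq_zero[of v]
        by (auto simp: complex_nonpos_Reals_iff less_le complex_eq_iff simp del: exp_not_eq_zero)
      ultimately show False using that by auto
    qed
    then show ?thesis by (simp only: Compl_iff mem_slit_iff) simp
  qed
  have holK: "(\<lambda>v. ellK (1 - exp v)) holomorphic_on ?S"
  proof -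
    have "(\<lambda>v. 1 - exp v) holomorphic_on ?S" by (intro holomorphic_intros)
    from holomorphic_on_compose_gen[OF this holomorphic_on_ellK] slit show ?thesis
      by (simp only: o_def image_subset_iff) blast
  qed
  have real: "E (of_real (ln (lam t))) = ellK (1 - exp (of_real (ln (lam t))))" if t: "t > 0" for t
  proof -
    have l: "0 < lam t" "lam t < 1" using lam_pos lam_less_1 t by auto
    then have e: "exp (complex_of_real (ln (lam t))) = of_real (lam t)" by (simp add: exp_of_real)
    have "ellK (1 - of_real (lam t)) = of_real pi / 2 * hypF (of_real (1 - lam t))"
    proof -
      have "1 - of_real (lam t) = complex_of_real (1 - lam t)" by simp
      moreover have "norm (complex_of_real (1 - lam t)) < 1" unfolding norm_of_real using l by simp
      ultimately show ?thesis by (simp only: ellK_eq)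
    qed
    also have "hypF (of_real (1 - lam t)) = of_real t * hypF (of_real (lam t))"
      using l by (simp add: hypF_real hypR_compl_lam t del: of_real_diff)
    finally show ?thesis unfolding E_def e tau_of_lam[OF t] by simp
  qed
  have subS: "complex_of_real ` {..<0} \<subseteq> ?S" and subL: "complex_of_real ` {..<0} \<subseteq> left_half" by auto
  have "E v = ellK (1 - exp v)" if "v \<in> ?S" for v
    by (rule lam_identity[OF _ holK opS conS subS real that]) (auto intro: holomorphic_on_subset[OF holE])
  then have "\<exists>f. f holomorphic_on left_half \<and> (\<forall>v. Re v < 0 \<and> \<bar>Im v\<bar> < pi \<longrightarrow> f v = ellK (1 - exp v))"
    using holE by (intro exI[of _ E]) auto
  from someI_ex[OF this] have C: "ellK_compl holomorphic_on left_half"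
    "\<And>v. Re v < 0 \<and> \<bar>Im v\<bar> < pi \<Longrightarrow> ellK_compl v = ellK (1 - exp v)"
    unfolding ellK_compl_def by auto
  have "ellK_compl v = E v"
  proof (rule lam_identity[OF C(1) holE open_left_half connected_left_half subL _ assms])
    fix t :: real assume t: "t > 0"
    then show "ellK_compl (of_real (ln (lam t))) = E (of_real (ln (lam t)))"
      unfolding real[OF t] using lam_pos lam_less_1 by (intro C(2)) auto
  qed
  then show ?thesis using norm_exp_left[OF assms] by (simp add: E_def ellK_eq)
qed

section \<open>Modularity of the theta functions\<close>

lemma moebius_upper:
  fixes a b c d :: int
  assumes "a * d - b * c = 1" "Im \<tau> > 0"
  shows "of_int c * \<tau> + of_int d \<noteq> 0"
    "Im ((of_int a * \<tau> + of_int b) / (of_int c * \<tau> + of_int d)) > 0"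
proof -
  let ?n = "of_int a * \<tau> + of_int b" and ?j = "of_int c * \<tau> + of_int d"
  show nz: "?j \<noteq> 0"
  proof
    assume 0: "?j = 0"
    then have "Im ?j = 0" "Re ?j = 0" by simp_all
    then have "c = 0" using assms(2) by simp
    with \<open>Re ?j = 0\<close> assms(1) show False by simp
  qed
  have "Im (?n * cnj ?j) = (of_int a * of_int d - of_int b * of_int c) * Im \<tau>"
    by (simp add: algebra_simps)
  also have "(of_int a * of_int d - of_int b * of_int c :: real) = of_int (a * d - b * c)" by simp
  also have "\<dots> * Im \<tau> > 0" using assms by simp
  finally have "Im (?n * cnj ?j) > 0" .
  moreover have "?n / ?j = ?n * cnj ?j / of_real ((norm ?j)\<^sup>2)"
    by (subst complex_div_cnj) simp
  ultimately show "Im (?n / ?j) > 0" using nz by (simp only: Im_divide_of_real) simp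
qed

section \<open>Squares of theta functions under the full modular group\<close>

abbreviation thetas :: "(complex \<Rightarrow> complex) set" where
  "thetas \<equiv> {theta2, theta3, theta4}"

lemma thetas_shift:
  assumes "f \<in> thetas"
  shows "\<exists>g\<in>thetas. \<exists>\<epsilon>. \<epsilon> \<noteq> 0 \<and> (\<forall>z. (f (z + of_int k))\<^sup>2 = \<epsilon> * (g z)\<^sup>2)"
proof -
  have "\<exists>\<epsilon>. \<epsilon> \<noteq> 0 \<and> (\<forall>z. (theta2 (z + of_int k))\<^sup>2 = \<epsilon> * (theta2 z)\<^sup>2)"
    by (intro exI[of _ "(exp (of_real pi * \<i> * of_int k / 4))\<^sup>2"]) (simp add: theta2_shift power_mult_distrib)
  moreover have "\<exists>g\<in>thetas. \<forall>z. (theta3 (z + of_int k))\<^sup>2 = 1 * (g z)\<^sup>2"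
    by (cases "even k") (auto simp: theta3_shift)
  moreover have "\<exists>g\<in>thetas. \<forall>z. (theta4 (z + of_int k))\<^sup>2 = 1 * (g z)\<^sup>2"
    by (cases "even k") (auto simp: theta4_shift)
  ultimately show ?thesis using assms by (metis insert_iff singletonD zero_neq_one)
qed

lemma thetas_inversion:
  assumes "f \<in> thetas"
  shows "\<exists>g\<in>thetas. \<forall>z. Im z > 0 \<longrightarrow> (f (- 1 / z))\<^sup>2 = - \<i> * z * (g z)\<^sup>2"
  using assms theta_inversion by (elim insertE) blast+

text \<open>Euclid's algorithm on the first column: \<gamma> \<tau> = q - 1 / z, where z is the
  image of \<tau> under the matrix with rows (-c, -d) and (a mod c, b - q d). Translation and
  inversion permute the squares up to constants. This coarse form serves the expansions at the
  cusps, where the constants need only be nonzero.\<close>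

theorem thetas_SL2:
  fixes a b c d :: int
  assumes "a * d - b * c = 1" "f \<in> thetas"
  shows "\<exists>g\<in>thetas. \<exists>\<epsilon>. \<epsilon> \<noteq> 0 \<and> (\<forall>\<tau>. Im \<tau> > 0 \<longrightarrow>
    (f ((of_int a * \<tau> + of_int b) / (of_int c * \<tau> + of_int d)))\<^sup>2 = \<epsilon> * (of_int c * \<tau> + of_int d) * (g \<tau>)\<^sup>2)"
  using assms
proof (induction "nat \<bar>c\<bar>" arbitrary: a b c d f rule: less_induct)
  case less
  show ?case
  proof (cases "c = 0")
    case True
    then have ad: "a * d = 1" using less.prems by simp
    then have "(d = 1 \<and> a = 1) \<or> (d = -1 \<and> a = -1)" using zmult_eq_1_iff by auto
    then have e: "(of_int a * \<tau> + of_int b) / (of_int c * \<tau> + of_int d) = \<tau> + of_int (b * d)" "d \<noteq> 0" for \<tau> :: complex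
      using True by auto
    obtain g \<epsilon> where "g \<in> thetas" "\<epsilon> \<noteq> 0" "\<And>z. (f (z + of_int (b * d)))\<^sup>2 = \<epsilon> * (g z)\<^sup>2"
      using thetas_shift[OF less.prems(2)] by blast
    then show ?thesis using True \<open>d \<noteq> 0\<close> unfolding e(1)
      by (intro bexI[of _ g] exI[of _ "\<epsilon> / of_int d"]) auto
  next
    case False
    define q where "q = a div c"
    define a' where "a' = a mod c"
    define b' where "b' = b - q * d"
    have a: "a = q * c + a'" by (simp add: q_def a'_def)
    have lt: "nat \<bar>a'\<bar> < nat \<bar>c\<bar>"
      using False abs_mod_less[of c a] by (simp add: a'_def)
    have det: "(- c) * b' - (- d) * a' = 1"
      using less.prems(1) by (simp add: a b'_def algebra_simps)
    obtain g1 \<epsilon>1 where 1: "g1 \<in> thetas" "\<epsilon>1 \<noteq> 0" "\<And>z. (f (z + of_int q))\<^sup>2 = \<epsilon>1 * (g1 z)\<^sup>2"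
      using thetas_shift[OF less.prems(2)] by blast
    obtain g2 where 2: "g2 \<in> thetas" "\<And>z. Im z > 0 \<Longrightarrow> (g1 (- 1 / z))\<^sup>2 = - \<i> * z * (g2 z)\<^sup>2"
      using thetas_inversion[OF 1(1)] by blast
    obtain g3 \<epsilon>2 where 3: "g3 \<in> thetas" "\<epsilon>2 \<noteq> 0" "\<And>\<tau>. Im \<tau> > 0 \<Longrightarrow>
        (g2 ((of_int (- c) * \<tau> + of_int (- d)) / (of_int a' * \<tau> + of_int b')))\<^sup>2 = \<epsilon>2 * (of_int a' * \<tau> + of_int b') * (g3 \<tau>)\<^sup>2"
      using less.hyps[OF lt det 2(1)] by blast
    have "(f ((of_int a * \<tau> + of_int b) / (of_int c * \<tau> + of_int d)))\<^sup>2 = (\<i> * \<epsilon>1 * \<epsilon>2) * (of_int c * \<tau> + of_int d) * (g3 \<tau>)\<^sup>2"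
      if \<tau>: "Im \<tau> > 0" for \<tau>
    proof -
      define j where "j = of_int c * \<tau> + of_int d"
      define n where "n = of_int a' * \<tau> + of_int b'"
      have m: "(of_int (- c) * \<tau> + of_int (- d)) / (of_int a' * \<tau> + of_int b') = - j / n" by (simp add: j_def n_def)
      have j: "j \<noteq> 0" unfolding j_def by (rule moebius_upper[OF less.prems(1) \<tau>])
      have n: "n \<noteq> 0" unfolding n_def by (rule moebius_upper[OF det \<tau>])
      have z: "Im (- j / n) > 0" using moebius_upper(2)[OF det \<tau>] unfolding m .
      have "of_int a * \<tau> + of_int b = n + of_int q * j"
        by (simp add: a b'_def n_def j_def algebra_simps)
      then have "(of_int a * \<tau> + of_int b) / j = - 1 / (- j / n) + of_int q"
        using j n by (simp add: add_divide_distrib)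
      then have "(f ((of_int a * \<tau> + of_int b) / j))\<^sup>2 = \<epsilon>1 * (- \<i> * (- j / n) * (g2 (- j / n))\<^sup>2)"
        by (simp only: 1(3) 2(2)[OF z])
      also have "(g2 (- j / n))\<^sup>2 = \<epsilon>2 * n * (g3 \<tau>)\<^sup>2"
        by (rule 3(3)[OF \<tau>, unfolded m, folded n_def])
      \<comment> \<open>The weight factors combine: the argument - j / n times the denominator n
        leaves j up to sign.\<close>
      also have "\<epsilon>1 * (- \<i> * (- j / n) * (\<epsilon>2 * n * (g3 \<tau>)\<^sup>2)) = (\<i> * \<epsilon>1 * \<epsilon>2) * j * (g3 \<tau>)\<^sup>2" using n by simp
      finally show ?thesis unfolding j_def .
    qed
    then show ?thesis using 1(2) 3(1,2) by (intro bexI[of _ g3] exI[of _ "\<i> * \<epsilon>1 * \<epsilon>2"]) auto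
  qed
qed

text \<open>The map z \<mapsto> z / (2 m z + 1) is translation by - 2 m conjugated by the inversion.
  The inversion exchanges \<open>theta2\<close> and \<open>theta4\<close>, so the sign that a
  translation gives to \<open>theta2\<close> now falls on \<open>theta4\<close>.\<close>

lemma theta_lower_shift:
  fixes m :: int
  assumes "Im z > 0"
  defines "z' \<equiv> z / (of_int (2 * m) * z + 1)"
  shows "(theta2 z')\<^sup>2 = (of_int (2 * m) * z + 1) * (theta2 z)\<^sup>2"
    "(theta3 z')\<^sup>2 = (of_int (2 * m) * z + 1) * (theta3 z)\<^sup>2"
    "(theta4 z')\<^sup>2 = (-1) powi m * (of_int (2 * m) * z + 1) * (theta4 z)\<^sup>2"
proof -
  define w where "w = - 1 / z + of_int (2 * (- m))"
  have z0: "z \<noteq> 0" using assms by auto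
  have u: "Im (- 1 / z) > 0" using moebius_upper(2)[of 0 0 "-1" 1 z] assms by simp
  then have w: "Im w > 0" by (simp add: w_def)
  then have w0: "w \<noteq> 0" by auto
  have wz: "- w * z = of_int (2 * m) * z + 1" using z0 by (simp add: w_def algebra_simps)
  have z'w: "z' = - 1 / w" unfolding z'_def wz[symmetric] using z0 w0 by (simp add: field_simps)
  have 34: "(theta3 w)\<^sup>2 = (theta3 (- 1 / z))\<^sup>2" "(theta4 w)\<^sup>2 = (theta4 (- 1 / z))\<^sup>2"
    unfolding w_def theta3_shift theta4_shift by simp_all
  have 2: "(theta2 w)\<^sup>2 = (-1) powi m * (theta2 (- 1 / z))\<^sup>2"
    unfolding w_def theta2_sq_shift by (simp add: power_int_minus_left)
  have r: "- \<i> * w * (- \<i> * z * X) = - w * z * X" "- \<i> * w * (s * (- \<i> * z * X)) = s * (- w * z) * X" for s X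
    by (simp_all add: algebra_simps)
  show "(theta2 z')\<^sup>2 = (of_int (2 * m) * z + 1) * (theta2 z)\<^sup>2"
    "(theta3 z')\<^sup>2 = (of_int (2 * m) * z + 1) * (theta3 z)\<^sup>2"
    "(theta4 z')\<^sup>2 = (-1) powi m * (of_int (2 * m) * z + 1) * (theta4 z)\<^sup>2"
    unfolding wz[symmetric] z'w theta_inversion[OF w] 34 2 theta_inversion[OF assms(1)] r by (rule refl)+
qed

lemma powi_parity: "even (j - k) \<Longrightarrow> (-1 :: complex) powi j = (-1) powi k"
  by (simp add: power_int_minus_left)

text \<open>Quotients must be even to stay inside \<Gamma>(2), so the reduction is modulo 2 c.
  Adding c before and subtracting it after division centres the residue at 0.\<close>

lemma balanced_remainder:
  fixes a c :: int
  assumes "c \<noteq> 0"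
  shows "\<exists>n. \<bar>a - 2 * n * c\<bar> \<le> \<bar>c\<bar>"
proof -
  let ?n = "(a + c) div (2 * c)"
  have e: "a - 2 * ?n * c = (a + c) mod (2 * c) - c"
    by (simp add: minus_div_mult_eq_mod [symmetric] algebra_simps)
  show ?thesis
  proof (cases "c > 0")
    case True
    then have "0 \<le> (a + c) mod (2 * c)" "(a + c) mod (2 * c) < 2 * c" by simp_all
    then show ?thesis using e True by (intro exI[of _ ?n]) linarith
  next
    case False
    then have "(a + c) mod (2 * c) \<le> 0" "2 * c < (a + c) mod (2 * c)" using assms by simp_all
    then show ?thesis using e False by (intro exI[of _ ?n]) linarith
  qed
qed

text \<open>\<open>Gamma(2)\<close> is generated by \<open>-I\<close>, \<open>\<tau> \<mapsto> \<tau> + 2\<close> and \<open>\<tau> \<mapsto> \<tau> / (2 \<tau> + 1)\<close>: Euclid's algorithm with even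
  quotients, applied to the first column, terminates because the two entries have different parity.\<close>

theorem theta_Gamma2:
  fixes \<alpha> \<beta> \<gamma> \<delta> :: int
  assumes "(2 * \<alpha> + 1) * (2 * \<delta> + 1) - (2 * \<beta>) * (2 * \<gamma>) = 1" "Im \<tau> > 0"
  defines "j \<equiv> of_int (2 * \<gamma>) * \<tau> + of_int (2 * \<delta> + 1)"
  defines "z \<equiv> (of_int (2 * \<alpha> + 1) * \<tau> + of_int (2 * \<beta>)) / j"
  shows "(theta2 z)\<^sup>2 = (-1) powi (\<delta> + \<beta>) * j * (theta2 \<tau>)\<^sup>2 \<and>
    (theta3 z)\<^sup>2 = (-1) powi \<delta> * j * (theta3 \<tau>)\<^sup>2 \<and>
    (theta4 z)\<^sup>2 = (-1) powi (\<delta> + \<gamma>) * j * (theta4 \<tau>)\<^sup>2"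
  using assms(1) unfolding z_def j_def
proof (induction "nat \<bar>\<gamma>\<bar>" arbitrary: \<alpha> \<beta> \<gamma> \<delta> rule: less_induct)
  case less
  show ?case
  proof (cases "\<gamma> = 0")
    case True
    then have "(2 * \<alpha> + 1) * (2 * \<delta> + 1) = 1" using less.prems by simp
    then have "(\<delta> = 0 \<and> \<alpha> = 0) \<or> (\<delta> = -1 \<and> \<alpha> = -1)" using zmult_eq_1_iff[of "2 * \<alpha> + 1" "2 * \<delta> + 1"] by auto
    then show ?thesis
    proof
      assume "\<delta> = 0 \<and> \<alpha> = 0"
      then show ?thesis
        using True theta2_sq_shift[of \<tau> \<beta>] theta3_shift[of \<tau> "2 * \<beta>"] theta4_shift[of \<tau> "2 * \<beta>"] by simp
    next
      assume "\<delta> = -1 \<and> \<alpha> = -1"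
      moreover have "(-1 :: complex) powi (\<beta> - 1) = - ((-1) powi (- \<beta>))" by (simp add: power_int_minus_left)
      moreover have "(- \<tau> + of_int (2 * \<beta>)) / (- 1) = \<tau> + of_int (2 * (- \<beta>))" by simp
      ultimately show ?thesis
        using True theta2_sq_shift[of \<tau> "- \<beta>"] theta3_shift[of \<tau> "2 * (- \<beta>)"] theta4_shift[of \<tau> "2 * (- \<beta>)"]
        by simp
    qed
  next
    case False
    obtain n where n: "\<bar>(2 * \<alpha> + 1) - 2 * n * (2 * \<gamma>)\<bar> \<le> \<bar>2 * \<gamma>\<bar>"
      using balanced_remainder[of "2 * \<gamma>" "2 * \<alpha> + 1"] False by auto
    define \<alpha>1 where "\<alpha>1 = \<alpha> - 2 * n * \<gamma>"
    define \<beta>1 where "\<beta>1 = \<beta> - n * (2 * \<delta> + 1)"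
    have "\<bar>2 * \<alpha>1 + 1\<bar> \<le> \<bar>2 * \<gamma>\<bar>" using n by (simp add: \<alpha>1_def algebra_simps)
    \<comment> \<open>An odd entry cannot equal an even one in absolute value, so the weak bound of
      the balanced remainder is strict.\<close>
    moreover have "2 * \<alpha>1 + 1 \<noteq> 0" "2 * \<alpha>1 + 1 \<noteq> 2 * \<gamma>" "2 * \<alpha>1 + 1 \<noteq> - (2 * \<gamma>)" by presburger+
    ultimately have a1: "\<bar>2 * \<alpha>1 + 1\<bar> < \<bar>2 * \<gamma>\<bar>" "2 * \<alpha>1 + 1 \<noteq> 0" by linarith+
    obtain m where m: "\<bar>2 * \<gamma> - 2 * m * (2 * \<alpha>1 + 1)\<bar> \<le> \<bar>2 * \<alpha>1 + 1\<bar>"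
      using balanced_remainder[OF a1(2)] by blast
    define \<gamma>1 where "\<gamma>1 = \<gamma> - m * (2 * \<alpha>1 + 1)"
    define \<delta>1 where "\<delta>1 = \<delta> - 2 * m * \<beta>1"
    have "2 * \<gamma> - 2 * m * (2 * \<alpha>1 + 1) = 2 * \<gamma>1" by (simp add: \<gamma>1_def algebra_simps)
    then have "\<bar>\<gamma>1\<bar> < \<bar>\<gamma>\<bar>" using m a1 by linarith
    then have lt: "nat \<bar>\<gamma>1\<bar> < nat \<bar>\<gamma>\<bar>" by simp
    \<comment> \<open>Entrywise form of the factorisation of the matrix as T^(2 n) U^m times the
      reduced matrix, with T the translation by 1 and U the map z \<mapsto> z / (2 z + 1).\<close>
    have eqs: "\<alpha> = \<alpha>1 + 2 * n * \<gamma>" "\<beta> = \<beta>1 + n * (2 * \<delta> + 1)" "\<gamma> = \<gamma>1 + m * (2 * \<alpha>1 + 1)" "\<delta> = \<delta>1 + 2 * m * \<beta>1"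
      by (simp_all add: \<alpha>1_def \<beta>1_def \<gamma>1_def \<delta>1_def)
    have det: "(2 * \<alpha>1 + 1) * (2 * \<delta>1 + 1) - (2 * \<beta>1) * (2 * \<gamma>1) = 1"
      using less.prems eqs by algebra
    define z1 where "z1 = (of_int (2 * \<alpha>1 + 1) * \<tau> + of_int (2 * \<beta>1)) / (of_int (2 * \<gamma>1) * \<tau> + of_int (2 * \<delta>1 + 1))"
    define j1 where "j1 = of_int (2 * \<gamma>1) * \<tau> + of_int (2 * \<delta>1 + 1)"
    define j where "j = of_int (2 * \<gamma>) * \<tau> + of_int (2 * \<delta> + 1)"
    have j0: "j \<noteq> 0" "j1 \<noteq> 0" unfolding j_def j1_def
      using moebius_upper(1)[OF less.prems assms(2)] moebius_upper(1)[OF det assms(2)] by auto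
    have z1: "Im z1 > 0" unfolding z1_def by (rule moebius_upper(2)[OF det assms(2)])
    have nz: "z1 * j1 = of_int (2 * \<alpha>1 + 1) * \<tau> + of_int (2 * \<beta>1)" using j0 by (simp add: z1_def j1_def)
    have jj: "(of_int (2 * m) * z1 + 1) * j1 = j"
    proof -
      have "(of_int (2 * m) * z1 + 1) * j1 = of_int (2 * m) * (z1 * j1) + j1" by (simp add: algebra_simps)
      also have "\<dots> = j" unfolding nz unfolding j1_def j_def eqs(4) by (subst eqs(3)) (simp add: algebra_simps)
      finally show ?thesis .
    qed
    have "z1 / (of_int (2 * m) * z1 + 1) = (z1 * j1) / j"
      unfolding jj[symmetric] using j0 by simp
    moreover have "of_int (2 * \<alpha> + 1) * \<tau> + of_int (2 * \<beta>) = z1 * j1 + of_int (2 * n) * j"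
      unfolding nz j_def by (subst eqs(1), subst eqs(2)) (simp add: algebra_simps)
    ultimately have z: "(of_int (2 * \<alpha> + 1) * \<tau> + of_int (2 * \<beta>)) / j = z1 / (of_int (2 * m) * z1 + 1) + of_int (2 * n)"
      using j0 by (simp add: add_divide_distrib)
    note IH = less.hyps[OF lt det, folded z1_def j1_def]
    note L = theta_lower_shift[OF z1, of m]
    let ?J = "of_int (2 * m) * z1 + 1"
    \<comment> \<open>Modulo 2 the reduction leaves \<delta> alone and changes \<beta> by n and
      \<gamma> by m, which matches the signs from T^(2 n) and U^m.\<close>
    have s2: "(-1 :: complex) powi n * (-1) powi (\<delta>1 + \<beta>1) = (-1) powi (\<delta> + \<beta>)"
      unfolding minus_one_powi_add [symmetric]
      by (rule powi_parity) (simp add: eqs(4) eqs(2))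
    have s3: "(-1 :: complex) powi \<delta>1 = (-1) powi \<delta>"
      by (rule powi_parity) (simp add: eqs(4))
    have s4: "(-1 :: complex) powi m * (-1) powi (\<delta>1 + \<gamma>1) = (-1) powi (\<delta> + \<gamma>)"
      unfolding minus_one_powi_add [symmetric]
      by (rule powi_parity) (simp add: eqs(4) eqs(3))
    have "(theta2 (z1 / ?J + of_int (2 * n)))\<^sup>2 = ((-1) powi n * (-1) powi (\<delta>1 + \<beta>1)) * (?J * j1) * (theta2 \<tau>)\<^sup>2"
      unfolding theta2_sq_shift L using IH by (simp add: mult_ac)
    moreover have "(theta3 (z1 / ?J + of_int (2 * n)))\<^sup>2 = (-1) powi \<delta>1 * (?J * j1) * (theta3 \<tau>)\<^sup>2"
      unfolding theta3_shift using L IH by (simp add: mult_ac)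
    moreover have "(theta4 (z1 / ?J + of_int (2 * n)))\<^sup>2 = ((-1) powi m * (-1) powi (\<delta>1 + \<gamma>1)) * (?J * j1) * (theta4 \<tau>)\<^sup>2"
      unfolding theta4_shift using L IH by (simp add: mult_ac)
    ultimately show ?thesis unfolding j_def[symmetric] z s2 s3 s4 jj by blast
  qed
qed

section \<open>The transformation laws for matrices\<close>

lemma SL2Z_iff: "\<gamma> \<in> SL2Z \<longleftrightarrow> \<gamma> $ 1 $ 1 * \<gamma> $ 2 $ 2 - \<gamma> $ 1 $ 2 * \<gamma> $ 2 $ 1 = 1"
  by (simp add: SL2Z_def det_2)

lemma moeb_upper:
  assumes "\<gamma> \<in> SL2Z" "\<tau> \<in> upper_half"
  shows "automorphy \<gamma> \<tau> \<noteq> 0" "moeb \<gamma> \<tau> \<in> upper_half"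
  using moebius_upper[of "\<gamma> $ 1 $ 1" "\<gamma> $ 2 $ 2" "\<gamma> $ 1 $ 2" "\<gamma> $ 2 $ 1" \<tau>] assms
  by (simp_all add: SL2Z_iff moeb_def automorphy_def upper_half_def)

lemma thetas_moeb:
  assumes "\<gamma> \<in> SL2Z" "f \<in> thetas"
  shows "\<exists>g\<in>thetas. \<exists>\<epsilon>. \<epsilon> \<noteq> 0 \<and> (\<forall>\<tau>\<in>upper_half. (f (moeb \<gamma> \<tau>))\<^sup>2 = \<epsilon> * automorphy \<gamma> \<tau> * (g \<tau>)\<^sup>2)"
  using thetas_SL2[of "\<gamma> $ 1 $ 1" "\<gamma> $ 2 $ 2" "\<gamma> $ 1 $ 2" "\<gamma> $ 2 $ 1" f] assms
  unfolding SL2Z_iff moeb_def automorphy_def upper_half_def by simp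

lemma theta_moeb_Gamma2:
  assumes "\<gamma> \<in> Gamma2" "\<tau> \<in> upper_half"
  shows "(theta2 (moeb \<gamma> \<tau>))\<^sup>2 = (-1) powi ((\<gamma> $ 2 $ 2 - 1) div 2 + \<gamma> $ 1 $ 2 div 2) * automorphy \<gamma> \<tau> * (theta2 \<tau>)\<^sup>2"
    "(theta3 (moeb \<gamma> \<tau>))\<^sup>2 = (-1) powi ((\<gamma> $ 2 $ 2 - 1) div 2) * automorphy \<gamma> \<tau> * (theta3 \<tau>)\<^sup>2"
    "(theta4 (moeb \<gamma> \<tau>))\<^sup>2 = (-1) powi ((\<gamma> $ 2 $ 2 - 1) div 2 + \<gamma> $ 2 $ 1 div 2) * automorphy \<gamma> \<tau> * (theta4 \<tau>)\<^sup>2"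
proof -
  have det: "\<gamma> $ 1 $ 1 * \<gamma> $ 2 $ 2 - \<gamma> $ 1 $ 2 * \<gamma> $ 2 $ 1 = 1" using assms(1) by (simp add: Gamma2_def SL2Z_iff)
  have "odd (\<gamma> $ 1 $ 1)" "odd (\<gamma> $ 2 $ 2)" "even (\<gamma> $ 1 $ 2)" "even (\<gamma> $ 2 $ 1)"
    using assms(1) by (auto simp: Gamma2_def forall_2 mat_def even_iff_mod_2_eq_zero odd_iff_mod_2_eq_one)
  then obtain \<alpha> \<beta> c \<delta> where e: "\<gamma> $ 1 $ 1 = 2 * \<alpha> + 1" "\<gamma> $ 2 $ 2 = 2 * \<delta> + 1" "\<gamma> $ 1 $ 2 = 2 * \<beta>" "\<gamma> $ 2 $ 1 = 2 * c"
    by (auto elim!: oddE evenE)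
  have h: "(2 * \<delta> + 1 - 1) div 2 = \<delta>" "2 * \<beta> div 2 = \<beta>" "2 * c div 2 = c" by simp_all
  have "Im \<tau> > 0" using assms(2) by (simp add: upper_half_def)
  from theta_Gamma2[OF det[unfolded e] this]
  show "(theta2 (moeb \<gamma> \<tau>))\<^sup>2 = (-1) powi ((\<gamma> $ 2 $ 2 - 1) div 2 + \<gamma> $ 1 $ 2 div 2) * automorphy \<gamma> \<tau> * (theta2 \<tau>)\<^sup>2"
    "(theta3 (moeb \<gamma> \<tau>))\<^sup>2 = (-1) powi ((\<gamma> $ 2 $ 2 - 1) div 2) * automorphy \<gamma> \<tau> * (theta3 \<tau>)\<^sup>2"
    "(theta4 (moeb \<gamma> \<tau>))\<^sup>2 = (-1) powi ((\<gamma> $ 2 $ 2 - 1) div 2 + \<gamma> $ 2 $ 1 div 2) * automorphy \<gamma> \<tau> * (theta4 \<tau>)\<^sup>2"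
    unfolding moeb_def automorphy_def e h by blast+
qed

subsection \<open>Meromorphy at the cusps\<close>

lemma holomorphic2_on_fst:
  assumes "f holomorphic_on A" "open A"
  shows "holomorphic2_on (\<lambda>p. f (fst p)) (A \<times> B)"
  unfolding holomorphic2_on_def
proof
  fix p :: "complex \<times> complex" assume "p \<in> A \<times> B"
  then obtain f' where "(f has_field_derivative f') (at (fst p))"
    using assms by (auto simp: holomorphic_on_open)
  then have "(f has_derivative (*) f') (at (fst p))" by (simp add: has_field_derivative_def)
  from has_derivative_compose[OF has_derivative_fst[OF has_derivative_ident] this]
  have "((\<lambda>p. f (fst p)) has_derivative (\<lambda>(h, k). f' * h + 0 * k)) (at p)"
    by (simp add: case_prod_unfold)
  then show "\<exists>a b. ((\<lambda>p. f (fst p)) has_derivative (\<lambda>(h, k). a * h + b * k)) (at p)" by blast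
qed

lemma holomorphic2_on_snd:
  assumes "f holomorphic_on A" "open A"
  shows "holomorphic2_on (\<lambda>p. f (snd p)) (B \<times> A)"
  unfolding holomorphic2_on_def
proof
  fix p :: "complex \<times> complex" assume "p \<in> B \<times> A"
  then obtain f' where "(f has_field_derivative f') (at (snd p))"
    using assms by (auto simp: holomorphic_on_open)
  then have "(f has_derivative (*) f') (at (snd p))" by (simp add: has_field_derivative_def)
  from has_derivative_compose[OF has_derivative_snd[OF has_derivative_ident] this]
  have "((\<lambda>p. f (snd p)) has_derivative (\<lambda>(h, k). 0 * h + f' * k)) (at p)"
    by (simp add: case_prod_unfold)
  then show "\<exists>a b. ((\<lambda>p. f (snd p)) has_derivative (\<lambda>(h, k). a * h + b * k)) (at p)" by blast
qed

lemma holomorphic2_on_add: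
  assumes "holomorphic2_on f U" "holomorphic2_on g U"
  shows "holomorphic2_on (\<lambda>p. f p + g p) U"
  unfolding holomorphic2_on_def
proof
  fix p assume "p \<in> U"
  then obtain a b c d where "(f has_derivative (\<lambda>(h, k). a * h + b * k)) (at p)"
    "(g has_derivative (\<lambda>(h, k). c * h + d * k)) (at p)"
    using assms unfolding holomorphic2_on_def by blast
  from has_derivative_add[OF this]
  have "((\<lambda>p. f p + g p) has_derivative (\<lambda>(h, k). (a + c) * h + (b + d) * k)) (at p)"
    by (simp add: case_prod_unfold algebra_simps)
  then show "\<exists>a b. ((\<lambda>p. f p + g p) has_derivative (\<lambda>(h, k). a * h + b * k)) (at p)" by blast
qed

lemma holomorphic2_on_mult:
  assumes "holomorphic2_on f U" "holomorphic2_on g U"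
  shows "holomorphic2_on (\<lambda>p. f p * g p) U"
  unfolding holomorphic2_on_def
proof
  fix p assume "p \<in> U"
  then obtain a b c d where "(f has_derivative (\<lambda>(h, k). a * h + b * k)) (at p)"
    "(g has_derivative (\<lambda>(h, k). c * h + d * k)) (at p)"
    using assms unfolding holomorphic2_on_def by blast
  from has_derivative_mult[OF this]
  have "((\<lambda>p. f p * g p) has_derivative (\<lambda>(h, k). (f p * c + a * g p) * h + (f p * d + b * g p) * k)) (at p)"
    by (simp add: case_prod_unfold algebra_simps)
  then show "\<exists>a b. ((\<lambda>p. f p * g p) has_derivative (\<lambda>(h, k). a * h + b * k)) (at p)" by blast
qed

abbreviation disc :: "complex set" where
  "disc \<equiv> ball 0 1"

lemma meromorphic2_at_holomorphic2:
  assumes "holomorphic2_on g U" "open U" "p \<in> U"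
  shows "meromorphic2_at g p"
proof -
  have "holomorphic2_on (\<lambda>_. 1) U"
    unfolding holomorphic2_on_def by (auto intro!: exI[of _ 0] simp: case_prod_unfold)
  then show ?thesis
    unfolding meromorphic2_at_def using assms by (intro exI[of _ U] exI[of _ g] exI[of _ "\<lambda>_. 1"]) auto
qed

lemma nonvanishing_dense:
  assumes "h holomorphic_on disc" "r \<in> disc" "h r \<noteq> 0" "open W" "W \<noteq> {}" "W \<subseteq> disc"
  shows "\<exists>z\<in>W. h z \<noteq> 0"
proof (rule ccontr)
  assume "\<not> (\<exists>z\<in>W. h z \<noteq> 0)"
  then have "h r = 0"
    using analytic_continuation_open[OF assms(4) open_ball assms(5) _ assms(6,1) holomorphic_on_const[of 0] _ assms(2)]
    by auto
  with assms(3) show False by simp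
qed

text \<open>Projections of open sets are open, so a denominator that is nonzero at one point of the
  disc cannot vanish identically on an open set of the product.\<close>

lemma meromorphic2_at_quotient:
  assumes "g holomorphic_on disc" "h holomorphic_on disc" "r \<in> disc" "h r \<noteq> 0" "p \<in> disc \<times> disc"
    and "\<And>z. h z \<noteq> 0 \<Longrightarrow> f z = g z / h z"
  shows "meromorphic2_at (\<lambda>p. f (fst p)) p" "meromorphic2_at (\<lambda>p. f (snd p)) p"
proof -
  have o: "open (disc \<times> disc)" by (intro open_Times open_ball)
  have "\<exists>z\<in>V. h (fst z) \<noteq> 0" "\<exists>z\<in>V. h (snd z) \<noteq> 0" if V: "open V" "V \<noteq> {}" "V \<subseteq> disc \<times> disc" for V
  proof -
    have "\<exists>z\<in>fst ` V. h z \<noteq> 0"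
      using V by (intro nonvanishing_dense[OF assms(2-4)] open_image_fst) auto
    then show "\<exists>z\<in>V. h (fst z) \<noteq> 0" by auto
    have "\<exists>z\<in>snd ` V. h z \<noteq> 0"
      using V by (intro nonvanishing_dense[OF assms(2-4)] open_image_snd) auto
    then show "\<exists>z\<in>V. h (snd z) \<noteq> 0" by auto
  qed
  then show "meromorphic2_at (\<lambda>p. f (fst p)) p" "meromorphic2_at (\<lambda>p. f (snd p)) p"
    unfolding meromorphic2_at_def
    using o assms holomorphic2_on_fst[OF assms(1) open_ball, of disc] holomorphic2_on_fst[OF assms(2) open_ball, of disc]
      holomorphic2_on_snd[OF assms(1) open_ball, of disc] holomorphic2_on_snd[OF assms(2) open_ball, of disc]
    by - (rule exI[of _ "disc \<times> disc"], rule exI[of _ "\<lambda>p. g (fst p)"], rule exI[of _ "\<lambda>p. h (fst p)"], blast,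
      rule exI[of _ "disc \<times> disc"], rule exI[of _ "\<lambda>p. g (snd p)"], rule exI[of _ "\<lambda>p. h (snd p)"], blast)
qed

text \<open>Width 4 because the square of \<open>theta2\<close> is 4 r \<psi>^2 with r = exp(\<pi>
  \<i> \<tau> / 2), a square root of the nome. It suits every pair of cusps, since moving a cusp
  only permutes the squares up to factors.\<close>

abbreviation cusp_param :: "complex \<Rightarrow> complex" where
  "cusp_param \<tau> \<equiv> exp (2 * of_real pi * \<i> * \<tau> / of_nat 4)"

lemma cusp_param_disc: "\<tau> \<in> upper_half \<Longrightarrow> cusp_param \<tau> \<in> disc"
  by (simp add: upper_half_def)

lemma cusp_param_sq: "(cusp_param \<tau>)\<^sup>2 = nome \<tau>"
  by (simp add: mult_ac flip: exp_of_nat_mult)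

lemma i_upper: "\<i> \<in> upper_half"
  by (simp add: upper_half_def)

lemma thetas_at_i:
  assumes "f \<in> thetas" shows "f \<i> \<noteq> 0"
  using assms theta2_imag[of 1] theta3_imag[of 1] theta4_imag_real[of 1] th2_pos[of 1] th3_pos[of 1] th4_pos[of 1]
  by auto

text \<open>The nonzero value at \<i> is recorded so that F can serve as a denominator that does not
  vanish identically.\<close>

lemma thetas_cusp_expansion:
  assumes "f \<in> thetas"
  shows "\<exists>F. F holomorphic_on disc \<and> F (cusp_param \<i>) \<noteq> 0 \<and> (\<forall>\<tau>\<in>upper_half. (f \<tau>)\<^sup>2 = F (cusp_param \<tau>))"
proof -
  have sq: "r\<^sup>2 \<in> disc" "- r\<^sup>2 \<in> disc" if "r \<in> disc" for r :: complex
    using that by (auto simp: norm_power power_less_one_iff)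
  have "(\<lambda>r. r\<^sup>2) ` disc \<subseteq> disc" "(\<lambda>r. - r\<^sup>2) ` disc \<subseteq> disc" using sq by blast+
  note im = this
  have h: "(\<lambda>r. r\<^sup>2) holomorphic_on disc" "(\<lambda>r. - r\<^sup>2) holomorphic_on disc"
    by (intro holomorphic_intros)+
  note hol = holomorphic_on_compose_gen[OF h(1) holomorphic_on_psi_q im(1), unfolded o_def]
    holomorphic_on_compose_gen[OF h(1) holomorphic_on_theta3_q im(1), unfolded o_def]
    holomorphic_on_compose_gen[OF h(2) holomorphic_on_theta3_q im(2), unfolded o_def]
  have "\<exists>F. F holomorphic_on disc \<and> (\<forall>\<tau>\<in>upper_half. (f \<tau>)\<^sup>2 = F (cusp_param \<tau>))"
    using assms
  proof (elim insertE emptyE)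
    assume [simp]: "f = theta2"
    have "(theta2 \<tau>)\<^sup>2 = 4 * cusp_param \<tau> * (psi_q ((cusp_param \<tau>)\<^sup>2))\<^sup>2" if "\<tau> \<in> upper_half" for \<tau>
    proof -
      have "(exp (of_real pi * \<i> * \<tau> / 4))\<^sup>2 = cusp_param \<tau>" by (simp add: mult_ac flip: exp_of_nat_mult)
      then show ?thesis using that unfolding cusp_param_sq by (simp add: theta2_eq_q upper_half_def power_mult_distrib)
    qed
    then show ?thesis
      by (intro exI[of _ "\<lambda>r. 4 * r * (psi_q (r\<^sup>2))\<^sup>2"] conjI ballI holomorphic_intros hol) simp
  next
    assume [simp]: "f = theta3"
    show ?thesis
      by (intro exI[of _ "\<lambda>r. (theta3_q (r\<^sup>2))\<^sup>2"] conjI ballI holomorphic_intros hol; unfold cusp_param_sq)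
        (simp add: theta3_eq_q upper_half_def)
  next
    assume [simp]: "f = theta4"
    show ?thesis
      by (intro exI[of _ "\<lambda>r. (theta3_q (- r\<^sup>2))\<^sup>2"] conjI ballI holomorphic_intros hol; unfold cusp_param_sq)
        (simp add: theta4_eq_q upper_half_def)
  qed
  then obtain F where F: "F holomorphic_on disc" "\<forall>\<tau>\<in>upper_half. (f \<tau>)\<^sup>2 = F (cusp_param \<tau>)" by blast
  have "F (cusp_param \<i>) = (f \<i>)\<^sup>2" using F(2) i_upper by simp
  then have "F (cusp_param \<i>) \<noteq> 0" using thetas_at_i[OF assms] by simp
  with F show ?thesis by blast
qed

text \<open>Weight (1,1) and width 4 are built in, and holomorphy replaces meromorphy: the summands
  of the period satisfy this stronger condition, which passes to sums without common
  denominators.\<close>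

definition holomorphic_extended :: "(complex \<Rightarrow> complex \<Rightarrow> complex) \<Rightarrow> bool" where
  "holomorphic_extended F \<longleftrightarrow> (\<forall>\<gamma>1\<in>SL2Z. \<forall>\<gamma>2\<in>SL2Z. \<exists>G. holomorphic2_on G (disc \<times> disc) \<and>
     (\<forall>\<tau>1\<in>upper_half. \<forall>\<tau>2\<in>upper_half.
        F (moeb \<gamma>1 \<tau>1) (moeb \<gamma>2 \<tau>2) = automorphy \<gamma>1 \<tau>1 * automorphy \<gamma>2 \<tau>2 * G (cusp_param \<tau>1, cusp_param \<tau>2)))"

lemma holomorphic_extended_add:
  assumes "holomorphic_extended F1" "holomorphic_extended F2"
  shows "holomorphic_extended (\<lambda>x y. F1 x y + F2 x y)"
  unfolding holomorphic_extended_def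
proof (intro ballI)
  fix \<gamma>1 \<gamma>2 assume \<gamma>: "\<gamma>1 \<in> SL2Z" "\<gamma>2 \<in> SL2Z"
  obtain G1 where G1: "holomorphic2_on G1 (disc \<times> disc)" "\<forall>\<tau>1\<in>upper_half. \<forall>\<tau>2\<in>upper_half.
      F1 (moeb \<gamma>1 \<tau>1) (moeb \<gamma>2 \<tau>2) = automorphy \<gamma>1 \<tau>1 * automorphy \<gamma>2 \<tau>2 * G1 (cusp_param \<tau>1, cusp_param \<tau>2)"
    using bspec[OF bspec[OF assms(1)[unfolded holomorphic_extended_def] \<gamma>(1)] \<gamma>(2)] by blast
  obtain G2 where G2: "holomorphic2_on G2 (disc \<times> disc)" "\<forall>\<tau>1\<in>upper_half. \<forall>\<tau>2\<in>upper_half.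
      F2 (moeb \<gamma>1 \<tau>1) (moeb \<gamma>2 \<tau>2) = automorphy \<gamma>1 \<tau>1 * automorphy \<gamma>2 \<tau>2 * G2 (cusp_param \<tau>1, cusp_param \<tau>2)"
    using bspec[OF bspec[OF assms(2)[unfolded holomorphic_extended_def] \<gamma>(1)] \<gamma>(2)] by blast
  from G1 G2 show "\<exists>G. holomorphic2_on G (disc \<times> disc) \<and> (\<forall>\<tau>1\<in>upper_half. \<forall>\<tau>2\<in>upper_half.
        F1 (moeb \<gamma>1 \<tau>1) (moeb \<gamma>2 \<tau>2) + F2 (moeb \<gamma>1 \<tau>1) (moeb \<gamma>2 \<tau>2)
          = automorphy \<gamma>1 \<tau>1 * automorphy \<gamma>2 \<tau>2 * G (cusp_param \<tau>1, cusp_param \<tau>2))"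
    by (intro exI[of _ "\<lambda>p. G1 p + G2 p"] conjI holomorphic2_on_add) (auto simp: distrib_left)
qed

lemma holomorphic_extended_thetas:
  assumes "f \<in> thetas" "g \<in> thetas"
  shows "holomorphic_extended (\<lambda>\<tau>1 \<tau>2. (f \<tau>1)\<^sup>2 * (g \<tau>2)\<^sup>2)"
  unfolding holomorphic_extended_def
proof (intro ballI)
  fix \<gamma>1 \<gamma>2 assume \<gamma>: "\<gamma>1 \<in> SL2Z" "\<gamma>2 \<in> SL2Z"
  obtain f1 \<epsilon>1 where f1: "f1 \<in> thetas" "\<And>\<tau>. \<tau> \<in> upper_half \<Longrightarrow> (f (moeb \<gamma>1 \<tau>))\<^sup>2 = \<epsilon>1 * automorphy \<gamma>1 \<tau> * (f1 \<tau>)\<^sup>2"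
    using thetas_moeb[OF \<gamma>(1) assms(1)] by blast
  obtain g1 \<epsilon>2 where g1: "g1 \<in> thetas" "\<And>\<tau>. \<tau> \<in> upper_half \<Longrightarrow> (g (moeb \<gamma>2 \<tau>))\<^sup>2 = \<epsilon>2 * automorphy \<gamma>2 \<tau> * (g1 \<tau>)\<^sup>2"
    using thetas_moeb[OF \<gamma>(2) assms(2)] by blast
  obtain F where F: "F holomorphic_on disc" "\<And>\<tau>. \<tau> \<in> upper_half \<Longrightarrow> (f1 \<tau>)\<^sup>2 = F (cusp_param \<tau>)"
    using thetas_cusp_expansion[OF f1(1)] by blast
  obtain G where G: "G holomorphic_on disc" "\<And>\<tau>. \<tau> \<in> upper_half \<Longrightarrow> (g1 \<tau>)\<^sup>2 = G (cusp_param \<tau>)"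
    using thetas_cusp_expansion[OF g1(1)] by blast
  have "(\<lambda>r. \<epsilon>1 * F r) holomorphic_on disc" "(\<lambda>r. \<epsilon>2 * G r) holomorphic_on disc"
    by (intro holomorphic_intros F G)+
  then have "holomorphic2_on (\<lambda>p. (\<epsilon>1 * F (fst p)) * (\<epsilon>2 * G (snd p))) (disc \<times> disc)"
    by (intro holomorphic2_on_mult[OF holomorphic2_on_fst holomorphic2_on_snd] open_ball)
  moreover have "(f (moeb \<gamma>1 \<tau>1))\<^sup>2 * (g (moeb \<gamma>2 \<tau>2))\<^sup>2
      = automorphy \<gamma>1 \<tau>1 * automorphy \<gamma>2 \<tau>2 * ((\<epsilon>1 * F (cusp_param \<tau>1)) * (\<epsilon>2 * G (cusp_param \<tau>2)))"
    if "\<tau>1 \<in> upper_half" "\<tau>2 \<in> upper_half" for \<tau>1 \<tau>2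
    unfolding f1(2)[OF that(1)] g1(2)[OF that(2)] F(2)[OF that(1)] G(2)[OF that(2)] by (simp only: mult_ac)
  ultimately show "\<exists>G. holomorphic2_on G (disc \<times> disc) \<and> (\<forall>\<tau>1\<in>upper_half. \<forall>\<tau>2\<in>upper_half.
        (f (moeb \<gamma>1 \<tau>1))\<^sup>2 * (g (moeb \<gamma>2 \<tau>2))\<^sup>2 = automorphy \<gamma>1 \<tau>1 * automorphy \<gamma>2 \<tau>2 * G (cusp_param \<tau>1, cusp_param \<tau>2))"
    by (intro exI[of _ "\<lambda>p. (\<epsilon>1 * F (fst p)) * (\<epsilon>2 * G (snd p))"]) simp
qed

lemma meromorphic_extended_weight_1:
  assumes "holomorphic_extended F"
  shows "meromorphic_extended 1 1 F"
  unfolding meromorphic_extended_def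
proof (intro ballI)
  fix \<gamma>1 \<gamma>2 assume \<gamma>: "\<gamma>1 \<in> SL2Z" "\<gamma>2 \<in> SL2Z"
  obtain G where G: "holomorphic2_on G (disc \<times> disc)" "\<And>\<tau>1 \<tau>2. \<tau>1 \<in> upper_half \<Longrightarrow> \<tau>2 \<in> upper_half \<Longrightarrow>
      F (moeb \<gamma>1 \<tau>1) (moeb \<gamma>2 \<tau>2) = automorphy \<gamma>1 \<tau>1 * automorphy \<gamma>2 \<tau>2 * G (cusp_param \<tau>1, cusp_param \<tau>2)"
    using bspec[OF bspec[OF assms[unfolded holomorphic_extended_def] \<gamma>(1)] \<gamma>(2)] by blast
  have "automorphy \<gamma>1 \<tau>1 powi (- 1) * automorphy \<gamma>2 \<tau>2 powi (- 1) * F (moeb \<gamma>1 \<tau>1) (moeb \<gamma>2 \<tau>2)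
      = G (cusp_param \<tau>1, cusp_param \<tau>2)" if "\<tau>1 \<in> upper_half" "\<tau>2 \<in> upper_half" for \<tau>1 \<tau>2
    unfolding G(2)[OF that] using moeb_upper(1)[OF \<gamma>(1) that(1)] moeb_upper(1)[OF \<gamma>(2) that(2)]
    by (simp add: power_int_minus field_simps)
  moreover have "meromorphic2_at G p" if "p \<in> disc \<times> disc" for p
    by (rule meromorphic2_at_holomorphic2[OF G(1) _ that]) (intro open_Times open_ball)
  ultimately show "\<exists>(N::nat) G. N > 0 \<and> (\<forall>\<tau>1\<in>upper_half. \<forall>\<tau>2\<in>upper_half.
        automorphy \<gamma>1 \<tau>1 powi (- 1) * automorphy \<gamma>2 \<tau>2 powi (- 1) * F (moeb \<gamma>1 \<tau>1) (moeb \<gamma>2 \<tau>2)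
           = G (exp (2 * of_real pi * \<i> * \<tau>1 / of_nat N), exp (2 * of_real pi * \<i> * \<tau>2 / of_nat N))) \<and>
        (\<forall>p \<in> disc \<times> disc. meromorphic2_at G p)"
    by (intro exI[of _ 4] exI[of _ G]) auto
qed

text \<open>The automorphy factors cancel in the quotient of fourth powers, leaving two series in
  the cusp parameter.\<close>

lemma modular_lambda_cusp_expansion:
  assumes "\<gamma> \<in> SL2Z"
  shows "\<exists>g h. g holomorphic_on disc \<and> h holomorphic_on disc \<and> h (cusp_param \<i>) \<noteq> 0 \<and>
    (\<forall>\<tau>\<in>upper_half. modular_lambda (moeb \<gamma> \<tau>) = g (cusp_param \<tau>) / h (cusp_param \<tau>))"
proof -
  obtain f1 \<epsilon>1 where f1: "f1 \<in> thetas" "\<And>\<tau>. \<tau> \<in> upper_half \<Longrightarrow> (theta2 (moeb \<gamma> \<tau>))\<^sup>2 = \<epsilon>1 * automorphy \<gamma> \<tau> * (f1 \<tau>)\<^sup>2"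
    using thetas_moeb[OF assms, of theta2] by blast
  obtain g1 \<epsilon>2 where g1: "g1 \<in> thetas" "\<epsilon>2 \<noteq> 0" "\<And>\<tau>. \<tau> \<in> upper_half \<Longrightarrow> (theta3 (moeb \<gamma> \<tau>))\<^sup>2 = \<epsilon>2 * automorphy \<gamma> \<tau> * (g1 \<tau>)\<^sup>2"
    using thetas_moeb[OF assms, of theta3] by blast
  obtain F where F: "F holomorphic_on disc" "\<And>\<tau>. \<tau> \<in> upper_half \<Longrightarrow> (f1 \<tau>)\<^sup>2 = F (cusp_param \<tau>)"
    using thetas_cusp_expansion[OF f1(1)] by blast
  obtain G where G: "G holomorphic_on disc" "G (cusp_param \<i>) \<noteq> 0" "\<And>\<tau>. \<tau> \<in> upper_half \<Longrightarrow> (g1 \<tau>)\<^sup>2 = G (cusp_param \<tau>)"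
    using thetas_cusp_expansion[OF g1(1)] by blast
  have "modular_lambda (moeb \<gamma> \<tau>) = (\<epsilon>1 * F (cusp_param \<tau>))\<^sup>2 / (\<epsilon>2 * G (cusp_param \<tau>))\<^sup>2" if "\<tau> \<in> upper_half" for \<tau>
  proof -
    have "modular_lambda (moeb \<gamma> \<tau>) = ((theta2 (moeb \<gamma> \<tau>))\<^sup>2)\<^sup>2 / ((theta3 (moeb \<gamma> \<tau>))\<^sup>2)\<^sup>2"
      by (simp add: modular_lambda_def flip: power_mult)
    then show ?thesis
      unfolding f1(2)[OF that] g1(3)[OF that] F(2)[OF that] G(3)[OF that]
      using moeb_upper(1)[OF assms that] by (simp add: power_mult_distrib)
  qed
  then show ?thesis
    using g1(2) G(2) by (intro exI[of _ "\<lambda>r. (\<epsilon>1 * F r)\<^sup>2"] exI[of _ "\<lambda>r. (\<epsilon>2 * G r)\<^sup>2"])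
      (auto intro!: holomorphic_intros F G)
qed

lemma meromorphic_extended_lambda:
  "meromorphic_extended 0 0 (\<lambda>\<tau>1 \<tau>2. modular_lambda \<tau>1)"
  "meromorphic_extended 0 0 (\<lambda>\<tau>1 \<tau>2. 1 - modular_lambda \<tau>2)"
proof -
  have i: "cusp_param \<i> \<in> disc" by (rule cusp_param_disc[OF i_upper])
  show "meromorphic_extended 0 0 (\<lambda>\<tau>1 \<tau>2. modular_lambda \<tau>1)"
    unfolding meromorphic_extended_def
  proof (intro ballI)
    fix \<gamma>1 \<gamma>2 assume \<gamma>: "\<gamma>1 \<in> SL2Z" "\<gamma>2 \<in> SL2Z"
    obtain g h where gh: "g holomorphic_on disc" "h holomorphic_on disc" "h (cusp_param \<i>) \<noteq> 0"
      "\<And>\<tau>. \<tau> \<in> upper_half \<Longrightarrow> modular_lambda (moeb \<gamma>1 \<tau>) = g (cusp_param \<tau>) / h (cusp_param \<tau>)"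
      using modular_lambda_cusp_expansion[OF \<gamma>(1)] by blast
    show "\<exists>(N::nat) G. N > 0 \<and> (\<forall>\<tau>1\<in>upper_half. \<forall>\<tau>2\<in>upper_half.
        automorphy \<gamma>1 \<tau>1 powi (- 0) * automorphy \<gamma>2 \<tau>2 powi (- 0) * modular_lambda (moeb \<gamma>1 \<tau>1)
           = G (exp (2 * of_real pi * \<i> * \<tau>1 / of_nat N), exp (2 * of_real pi * \<i> * \<tau>2 / of_nat N))) \<and>
        (\<forall>p \<in> disc \<times> disc. meromorphic2_at G p)"
      using gh(4) meromorphic2_at_quotient(1)[OF gh(1,2) i gh(3), of _ "\<lambda>z. g z / h z"]
      by (intro exI[of _ 4] exI[of _ "\<lambda>p. g (fst p) / h (fst p)"]) auto
  qed
  show "meromorphic_extended 0 0 (\<lambda>\<tau>1 \<tau>2. 1 - modular_lambda \<tau>2)"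
    unfolding meromorphic_extended_def
  proof (intro ballI)
    fix \<gamma>1 \<gamma>2 assume \<gamma>: "\<gamma>1 \<in> SL2Z" "\<gamma>2 \<in> SL2Z"
    obtain g h where gh: "g holomorphic_on disc" "h holomorphic_on disc" "h (cusp_param \<i>) \<noteq> 0"
      "\<And>\<tau>. \<tau> \<in> upper_half \<Longrightarrow> modular_lambda (moeb \<gamma>2 \<tau>) = g (cusp_param \<tau>) / h (cusp_param \<tau>)"
      using modular_lambda_cusp_expansion[OF \<gamma>(2)] by blast
    have "(\<lambda>z. h z - g z) holomorphic_on disc" by (intro holomorphic_intros gh)
    from meromorphic2_at_quotient(2)[OF this gh(2) i gh(3), of _ "\<lambda>z. 1 - g z / h z"]
    have "meromorphic2_at (\<lambda>p. 1 - g (snd p) / h (snd p)) p" if "p \<in> disc \<times> disc" for p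
      using that by (simp add: diff_divide_distrib)
    then show "\<exists>(N::nat) G. N > 0 \<and> (\<forall>\<tau>1\<in>upper_half. \<forall>\<tau>2\<in>upper_half.
        automorphy \<gamma>1 \<tau>1 powi (- 0) * automorphy \<gamma>2 \<tau>2 powi (- 0) * (1 - modular_lambda (moeb \<gamma>2 \<tau>2))
           = G (exp (2 * of_real pi * \<i> * \<tau>1 / of_nat N), exp (2 * of_real pi * \<i> * \<tau>2 / of_nat N))) \<and>
        (\<forall>p \<in> disc \<times> disc. meromorphic2_at G p)"
      using gh(4) by (intro exI[of _ 4] exI[of _ "\<lambda>p. 1 - g (snd p) / h (snd p)"]) auto
  qed
qed

subsection \<open>Transformation behaviour of the period\<close>

lemma transforms_a:
  assumes "\<gamma>1 \<in> Gamma2" "\<gamma>2 \<in> Gamma2"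
  shows "transforms_under \<gamma>1 \<gamma>2 1 1 (chi_a \<gamma>1 \<gamma>2) (\<lambda>\<tau>1 \<tau>2. (theta2 \<tau>1)\<^sup>2 * (theta3 \<tau>2)\<^sup>2)"
  unfolding transforms_under_def
proof (intro ballI)
  fix \<tau>1 \<tau>2 assume t: "\<tau>1 \<in> upper_half" "\<tau>2 \<in> upper_half"
  show "(theta2 (moeb \<gamma>1 \<tau>1))\<^sup>2 * (theta3 (moeb \<gamma>2 \<tau>2))\<^sup>2 =
     chi_a \<gamma>1 \<gamma>2 * automorphy \<gamma>1 \<tau>1 powi 1 * automorphy \<gamma>2 \<tau>2 powi 1 * ((theta2 \<tau>1)\<^sup>2 * (theta3 \<tau>2)\<^sup>2)"
    unfolding theta_moeb_Gamma2[OF assms(1) t(1)] theta_moeb_Gamma2[OF assms(2) t(2)] chi_a_def minus_one_powi_add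
    by (simp add: mult_ac)
qed

lemma transforms_b:
  assumes "\<gamma>1 \<in> Gamma2" "\<gamma>2 \<in> Gamma2"
  shows "transforms_under \<gamma>1 \<gamma>2 1 1 (chi_b \<gamma>1 \<gamma>2) (\<lambda>\<tau>1 \<tau>2. (theta4 \<tau>2)\<^sup>2 * (theta3 \<tau>1)\<^sup>2)"
  unfolding transforms_under_def
proof (intro ballI)
  fix \<tau>1 \<tau>2 assume t: "\<tau>1 \<in> upper_half" "\<tau>2 \<in> upper_half"
  show "(theta4 (moeb \<gamma>2 \<tau>2))\<^sup>2 * (theta3 (moeb \<gamma>1 \<tau>1))\<^sup>2 =
     chi_b \<gamma>1 \<gamma>2 * automorphy \<gamma>1 \<tau>1 powi 1 * automorphy \<gamma>2 \<tau>2 powi 1 * ((theta4 \<tau>2)\<^sup>2 * (theta3 \<tau>1)\<^sup>2)"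
    unfolding theta_moeb_Gamma2[OF assms(1) t(1)] theta_moeb_Gamma2[OF assms(2) t(2)] chi_b_def minus_one_powi_add
    by (simp add: mult_ac)
qed

lemma modular_lambda_Gamma2:
  assumes "\<gamma> \<in> Gamma2" "\<tau> \<in> upper_half"
  shows "modular_lambda (moeb \<gamma> \<tau>) = modular_lambda \<tau>"
proof -
  have "modular_lambda (moeb \<gamma> \<tau>) = ((theta2 (moeb \<gamma> \<tau>))\<^sup>2)\<^sup>2 / ((theta3 (moeb \<gamma> \<tau>))\<^sup>2)\<^sup>2"
    by (simp add: modular_lambda_def flip: power_mult)
  moreover have "((-1 :: complex) powi k)\<^sup>2 = 1" for k by (simp add: power_int_minus_left)
  moreover have "automorphy \<gamma> \<tau> \<noteq> 0" using assms by (intro moeb_upper(1)) (auto simp: Gamma2_def)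
  ultimately show ?thesis
    unfolding theta_moeb_Gamma2[OF assms] by (simp add: power_mult_distrib modular_lambda_def flip: power_mult)
qed

text \<open>The converse rests on the linear independence of the two summands: a trivial total
  factor forces both characters to be 1.\<close>

lemma Period0_modular_transforms_iff:
  assumes "\<gamma>1 \<in> Gamma2" "\<gamma>2 \<in> Gamma2"
  shows "transforms_under \<gamma>1 \<gamma>2 1 1 1 Period0_modular \<longleftrightarrow> (\<gamma>1, \<gamma>2) \<in> Gamma2_period"
proof -
  let ?A = "\<lambda>\<tau>1 \<tau>2. (theta2 \<tau>1)\<^sup>2 * (theta3 \<tau>2)\<^sup>2" and ?B = "\<lambda>\<tau>1 \<tau>2. (theta4 \<tau>2)\<^sup>2 * (theta3 \<tau>1)\<^sup>2"
  let ?j = "\<lambda>\<tau>1 \<tau>2. automorphy \<gamma>1 \<tau>1 * automorphy \<gamma>2 \<tau>2"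
  let ?a = "chi_a \<gamma>1 \<gamma>2" and ?b = "chi_b \<gamma>1 \<gamma>2"
  have P: "Period0_modular (moeb \<gamma>1 \<tau>1) (moeb \<gamma>2 \<tau>2) = ?j \<tau>1 \<tau>2 * (?a * ?A \<tau>1 \<tau>2 + ?b * ?B \<tau>1 \<tau>2)"
    if "\<tau>1 \<in> upper_half" "\<tau>2 \<in> upper_half" for \<tau>1 \<tau>2
    using transforms_a[OF assms] transforms_b[OF assms] that
    by (simp add: transforms_under_def Period0_modular_def algebra_simps)
  show ?thesis
  proof
    assume "(\<gamma>1, \<gamma>2) \<in> Gamma2_period"
    then have "?a = 1" "?b = 1" by (auto simp: Gamma2_period_def)
    then show "transforms_under \<gamma>1 \<gamma>2 1 1 1 Period0_modular"
      using P by (simp add: transforms_under_def Period0_modular_def)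
  next
    assume T: "transforms_under \<gamma>1 \<gamma>2 1 1 1 Period0_modular"
    have eq: "(?a - 1) * ?A \<tau>1 \<tau>2 + (?b - 1) * ?B \<tau>1 \<tau>2 = 0" if t: "\<tau>1 \<in> upper_half" "\<tau>2 \<in> upper_half" for \<tau>1 \<tau>2
    proof -
      have "?j \<tau>1 \<tau>2 \<noteq> 0"
        using moeb_upper(1)[OF _ t(1), of \<gamma>1] moeb_upper(1)[OF _ t(2), of \<gamma>2] assms by (simp add: Gamma2_def)
      moreover have "?j \<tau>1 \<tau>2 * (?a * ?A \<tau>1 \<tau>2 + ?b * ?B \<tau>1 \<tau>2) = ?j \<tau>1 \<tau>2 * (?A \<tau>1 \<tau>2 + ?B \<tau>1 \<tau>2)"
        using T t unfolding P[OF t, symmetric] by (simp add: transforms_under_def Period0_modular_def)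
      ultimately have "?a * ?A \<tau>1 \<tau>2 + ?b * ?B \<tau>1 \<tau>2 = ?A \<tau>1 \<tau>2 + ?B \<tau>1 \<tau>2" by simp
      then show ?thesis by (simp add: algebra_simps)
    qed
    \<comment> \<open>Moving the first variable from \<i> to \<i> + 2 negates the first summand and
      fixes the second, which separates the two coefficients.\<close>
    have i2: "\<i> + of_int (2 * 1) \<in> upper_half" by (simp add: upper_half_def)
    have "?A (\<i> + of_int (2 * 1)) \<i> = - ?A \<i> \<i>" "?B (\<i> + of_int (2 * 1)) \<i> = ?B \<i> \<i>"
      unfolding theta2_sq_shift theta3_shift by simp_all
    with eq[OF i2 i_upper] have 1: "- ((?a - 1) * ?A \<i> \<i>) + (?b - 1) * ?B \<i> \<i> = 0"
      by (metis mult_minus_right)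
    from eq[OF i_upper i_upper] have 2: "(?a - 1) * ?A \<i> \<i> + (?b - 1) * ?B \<i> \<i> = 0" .
    from 1 2 have "(?a - 1) * ?A \<i> \<i> = 0" "(?b - 1) * ?B \<i> \<i> = 0" by algebra+
    then have "?a = 1" "?b = 1" using thetas_at_i by auto
    then show "(\<gamma>1, \<gamma>2) \<in> Gamma2_period" using assms by (simp add: Gamma2_period_def)
  qed
qed

section \<open>Existence of the coordinates\<close>

text \<open>In terms of \<open>p = \<Lambda>\<^sub>1 + \<Lambda>\<^sub>2\<close> and \<open>c = \<Lambda>\<^sub>1 \<Lambda>\<^sub>2\<close> the equations are \<open>x p\<^sup>2 = 4 c\<close> and
  \<open>(1 - y) p\<^sup>2 = (1 + c)\<^sup>2\<close>. Hence \<open>c\<close> is the Landen transform of \<open>x / (1 - y)\<close>, and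
  \<open>\<Lambda>\<^sub>2 - \<Lambda>\<^sub>1 = p \<surd>(1 - x)\<close>.\<close>

lemma Lambda_coordinates_exist: "\<exists>U L1 L2. Lambda_coordinates U L1 L2"
proof -
  define w where "w z = fst z / (1 - snd z)" for z :: "complex \<times> complex"
  define p where "p z = (1 + landen_k (w z)) / csqrt (1 - snd z)" for z :: "complex \<times> complex"
  define L1 where "L1 z = p z * (1 - csqrt (1 - fst z)) / 2" for z
  define L2 where "L2 z = p z * (1 + csqrt (1 - fst z)) / 2" for z
  \<comment> \<open>Radius 1/4 keeps |1 - y| > 1/2 > |x|, so that |w| < 1 and Landen's modulus is
    available.\<close>
  let ?V = "ball (0, 0) (1/4) :: (complex \<times> complex) set"
  have V: "norm (fst z) < 1" "norm (snd z) < 1" "norm (w z) < 1" "1 - snd z \<noteq> 0" if "z \<in> ?V" for z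
  proof -
    have "norm z < 1/4" using that by (simp add: zero_prod_def[symmetric])
    then have f: "norm (fst z) < 1/4" "norm (snd z) < 1/4"
      using norm_fst_le[of "fst z" "snd z"] norm_snd_le[of "snd z" "fst z"] by simp_all
    then show "norm (fst z) < 1" "norm (snd z) < 1" by linarith+
    have "norm (1 - snd z) \<ge> 1 - norm (snd z)" using norm_triangle_ineq2[of 1 "snd z"] by simp
    then have d: "norm (1 - snd z) > 1/2" using f by linarith
    then show "1 - snd z \<noteq> 0" by auto
    show "norm (w z) < 1" unfolding w_def norm_divide using f d by (simp add: divide_less_eq)
  qed
  have cut: "1 - m \<notin> \<real>\<^sub>\<le>\<^sub>0" if "norm m < 1" for m :: complex
    using slit_planeI[OF that] by (simp only: Compl_iff mem_slit_iff simp_thms)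
  have nz: "\<forall>z\<in>?V. 1 - snd z \<noteq> 0" using V(4) by blast
  have cw: "continuous_on ?V w" unfolding w_def
    by (intro continuous_intros nz)
  have ck: "continuous_on ?V (\<lambda>z. landen_k (w z))"
    by (rule continuous_on_compose2[OF holomorphic_on_imp_continuous_on[OF holomorphic_on_landen_k] cw])
      (intro image_subsetI slit_planeI V(3))
  have cs: "continuous_on ?V (\<lambda>z. csqrt (1 - fst z))" "continuous_on ?V (\<lambda>z. csqrt (1 - snd z))"
  proof -
    have "(\<lambda>m. csqrt (1 - m)) holomorphic_on ball 0 1"
      by (intro holomorphic_intros cut) simp
    then have c: "continuous_on (ball 0 1) (\<lambda>m. csqrt (1 - m))" by (rule holomorphic_on_imp_continuous_on)
    have im: "fst ` ?V \<subseteq> ball 0 1" "snd ` ?V \<subseteq> ball 0 1"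
      by (intro image_subsetI; simp only: mem_ball_0 V)+
    show "continuous_on ?V (\<lambda>z. csqrt (1 - fst z))" "continuous_on ?V (\<lambda>z. csqrt (1 - snd z))"
      by (rule continuous_on_compose2[OF c continuous_on_fst[OF continuous_on_id] im(1)],
        rule continuous_on_compose2[OF c continuous_on_snd[OF continuous_on_id] im(2)])
  qed
  have cp: "continuous_on ?V p"
    unfolding p_def by (intro continuous_intros ck cs) (use nz in simp)
  have cL: "continuous_on ?V L1" "continuous_on ?V L2"
    unfolding L1_def L2_def by (intro continuous_intros cp cs; simp)+
  have L0: "L1 (0, 0) = 0" "L2 (0, 0) = 1" by (simp_all add: L1_def L2_def p_def w_def)
  have "isCont L1 (0, 0)" "isCont L2 (0, 0)"
    using cL by (auto simp: continuous_on_eq_continuous_at)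
  then have "isCont (\<lambda>z. norm ((L1 z)\<^sup>2)) (0, 0)" "isCont (\<lambda>z. norm (1 - (L2 z)\<^sup>2)) (0, 0)"
    by (auto intro!: continuous_intros)
  then have "\<forall>\<^sub>F z in nhds (0, 0). norm ((L1 z)\<^sup>2) < 1" "\<forall>\<^sub>F z in nhds (0, 0). norm (1 - (L2 z)\<^sup>2) < 1"
    using L0 by (auto simp: isCont_def eventually_nhds_conv_at dest!: order_tendstoD(2)[where a = 1])
  then have "\<forall>\<^sub>F z in nhds (0, 0). norm ((L1 z)\<^sup>2) < 1 \<and> norm (1 - (L2 z)\<^sup>2) < 1" by (rule eventually_conj)
  then obtain d where d: "d > 0" "\<And>z. dist z (0, 0) < d \<Longrightarrow> norm ((L1 z)\<^sup>2) < 1 \<and> norm (1 - (L2 z)\<^sup>2) < 1"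
    unfolding eventually_nhds_metric by blast
  let ?U = "ball (0, 0) (min d (1/4)) :: (complex \<times> complex) set"
  have U: "?U \<subseteq> ?V" by auto
  have eqs: "x = 4 * L1 (x, y) * L2 (x, y) / (L1 (x, y) + L2 (x, y))\<^sup>2"
    "y = - ((1 - (L1 (x, y))\<^sup>2) * (1 - (L2 (x, y))\<^sup>2)) / (L1 (x, y) + L2 (x, y))\<^sup>2" if "(x, y) \<in> ?V" for x y
  proof -
    define c where "c = landen_k (x / (1 - y))"
    define s where "s = csqrt (1 - y)"
    define u where "u = csqrt (1 - x)"
    have y: "1 - y \<noteq> 0" using V(4)[OF that] by simp
    have s: "s\<^sup>2 = 1 - y" "s \<noteq> 0" using y by (auto simp: s_def)
    have u: "u\<^sup>2 = 1 - x" by (simp add: u_def)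
    have "norm (x / (1 - y)) < 1" using V(3)[OF that] by (simp add: w_def)
    note sl = slit_planeI[OF this]
    have c1: "1 + c \<noteq> 0" using norm_landen_k[OF sl] by (auto simp: c_def add_eq_0_iff)
    have "x / (1 - y) * (1 + c)\<^sup>2 = 4 * c" unfolding c_def by (rule landen_k_eq[OF sl])
    then have c: "x * (1 + c)\<^sup>2 = 4 * c * s\<^sup>2" using y by (simp add: s field_simps)
    define P where "P = (1 + c) / s"
    have P: "P \<noteq> 0" "P * s = 1 + c" using c1 s by (auto simp: P_def)
    have L: "L1 (x, y) = P * (1 - u) / 2" "L2 (x, y) = P * (1 + u) / 2"
      by (simp_all add: L1_def L2_def p_def w_def P_def c_def s_def u_def)
    have sum: "L1 (x, y) + L2 (x, y) = P" unfolding L by (simp add: field_simps)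
    have "4 * L1 (x, y) * L2 (x, y) = P\<^sup>2 * (1 - u\<^sup>2)" unfolding L by (simp add: power2_eq_square field_simps)
    then have prod: "4 * L1 (x, y) * L2 (x, y) = x * P\<^sup>2" using u by simp
    then show "x = 4 * L1 (x, y) * L2 (x, y) / (L1 (x, y) + L2 (x, y))\<^sup>2"
      unfolding sum using P by simp
    have "x * P\<^sup>2 * s\<^sup>2 = 4 * c * s\<^sup>2" using c P(2) by (metis mult.assoc power_mult_distrib)
    then have "x * P\<^sup>2 = 4 * c" using s(2) by simp
    with prod have cc: "L1 (x, y) * L2 (x, y) = c" by simp
    \<comment> \<open>Both sides expand (1 + \<Lambda>1 \<Lambda>2)^2 - (\<Lambda>1 + \<Lambda>2)^2;
      this is how the equation for y reduces to (1 - y) p^2 = (1 + c)^2.\<close>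
    have "(1 - (L1 (x, y))\<^sup>2) * (1 - (L2 (x, y))\<^sup>2) = (1 + c)\<^sup>2 - P\<^sup>2"
      unfolding cc[symmetric] sum[symmetric] by (simp add: power2_eq_square algebra_simps)
    also have "\<dots> = - y * P\<^sup>2" unfolding P(2)[symmetric] power_mult_distrib s by (simp add: algebra_simps)
    finally show "y = - ((1 - (L1 (x, y))\<^sup>2) * (1 - (L2 (x, y))\<^sup>2)) / (L1 (x, y) + L2 (x, y))\<^sup>2"
      unfolding sum using P by simp
  qed
  have "Lambda_coordinates ?U L1 L2"
    unfolding Lambda_coordinates_def
  proof (intro conjI allI impI)
    show "continuous_on ?U L1" "continuous_on ?U L2" using cL U by (auto intro: continuous_on_subset)
    fix x y assume xy: "(x, y) \<in> ?U"
    show "norm ((L1 (x, y))\<^sup>2) < 1" "norm (1 - (L2 (x, y))\<^sup>2) < 1"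
      using d(2)[of "(x, y)"] xy by (auto simp: dist_commute)
    show "x = 4 * L1 (x, y) * L2 (x, y) / (L1 (x, y) + L2 (x, y))\<^sup>2"
      "y = - ((1 - (L1 (x, y))\<^sup>2) * (1 - (L2 (x, y))\<^sup>2)) / (L1 (x, y) + L2 (x, y))\<^sup>2"
      using eqs xy U by blast+
  qed (use d(1) L0 in auto)
  then show ?thesis by blast
qed

text \<open>On the imaginary axis 1 - \<Lambda>2^2 has real part at least 1, which the bound |1 -
  \<Lambda>2^2| < 1 excludes. A continuous \<Lambda>2 on a connected set therefore stays on the side
  of its value 1 at the origin, and it is the principal root of its square.\<close>

lemma Lambda2_Re_pos:
  assumes "Lambda_coordinates U L1 L2" "z \<in> U"
  shows "Re (L2 z) > 0"
proof (rule ccontr)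
  assume "\<not> Re (L2 z) > 0"
  have "connected ((\<lambda>z. Re (L2 z)) ` U)"
    using assms(1) unfolding Lambda_coordinates_def
    by (intro connected_continuous_image continuous_intros) auto
  moreover have "Re (L2 z) \<in> (\<lambda>z. Re (L2 z)) ` U" "Re (L2 (0, 0)) \<in> (\<lambda>z. Re (L2 z)) ` U" "L2 (0, 0) = 1"
    using assms(1) assms(2) unfolding Lambda_coordinates_def by blast+
  ultimately have "0 \<in> (\<lambda>z. Re (L2 z)) ` U"
    using connectedD_interval[of "(\<lambda>z. Re (L2 z)) ` U" "Re (L2 z)" "Re (L2 (0, 0))" 0] \<open>\<not> Re (L2 z) > 0\<close> by auto
  then obtain x y where xy: "(x, y) \<in> U" "Re (L2 (x, y)) = 0" by auto
  then have "norm (1 - (L2 (x, y))\<^sup>2) < 1" using assms(1) unfolding Lambda_coordinates_def by blast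
  moreover have "Re (1 - (L2 (x, y))\<^sup>2) \<ge> 1" using xy(2) by (simp add: power2_eq_square)
  ultimately show False using complex_Re_le_cmod[of "1 - (L2 (x, y))\<^sup>2"] by linarith
qed

lemma Lambda_sum_nonzero:
  assumes "Lambda_coordinates U L1 L2" "(x, y) \<in> U"
  shows "L1 (x, y) + L2 (x, y) \<noteq> 0"
proof
  assume 0: "L1 (x, y) + L2 (x, y) = 0"
  then have "x = 0" "y = 0" using assms unfolding Lambda_coordinates_def by fastforce+
  moreover have "norm ((L1 (x, y))\<^sup>2) < 1" using assms unfolding Lambda_coordinates_def by blast
  moreover have "L2 (0, 0) = 1" using assms unfolding Lambda_coordinates_def by blast
  ultimately have "L1 (x, y) = - 1" "norm ((L1 (x, y))\<^sup>2) < 1" using 0 by (auto simp: add_eq_0_iff2)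
  then show False by simp
qed

text \<open>Both quotients of periods turn out to be values of \<open>tau_of\<close>, at v1 and at
  v2. The hypothesis on v1 fixes exp(v1/2), not just its square, because the quotient of the squares
  of \<open>theta2\<close> and \<open>theta3\<close> at \<tau>1 is exp(v1/2), and this must be
  \<Lambda>1 with its sign.\<close>

lemma period_mirror_map:
  assumes "norm (\<Lambda>1\<^sup>2) < 1" "norm (1 - \<Lambda>2\<^sup>2) < 1" "Re \<Lambda>2 > 0" "\<Lambda>1 + \<Lambda>2 \<noteq> 0"
    and v: "exp (v1 / 2) = \<Lambda>1" "exp v2 = 1 - \<Lambda>2\<^sup>2"
  defines "\<tau>1 \<equiv> Period1 v1 \<Lambda>1 \<Lambda>2 / Period0 \<Lambda>1 \<Lambda>2" and "\<tau>2 \<equiv> Period2 v2 \<Lambda>1 \<Lambda>2 / Period0 \<Lambda>1 \<Lambda>2"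
  shows "Period0 \<Lambda>1 \<Lambda>2 \<noteq> 0"
    "\<tau>1 = \<i> * ellK_compl v1 / ellK (\<Lambda>1\<^sup>2)" "\<tau>2 = \<i> * ellK_compl v2 / ellK (1 - \<Lambda>2\<^sup>2)"
    "\<tau>1 \<in> upper_half" "\<tau>2 \<in> upper_half" "\<Lambda>1\<^sup>2 = modular_lambda \<tau>1" "\<Lambda>2\<^sup>2 = 1 - modular_lambda \<tau>2"
    "1 - modular_lambda \<tau>2 = theta4 \<tau>2 ^ 4 / theta3 \<tau>2 ^ 4"
    "Period0 \<Lambda>1 \<Lambda>2 = Period0_modular \<tau>1 \<tau>2"
proof -
  have e1: "exp v1 = \<Lambda>1\<^sup>2" using exp_double[of "v1 / 2"] v(1) by simp
  have "norm (exp v1) < 1" "norm (exp v2) < 1" using assms(1,2) unfolding e1 v(2) .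
  then have l: "v1 \<in> left_half" "v2 \<in> left_half" by simp_all
  have K: "ellK (\<Lambda>1\<^sup>2) = of_real pi / 2 * hypF (\<Lambda>1\<^sup>2)" "ellK (1 - \<Lambda>2\<^sup>2) = of_real pi / 2 * hypF (1 - \<Lambda>2\<^sup>2)"
    using assms(1,2) by (simp_all only: ellK_eq)
  have nz: "hypF (\<Lambda>1\<^sup>2) \<noteq> 0" "hypF (1 - \<Lambda>2\<^sup>2) \<noteq> 0" using assms(1,2) by (simp_all only: hypF_nonzero not_False_eq_True)
  then have Knz: "ellK (\<Lambda>1\<^sup>2) \<noteq> 0" "ellK (1 - \<Lambda>2\<^sup>2) \<noteq> 0" by (simp_all add: K)
  have c: "4 / (complex_of_real pi)\<^sup>2 * (\<Lambda>1 + \<Lambda>2) \<noteq> 0" using assms(4) by (intro no_zero_divisors) simp_all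
  then show P0: "Period0 \<Lambda>1 \<Lambda>2 \<noteq> 0" using Knz unfolding Period0_def by (simp only: mult_eq_0_iff simp_thms)
  have cancel: "C * b * X / (C * a * b) = X / a" "C * a * X / (C * a * b) = X / b"
    if "C \<noteq> 0" "a \<noteq> 0" "b \<noteq> 0" for C a b X :: complex
    using that by simp_all
  have "Period1 v1 \<Lambda>1 \<Lambda>2 = (4 / (complex_of_real pi)\<^sup>2 * (\<Lambda>1 + \<Lambda>2)) * ellK (1 - \<Lambda>2\<^sup>2) * (\<i> * ellK_compl v1)"
    "Period2 v2 \<Lambda>1 \<Lambda>2 = (4 / (complex_of_real pi)\<^sup>2 * (\<Lambda>1 + \<Lambda>2)) * ellK (\<Lambda>1\<^sup>2) * (\<i> * ellK_compl v2)"
    "Period0 \<Lambda>1 \<Lambda>2 = (4 / (complex_of_real pi)\<^sup>2 * (\<Lambda>1 + \<Lambda>2)) * ellK (\<Lambda>1\<^sup>2) * ellK (1 - \<Lambda>2\<^sup>2)"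
    by (simp_all add: Period0_def Period1_def Period2_def mult_ac)
  then show t: "\<tau>1 = \<i> * ellK_compl v1 / ellK (\<Lambda>1\<^sup>2)" "\<tau>2 = \<i> * ellK_compl v2 / ellK (1 - \<Lambda>2\<^sup>2)"
    unfolding \<tau>1_def \<tau>2_def by (simp_all only: cancel[OF c Knz])
  have t1: "\<tau>1 = tau_of v1" and t2: "\<tau>2 = tau_of v2"
    using ellK_compl_eq[OF l(1)] ellK_compl_eq[OF l(2)] Knz unfolding t e1 v(2) by simp_all
  show "\<tau>1 \<in> upper_half" "\<tau>2 \<in> upper_half" unfolding t1 t2 upper_half_def using tau_of_upper l by auto
  \<comment> \<open>For \<Lambda>2 the sign comes from Re \<Lambda>2 > 0, whichever logarithm v2 is
    taken.\<close>
  have kp2: "kp v2 = \<Lambda>2" using assms(3) by (simp add: kp_def v(2) csqrt_square)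
  note T1 = theta_tau_of[OF l(1), unfolded e1 v(1), folded t1]
  note T2 = theta_tau_of[OF l(2), unfolded v(2) kp2, folded t2]
  have th: "theta3 \<tau>1 \<noteq> 0" "theta3 \<tau>2 \<noteq> 0" using T1(3) T2(3) nz by auto
  show m1: "\<Lambda>1\<^sup>2 = modular_lambda \<tau>1"
  proof -
    have "theta2 \<tau>1 ^ 4 = \<Lambda>1\<^sup>2 * theta3 \<tau>1 ^ 4" using T1(1) by algebra
    then show ?thesis using th by (simp add: modular_lambda_def)
  qed
  have "theta4 \<tau>2 ^ 4 = \<Lambda>2\<^sup>2 * theta3 \<tau>2 ^ 4" using T2(2) by algebra
  then have m2: "theta4 \<tau>2 ^ 4 / theta3 \<tau>2 ^ 4 = \<Lambda>2\<^sup>2" using th by simp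
  have "theta3 \<tau>2 ^ 4 = theta2 \<tau>2 ^ 4 + theta4 \<tau>2 ^ 4"
    using tau_of_upper[OF l(2)] unfolding t2 by (rule theta_jacobi)
  then have "theta4 \<tau>2 ^ 4 = theta3 \<tau>2 ^ 4 - theta2 \<tau>2 ^ 4" by simp
  then show m3: "1 - modular_lambda \<tau>2 = theta4 \<tau>2 ^ 4 / theta3 \<tau>2 ^ 4"
    using th by (simp add: modular_lambda_def diff_divide_distrib)
  then show "\<Lambda>2\<^sup>2 = 1 - modular_lambda \<tau>2" using m2 by simp
  \<comment> \<open>The normalisation 4 / \<pi>^2 cancels the two factors \<pi> / 2 of K. Each F is
    a square of \<open>theta3\<close>, and \<Lambda>1, \<Lambda>2 turn one of them into a square of
    \<open>theta2\<close> or \<open>theta4\<close>.\<close>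
  have "Period0 \<Lambda>1 \<Lambda>2 = (\<Lambda>1 + \<Lambda>2) * hypF (\<Lambda>1\<^sup>2) * hypF (1 - \<Lambda>2\<^sup>2)"
    unfolding Period0_def K by (simp add: power2_eq_square)
  then show "Period0 \<Lambda>1 \<Lambda>2 = Period0_modular \<tau>1 \<tau>2"
    unfolding Period0_modular_def T1 T2 by (simp add: algebra_simps)
qed

theorem mainTheorem2:
  shows
    "(\<exists>U L1 L2. Lambda_coordinates U L1 L2) \<and>
     (\<forall>U L1 L2 x y v1 v2 \<Lambda>1 \<Lambda>2 \<tau>1 \<tau>2.
        Lambda_coordinates U L1 L2 \<and> (x, y) \<in> U \<and>
        \<Lambda>1 = L1 (x, y) \<and> \<Lambda>2 = L2 (x, y) \<and>
        exp (v1 / 2) = \<Lambda>1 \<and> exp v2 = 1 - \<Lambda>2\<^sup>2 \<and>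
        \<tau>1 = Period1 v1 \<Lambda>1 \<Lambda>2 / Period0 \<Lambda>1 \<Lambda>2 \<and>
        \<tau>2 = Period2 v2 \<Lambda>1 \<Lambda>2 / Period0 \<Lambda>1 \<Lambda>2
        \<longrightarrow>
        Period0 \<Lambda>1 \<Lambda>2 \<noteq> 0 \<and>
        \<tau>1 = \<i> * ellK_compl v1 / ellK (\<Lambda>1\<^sup>2) \<and>
        \<tau>2 = \<i> * ellK_compl v2 / ellK (1 - \<Lambda>2\<^sup>2) \<and>
        \<tau>1 \<in> upper_half \<and> \<tau>2 \<in> upper_half \<and>
        \<Lambda>1\<^sup>2 = modular_lambda \<tau>1 \<and>
        modular_lambda \<tau>1 = theta2 \<tau>1 ^ 4 / theta3 \<tau>1 ^ 4 \<and>
        \<Lambda>2\<^sup>2 = 1 - modular_lambda \<tau>2 \<and>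
        1 - modular_lambda \<tau>2 = theta4 \<tau>2 ^ 4 / theta3 \<tau>2 ^ 4 \<and>
        Period0 \<Lambda>1 \<Lambda>2 = Period0_modular \<tau>1 \<tau>2) \<and>
     modular_form2 (Gamma2 \<times> Gamma2) 1 1 chi_a (\<lambda>\<tau>1 \<tau>2. (theta2 \<tau>1)\<^sup>2 * (theta3 \<tau>2)\<^sup>2) \<and>
     modular_form2 (Gamma2 \<times> Gamma2) 1 1 chi_b (\<lambda>\<tau>1 \<tau>2. (theta4 \<tau>2)\<^sup>2 * (theta3 \<tau>1)\<^sup>2) \<and>
     modular_form2 Gamma2_period 1 1 trivial_character Period0_modular \<and>
     (\<forall>\<gamma>1\<in>Gamma2. \<forall>\<gamma>2\<in>Gamma2.
        transforms_under \<gamma>1 \<gamma>2 1 1 1 Period0_modular \<longleftrightarrow> (\<gamma>1, \<gamma>2) \<in> Gamma2_period) \<and>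
     modular_form2 (Gamma2 \<times> Gamma2) 0 0 trivial_character (\<lambda>\<tau>1 \<tau>2. modular_lambda \<tau>1) \<and>
     modular_form2 (Gamma2 \<times> Gamma2) 0 0 trivial_character (\<lambda>\<tau>1 \<tau>2. 1 - modular_lambda \<tau>2)"
proof (intro conjI allI impI)
  show "\<exists>U L1 L2. Lambda_coordinates U L1 L2" by (rule Lambda_coordinates_exist)
next
  fix U L1 L2 x y v1 v2 \<Lambda>1 \<Lambda>2 \<tau>1 \<tau>2
  assume A: "Lambda_coordinates U L1 L2 \<and> (x, y) \<in> U \<and>
        \<Lambda>1 = L1 (x, y) \<and> \<Lambda>2 = L2 (x, y) \<and>
        exp (v1 / 2) = \<Lambda>1 \<and> exp v2 = 1 - \<Lambda>2\<^sup>2 \<and>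
        \<tau>1 = Period1 v1 \<Lambda>1 \<Lambda>2 / Period0 \<Lambda>1 \<Lambda>2 \<and>
        \<tau>2 = Period2 v2 \<Lambda>1 \<Lambda>2 / Period0 \<Lambda>1 \<Lambda>2"
  then have "norm (\<Lambda>1\<^sup>2) < 1" "norm (1 - \<Lambda>2\<^sup>2) < 1" unfolding Lambda_coordinates_def by blast+
  moreover have "Re \<Lambda>2 > 0" "\<Lambda>1 + \<Lambda>2 \<noteq> 0"
    using A Lambda2_Re_pos Lambda_sum_nonzero by auto
  ultimately have "norm (\<Lambda>1\<^sup>2) < 1" "norm (1 - \<Lambda>2\<^sup>2) < 1" "Re \<Lambda>2 > 0" "\<Lambda>1 + \<Lambda>2 \<noteq> 0"
    "exp (v1 / 2) = \<Lambda>1" "exp v2 = 1 - \<Lambda>2\<^sup>2"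
    using A by blast+
  note M = period_mirror_map[OF this]
  have \<tau>: "\<tau>1 = Period1 v1 \<Lambda>1 \<Lambda>2 / Period0 \<Lambda>1 \<Lambda>2" "\<tau>2 = Period2 v2 \<Lambda>1 \<Lambda>2 / Period0 \<Lambda>1 \<Lambda>2"
    using A by blast+
  show "Period0 \<Lambda>1 \<Lambda>2 \<noteq> 0" "\<tau>1 = \<i> * ellK_compl v1 / ellK (\<Lambda>1\<^sup>2)" "\<tau>2 = \<i> * ellK_compl v2 / ellK (1 - \<Lambda>2\<^sup>2)"
    "\<tau>1 \<in> upper_half" "\<tau>2 \<in> upper_half" "\<Lambda>1\<^sup>2 = modular_lambda \<tau>1" "\<Lambda>2\<^sup>2 = 1 - modular_lambda \<tau>2"
    "1 - modular_lambda \<tau>2 = theta4 \<tau>2 ^ 4 / theta3 \<tau>2 ^ 4" "Period0 \<Lambda>1 \<Lambda>2 = Period0_modular \<tau>1 \<tau>2"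
    unfolding \<tau> by (fact M)+
  show "modular_lambda \<tau>1 = theta2 \<tau>1 ^ 4 / theta3 \<tau>1 ^ 4" by (rule modular_lambda_def)
next
  show "modular_form2 (Gamma2 \<times> Gamma2) 1 1 chi_a (\<lambda>\<tau>1 \<tau>2. (theta2 \<tau>1)\<^sup>2 * (theta3 \<tau>2)\<^sup>2)"
    unfolding modular_form2_def using transforms_a
    by (auto intro!: meromorphic_extended_weight_1 holomorphic_extended_thetas)
next
  have e: "(\<lambda>\<tau>1 \<tau>2. (theta4 \<tau>2)\<^sup>2 * (theta3 \<tau>1)\<^sup>2) = (\<lambda>\<tau>1 \<tau>2. (theta3 \<tau>1)\<^sup>2 * (theta4 \<tau>2)\<^sup>2)"
    by (simp add: mult.commute)
  have ext_b: "holomorphic_extended (\<lambda>\<tau>1 \<tau>2. (theta4 \<tau>2)\<^sup>2 * (theta3 \<tau>1)\<^sup>2)"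
    unfolding e by (rule holomorphic_extended_thetas) auto
  then show "modular_form2 (Gamma2 \<times> Gamma2) 1 1 chi_b (\<lambda>\<tau>1 \<tau>2. (theta4 \<tau>2)\<^sup>2 * (theta3 \<tau>1)\<^sup>2)"
    unfolding modular_form2_def using transforms_b by (auto intro!: meromorphic_extended_weight_1)
  have "holomorphic_extended Period0_modular"
    unfolding Period0_modular_def[abs_def]
    by (intro holomorphic_extended_add ext_b holomorphic_extended_thetas) auto
  then show "modular_form2 Gamma2_period 1 1 trivial_character Period0_modular"
    unfolding modular_form2_def using Period0_modular_transforms_iff
    by (auto intro!: meromorphic_extended_weight_1 simp: Gamma2_period_def)
next
  show "\<forall>\<gamma>1\<in>Gamma2. \<forall>\<gamma>2\<in>Gamma2.
        transforms_under \<gamma>1 \<gamma>2 1 1 1 Period0_modular \<longleftrightarrow> (\<gamma>1, \<gamma>2) \<in> Gamma2_period"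
    using Period0_modular_transforms_iff by blast
next
  show "modular_form2 (Gamma2 \<times> Gamma2) 0 0 trivial_character (\<lambda>\<tau>1 \<tau>2. modular_lambda \<tau>1)"
    "modular_form2 (Gamma2 \<times> Gamma2) 0 0 trivial_character (\<lambda>\<tau>1 \<tau>2. 1 - modular_lambda \<tau>2)"
    unfolding modular_form2_def using meromorphic_extended_lambda
    by (auto simp: transforms_under_def modular_lambda_Gamma2)
qed

end
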